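(* Let $\varepsilon\in[0,1)$ and $\rho\ge0$ with $(\rho,\varepsilon)\ne(0,\frac12)$. Let $x,y\in\mathbb Z$ and let $c,s,t\in\mathbb C$ satisfy $0<|c|<1$, $0<|s|<1$ and $\sqrt{|cs|}<|t|<1/\sqrt{|cs|}$. Then $$\sum_{n=-\infty}^\infty\hat m_n(x;-\tfrac12+i\rho,\varepsilon,c)\,\hat m_n(y;-\tfrac12+i\rho,\varepsilon,s)\,t^n$$ $$=t^y(1-s)^{2\varepsilon+y}(1-c)^{2\varepsilon+y}(1-\sqrt{c}\sqrt{s}\,t)^{-2\varepsilon-x-y}(\sqrt s\,t-\sqrt c)^{x-y}\,c^{\frac x2}s^{\frac y2}\,\frac{|\Gamma(x+\varepsilon+\frac12+i\rho)|^2}{\Gamma(1+x-y)}$$ $$\times\ {}_2F_1\!\left({-y-\varepsilon+\frac12+i\rho,\ -y-\varepsilon+\frac12-i\rho\atop1+x-y};\frac{(\sqrt c-\sqrt s\,t)(\sqrt c-\sqrt s/t)}{(1-c)(s-1)}\right).$$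
   Context: Meixner functions: for $n,x\in\mathbb Z$, $$\hat m_n(x;\lambda,\varepsilon,c)=\left(\frac{1-c}{\sqrt c}\right)^{-n}\frac{\sqrt{\Gamma(n+\lambda+\varepsilon+1)\,\Gamma(n+\varepsilon-\lambda)}}{\Gamma(n+1-x)}\ {}_2F_1\!\left({n+\varepsilon+\lambda+1,\ n+\varepsilon-\lambda\atop n+1-x};\frac c{c-1}\right).$$ For $\lambda=-\frac12+i\rho$ the radicand equals $|\Gamma(n+\varepsilon+\frac12+i\rho)|^2>0$ and the positive root is taken. Conventions: $\sqrt c,\sqrt s$ are principal square roots, $c^{x/2}=(\sqrt c)^x$, $s^{y/2}=(\sqrt s)^y$, and the non-integer powers of $1-s$, $1-c$, $1-\sqrt c\sqrt s\,t$ (all of positive real part) are principal. ${}_2F_1$ is taken as its analytic continuation to $\mathbb C\setminus[1,\infty)$. The quotient $\frac1{\Gamma(C)}{}_2F_1(A,B;C;z)$ is the regularized hypergeometric function, i.e. the analytic continuation of $\sum_{k\ge0}\frac{(A)_k(B)_k}{\Gamma(C+k)k!}z^k$, defined also when $C$ is a non-positive integer. If $x<y$ and $\sqrt s\,t=\sqrt c$, the right-hand side is understood by continuity (the zero of the regularized hypergeometric function cancels the negative power). *)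

theory Defs
  imports "HOL-Analysis.Analysis"
begin

text \<open>
  The Gauss series divided by \<open>Gamma C\<close>.  Since \<^const>\<open>rGamma\<close> vanishes at the poles of
  \<^const>\<open>Gamma\<close>, this makes sense for every \<open>C\<close>, non-positive integers included.
\<close>

definition hyp2F1_reg_series :: "complex \<Rightarrow> complex \<Rightarrow> complex \<Rightarrow> complex \<Rightarrow> complex" where
  "hyp2F1_reg_series A B C z =
     (\<Sum>k. pochhammer A k * pochhammer B k * rGamma (C + of_nat k) / fact k * z ^ k)"

definition cut_plane :: "complex set" where
  "cut_plane = - (complex_of_real ` {1..})"

text \<open>
  The regularized hypergeometric function \<open>2F1(A,B;C;z) / Gamma C\<close> on the cut plane, as the value
  at \<open>z\<close> of the analytic continuation of the series.  The cut plane is connected, so the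
  continuation \<open>F\<close> is unique on it; on the cut itself the value is unspecified.
\<close>

definition hyp2F1_reg :: "complex \<Rightarrow> complex \<Rightarrow> complex \<Rightarrow> complex \<Rightarrow> complex" where
  "hyp2F1_reg A B C z =
     (THE w. \<exists>F. F holomorphic_on cut_plane \<and>
                 (\<forall>u\<in>ball 0 1. F u = hyp2F1_reg_series A B C u) \<and> F z = w)"

text \<open>
  The Meixner functions.  For \<open>l = -1/2 + \<i>\<rho>\<close> the radicand is a positive real, so that
  the principal root \<^const>\<open>csqrt\<close> is the positive root.
\<close>

definition meixner :: "int \<Rightarrow> int \<Rightarrow> complex \<Rightarrow> real \<Rightarrow> complex \<Rightarrow> complex" where
  "meixner n x l \<epsilon> c =
     ((1 - c) / csqrt c) powi (- n) *
     csqrt (Gamma (of_int n + l + of_real \<epsilon> + 1) * Gamma (of_int n + of_real \<epsilon> - l)) *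
     hyp2F1_reg (of_int n + of_real \<epsilon> + l + 1) (of_int n + of_real \<epsilon> - l)
       (of_int (n + 1 - x)) (c / (c - 1))"

definition meixner_bilinear_formula ::
  "real \<Rightarrow> real \<Rightarrow> int \<Rightarrow> int \<Rightarrow> complex \<Rightarrow> complex \<Rightarrow> complex \<Rightarrow> complex" where
  "meixner_bilinear_formula \<rho> \<epsilon> x y c s t =
     t powi y *
     (1 - s) powr of_real (2 * \<epsilon> + of_int y) *
     (1 - c) powr of_real (2 * \<epsilon> + of_int y) *
     (1 - csqrt c * csqrt s * t) powr of_real (- 2 * \<epsilon> - of_int x - of_int y) *
     (csqrt s * t - csqrt c) powi (x - y) *
     csqrt c powi x * csqrt s powi y *
     of_real ((cmod (Gamma (of_int x + of_real \<epsilon> + 1/2 + \<i> * of_real \<rho>)))\<^sup>2) *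
     hyp2F1_reg (- of_int y - of_real \<epsilon> + 1/2 + \<i> * of_real \<rho>)
       (- of_int y - of_real \<epsilon> + 1/2 - \<i> * of_real \<rho>)
       (of_int (1 + x - y))
       ((csqrt c - csqrt s * t) * (csqrt c - csqrt s / t) / ((1 - c) * (s - 1)))"

text \<open>
  The formula, extended by continuity in \<open>t\<close> to the point where a negative power of zero
  meets a zero of the regularized hypergeometric function.
\<close>

definition meixner_bilinear_rhs ::
  "real \<Rightarrow> real \<Rightarrow> int \<Rightarrow> int \<Rightarrow> complex \<Rightarrow> complex \<Rightarrow> complex \<Rightarrow> complex" where
  "meixner_bilinear_rhs \<rho> \<epsilon> x y c s t =
     (if x < y \<and> csqrt s * t = csqrt c
      then Lim (at t) (meixner_bilinear_formula \<rho> \<epsilon> x y c s)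
      else meixner_bilinear_formula \<rho> \<epsilon> x y c s t)"

end

theory Submission
  imports Defs "HOL-Complex_Analysis.Complex_Analysis"
begin

text \<open>
  Put \<open>\<alpha> = \<epsilon> + 1/2 + \<i> \<rho>\<close>, \<open>\<beta> = \<epsilon> + 1/2 - \<i> \<rho>\<close> and \<open>P = csqrt c\<close>.  By Pfaff's
  transformation the Meixner function is, up to elementary factors, the coefficient of \<open>u powi (n - x)\<close> in
  \<open>(1 - P u) powr (- \<alpha> - x) * (1 - P / u) powr (x + \<beta> - 1)\<close>, and also the same expression with \<open>\<alpha>\<close> and
  \<open>\<beta>\<close> exchanged.  Using one form for each factor, the bilinear sum becomes a single coefficient
  of a product of four binomials, with singularities \<open>csqrt c\<close> and \<open>Q = csqrt s * t\<close> inside and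
  \<open>1 / csqrt c\<close> and \<open>1 / R = t / csqrt s\<close> outside the contour; the bounds on \<open>t\<close> say that such a contour
  exists.  The exponents are such that the Moebius substitution \<open>v = (u - Q) / (1 - R u)\<close> removes two of the
  factors, which leaves a hypergeometric series when the parameters are small.

  For general parameters, replace \<open>P, R\<close> by \<open>z P, z R\<close> in the factors that are regular inside: the
  coefficient is then a power series in \<open>z\<close> that converges beyond \<open>z = 1\<close>, and the identity theorem
  applies as soon as the hypergeometric argument stays in the cut plane.  That argument \<open>w\<close> satisfies
  \<open>1 - w = (1 - a) (1 - b) / ((1 - c) (1 - s))\<close> with \<open>a b = c s\<close> in the unit disc, and
  \<open>(1 - a b) / ((1 - a) (1 - b)) = 1 / (1 - a) + 1 / (1 - b) - 1\<close> has positive real part.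
\<close>

section \<open>Binomial series and contour integrals on the unit circle\<close>

text \<open>The two roots in a product of Meixner functions multiply to the Gamma values at
  \<open>N + \<alpha>\<close> and \<open>N + \<beta>\<close>, so each function can absorb one of
  them. With the \<alpha>-form for \<open>x\<close> and the \<beta>-form for \<open>y\<close>, the
  exponents of the two factors regular inside add up to \<open>1 - (y - x)\<close> and those of the
  other two to \<open>1 + (y - x)\<close>. Hence the leftover powers of \<open>1 - R u\<close> and
  \<open>1 - Q / u\<close> are integral and merge with the Jacobian of \<open>v\<close>; the same
  form used twice would leave a discrepancy \<open>\<alpha> - \<beta> = 2 \<i> \<rho>\<close>.
  \<open>hyp2F1_reg\<close> has a usable value only once a continuation to the cut plane is known to
  exist. Both this existence and Pfaff's transformation come out as special cases of the correlation
  identity for small parameters. Integer upper parameters would cause poles of Gamma and divisions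
  by zero Pochhammer symbols; the excluded pair is the one where \<alpha> and \<beta> are integers.
  The sign of \<open>y - x\<close> decides which pair of binomials carries the index shift, and for
  \<open>x < y\<close> the sum is found in a form without the removable singularity.\<close>

definition rising_coeff :: "complex \<Rightarrow> nat \<Rightarrow> complex" where
  "rising_coeff a k = pochhammer a k / fact k"

lemma negative_binomial_series:
  fixes z :: complex
  assumes "norm z < 1"
  shows "(\<lambda>k. rising_coeff a k * z ^ k) sums ((1 - z) powr (- a))"
proof -
  have "((- a) gchoose k) * (- z) ^ k = rising_coeff a k * z ^ k" for k
    by (simp add: rising_coeff_def gbinomial_pochhammer power_minus[of z])
  with gen_binomial_complex[of "- z" "- a"] assms show ?thesis by simp
qed

lemma summable_norm_rising_coeff:
  fixes z :: complex
  assumes "norm z < 1"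
  shows "summable (\<lambda>k. norm (rising_coeff a k * z ^ k))"
proof -
  obtain r where r: "norm z < r" "r < 1" using dense[OF assms] by blast
  hence "norm (of_real r :: complex) < 1" using norm_ge_zero[of z] r by (simp del: norm_ge_zero)
  from negative_binomial_series[OF this] show ?thesis
    by (rule powser_insidea[OF sums_summable]) (use r norm_ge_zero[of z] in simp)
qed

text \<open>The coefficient of \<open>u ^ m\<close> in \<open>(1 - P u) powr (- a) * (1 - R u) powr (- b)\<close>.\<close>

definition binomial2_coeff :: "complex \<Rightarrow> complex \<Rightarrow> complex \<Rightarrow> complex \<Rightarrow> nat \<Rightarrow> complex" where
  "binomial2_coeff a b P R m =
     (\<Sum>i\<le>m. rising_coeff a i * P ^ i * (rising_coeff b (m - i) * R ^ (m - i)))"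

text \<open>Homogeneity of degree \<open>m\<close>: this is what turns the scaling of
  \<open>P\<close> and \<open>R\<close> by \<open>z\<close> into a power series in
  \<open>z\<close>.\<close>

lemma binomial2_coeff_scale:
  "binomial2_coeff a b (z * P) (z * R) m = z ^ m * binomial2_coeff a b P R m"
  unfolding binomial2_coeff_def sum_distrib_left
proof (rule sum.cong)
  fix i assume "i \<in> {..m}"
  hence "z ^ m = z ^ i * z ^ (m - i)" by (simp flip: power_add)
  thus "rising_coeff a i * (z * P) ^ i * (rising_coeff b (m - i) * (z * R) ^ (m - i)) =
        z ^ m * (rising_coeff a i * P ^ i * (rising_coeff b (m - i) * R ^ (m - i)))"
    by (simp add: power_mult_distrib)
qed simp

lemma binomial2_series:
  fixes u :: complex
  assumes "norm (P * u) < 1" "norm (R * u) < 1"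
  shows binomial2_series_sums:
      "(\<lambda>m. binomial2_coeff a b P R m * u ^ m) sums
         ((1 - P * u) powr (- a) * (1 - R * u) powr (- b))"
    and summable_norm_binomial2: "summable (\<lambda>m. norm (binomial2_coeff a b P R m * u ^ m))"
proof -
  define f where "f = (\<lambda>k. rising_coeff a k * (P * u) ^ k)"
  define g where "g = (\<lambda>k. rising_coeff b k * (R * u) ^ k)"
  have f: "summable (\<lambda>k. norm (f k))" and g: "summable (\<lambda>k. norm (g k))"
    unfolding f_def g_def by (rule summable_norm_rising_coeff, fact)+
  have eq: "(\<Sum>i\<le>m. f i * g (m - i)) = binomial2_coeff a b P R m * u ^ m" for m
    using binomial2_coeff_scale[of a b u P R m]
    unfolding binomial2_coeff_def f_def g_def by (simp add: mult_ac)
  have "suminf f = (1 - P * u) powr (- a)" "suminf g = (1 - R * u) powr (- b)"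
    unfolding f_def g_def using negative_binomial_series assms by (blast intro: sums_unique[symmetric])+
  with Cauchy_product_sums[OF f g] eq
  show "(\<lambda>m. binomial2_coeff a b P R m * u ^ m) sums
         ((1 - P * u) powr (- a) * (1 - R * u) powr (- b))" by simp
  have "summable (\<lambda>m. \<Sum>i\<le>m. norm (f i) * norm (g (m - i)))"
    by (rule summable_Cauchy_product) (use f g in simp_all)
  thus "summable (\<lambda>m. norm (binomial2_coeff a b P R m * u ^ m))"
  proof (rule summable_comparison_test')
    fix m show "norm (norm (binomial2_coeff a b P R m * u ^ m)) \<le> (\<Sum>i\<le>m. norm (f i) * norm (g (m - i)))"
      unfolding eq[symmetric] norm_mult[symmetric] real_norm_def abs_norm_cancel by (rule norm_sum)
  qed
qed

lemma one_minus_mult_nonzero: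
  fixes R u :: complex
  assumes "norm R < 1" "norm u \<le> 1"
  shows "1 - R * u \<noteq> 0"
proof
  assume "1 - R * u = 0"
  hence "norm (R * u) = 1" by (metis eq_iff_diff_eq_0 norm_one)
  moreover have "norm (R * u) \<le> norm R * 1" unfolding norm_mult by (rule mult_left_mono) (use assms in auto)
  ultimately show False using assms by simp
qed

text \<open>The derivative of \<open>v\<close> is \<open>(1 - R * Q) / (1 - R * u)\<^sup>2\<close>,
  so the integrand is a constant times \<open>v powi (k - 1)\<close> times \<open>v'\<close> with
  \<open>k = i - j - n\<close>. For \<open>k \<noteq> 0\<close> it has a primitive along the circle,
  where \<open>v\<close> has no zero; for \<open>k = 0\<close> Cauchy's formula at the simple pole
  \<open>Q\<close> gives the value.\<close>

lemma moebius_circle_integral: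
  fixes Q R :: complex and i j n :: nat
  assumes "norm Q < 1" "norm R < 1"
  defines "v \<equiv> (\<lambda>u. (u - Q) / (1 - R * u))"
  shows "((\<lambda>u. v u ^ i * inverse (v u) ^ j * (inverse (v u) ^ Suc n / (1 - R * u)\<^sup>2))
           has_contour_integral (if i = n + j then 2 * pi * \<i> / (1 - R * Q) else 0)) (circlepath 0 1)"
proof -
  have nzR: "1 - R * u \<noteq> 0" if "norm u \<le> 1" for u
    using assms(2) that by (rule one_minus_mult_nonzero)
  have nzQ: "u - Q \<noteq> 0" if "norm u = 1" for u using assms that by auto
  have v0: "v u \<noteq> 0" if "norm u = 1" for u
    using nzR[of u] nzQ[of u] that by (simp add: v_def)
  define k where "k = int i - int j - int n"
  have form: "v u ^ i * inverse (v u) ^ j * (inverse (v u) ^ Suc n / (1 - R * u)\<^sup>2) =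
                v u powi (k - 1) / (1 - R * u)\<^sup>2" if "norm u = 1" for u
  proof -
    have "k - 1 = int i + (- int j) + (- int (Suc n))" by (simp add: k_def)
    also have "v u powi \<dots> = v u ^ i * inverse (v u) ^ j * inverse (v u) ^ Suc n"
      by (simp only: power_int_add[OF disjI1[OF v0[OF that]]] power_int_minus power_int_of_nat power_inverse)
    finally show ?thesis by simp
  qed
  have "((\<lambda>u. v u powi (k - 1) / (1 - R * u)\<^sup>2)
           has_contour_integral (if i = n + j then 2 * pi * \<i> / (1 - R * Q) else 0)) (circlepath 0 1)"
  proof (cases "i = n + j")
    case True
    have "((\<lambda>u. (1 / (1 - R * u)) / (u - Q)) has_contour_integral (2 * of_real pi * \<i> * (1 / (1 - R * Q))))
         (circlepath 0 1)"
      by (rule Cauchy_integral_circlepath_simple)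
         (use assms nzR in \<open>auto intro!: holomorphic_intros\<close>)
    moreover have "(1 / (1 - R * u)) / (u - Q) = v u powi (k - 1) / (1 - R * u)\<^sup>2" if "u \<in> path_image (circlepath 0 1)" for u
    proof -
      have eq: "v u powi (k - 1) = inverse (v u)" using True by (simp add: k_def power_int_minus)
      show ?thesis unfolding eq using nzR[of u] nzQ[of u] that by (simp add: v_def power2_eq_square divide_simps)
    qed
    ultimately show ?thesis using True by (auto intro: has_contour_integral_eq)
  next
    case False
    hence k: "k \<noteq> 0" by (auto simp: k_def)
    have Q: "1 - R * Q \<noteq> 0" using nzR assms by simp
    define F where "F = (\<lambda>u. v u powi k / (of_int k * (1 - R * Q)))"
    have "((\<lambda>u. v u powi (k - 1) / (1 - R * u)\<^sup>2) has_contour_integral 0) (circlepath 0 1)"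
    proof (rule Cauchy_theorem_primitive)
      fix u :: complex assume u: "u \<in> sphere 0 1"
      have nz: "1 - R * u \<noteq> 0" using nzR[of u] u by auto
      have v': "(v has_field_derivative ((1 - R * Q) / (1 - R * u)\<^sup>2)) (at u within sphere 0 1)"
        unfolding v_def
        using nz by (auto intro!: derivative_eq_intros simp: power2_eq_square divide_simps) (simp add: algebra_simps)
      have "v u \<noteq> 0" using v0 u by simp
      hence "((\<lambda>u. v u powi k) has_field_derivative
               of_int k * v u powi (k - 1) * ((1 - R * Q) / (1 - R * u)\<^sup>2)) (at u within sphere 0 1)"
        by (auto intro!: derivative_eq_intros v')
      from DERIV_cdivide[OF this, of "of_int k * (1 - R * Q)"]
      show "(F has_field_derivative v u powi (k - 1) / (1 - R * u)\<^sup>2) (at u within sphere 0 1)"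
        unfolding F_def using k Q by simp
    qed simp_all
    thus ?thesis using False by simp
  qed
  thus ?thesis
  proof (rule has_contour_integral_eq)
    fix u :: complex assume "u \<in> path_image (circlepath 0 1)"
    hence "norm u = 1" by simp
    from form[OF this, symmetric]
    show "v u powi (k - 1) / (1 - R * u)\<^sup>2 =
          v u ^ i * inverse (v u) ^ j * (inverse (v u) ^ Suc n / (1 - R * u)\<^sup>2)" .
  qed
qed

text \<open>
  Up to the factor \<open>1 - R Q\<close>, the weight in the integral is \<open>v powi (- n - 1)\<close> times the derivative of \<open>v\<close>,
  so that termwise integration picks out the constant term in \<open>v\<close>.  The case \<open>Q = R = 0\<close> is the
  usual Parseval identity.
\<close>

lemma moebius_circle_sums:
  fixes Q R :: complex and A B :: "nat \<Rightarrow> complex" and n :: nat and r :: real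
  assumes "norm Q < 1" "norm R < 1"
  defines "v \<equiv> (\<lambda>u. (u - Q) / (1 - R * u))"
  assumes le: "\<And>u. norm u = 1 \<Longrightarrow> norm (v u) \<le> r" "\<And>u. norm u = 1 \<Longrightarrow> norm (inverse (v u)) \<le> r"
    and A: "summable (\<lambda>i. norm (A i) * r ^ i)" and B: "summable (\<lambda>i. norm (B i) * r ^ i)"
  shows "(\<lambda>j. A (n + j) * B j) sums
           ((1 - R * Q) / (2 * pi * \<i>) * contour_integral (circlepath 0 1)
             (\<lambda>u. (\<Sum>i. A i * v u ^ i) * (\<Sum>j. B j * inverse (v u) ^ j) *
                  (inverse (v u) ^ Suc n / (1 - R * u)\<^sup>2)))"
proof -
  define wt where "wt = (\<lambda>u. inverse (v u) ^ Suc n / (1 - R * u)\<^sup>2)"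
  have nzR: "1 - R * u \<noteq> 0" if "norm u \<le> 1" for u
    using assms(2) that by (rule one_minus_mult_nonzero)
  have nzQ: "u - Q \<noteq> 0" if "norm u = 1" for u using assms that by auto
  have RQ: "1 - R * Q \<noteq> 0" using nzR assms by simp
  have cont_v: "continuous_on (sphere 0 1) v" unfolding v_def
    by (intro continuous_intros) (use nzR in auto)
  have v0: "v u \<noteq> 0" if "norm u = 1" for u
    using nzR[of u] nzQ[of u] that by (simp add: v_def)
  have UA: "uniform_limit (sphere 0 1) (\<lambda>N u. \<Sum>i<N. A i * v u ^ i) (\<lambda>u. \<Sum>i. A i * v u ^ i) sequentially"
    by (rule Weierstrass_m_test[OF _ A])
       (auto simp: norm_mult norm_power intro!: mult_left_mono power_mono le)
  \<comment> \<open>Truncating \<open>i\<close> at \<open>n + N\<close> while \<open>j\<close> stops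
    at \<open>N\<close> ensures that every \<open>j < N\<close> meets its partner
    \<open>i = n + j\<close>.\<close>
  have UA': "uniform_limit (sphere 0 1) (\<lambda>N u. \<Sum>i<n+N. A i * v u ^ i) (\<lambda>u. \<Sum>i. A i * v u ^ i) sequentially"
    using filterlim_compose[OF UA filterlim_add_const_nat_at_top[of n]] by (simp add: add.commute)
  have UB: "uniform_limit (sphere 0 1) (\<lambda>N u. \<Sum>i<N. B i * inverse (v u) ^ i) (\<lambda>u. \<Sum>i. B i * inverse (v u) ^ i) sequentially"
    by (rule Weierstrass_m_test[OF _ B])
       (auto simp: norm_mult norm_power norm_inverse intro!: mult_left_mono power_mono le[unfolded norm_inverse])
  have cA: "continuous_on (sphere 0 1) (\<lambda>u. \<Sum>i. A i * v u ^ i)"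
    by (rule uniform_limit_theorem[OF _ UA]) (auto intro!: always_eventually continuous_intros cont_v)
  have cB: "continuous_on (sphere 0 1) (\<lambda>u. \<Sum>i. B i * inverse (v u) ^ i)"
    by (rule uniform_limit_theorem[OF _ UB]) (auto intro!: always_eventually continuous_intros cont_v v0)
  have cwt: "continuous_on (sphere 0 1) wt" unfolding wt_def
    by (intro continuous_intros cont_v) (use v0 nzR in auto)
  have bd: "bounded (f ` sphere 0 1)" if "continuous_on (sphere 0 1) f" for f :: "complex \<Rightarrow> complex"
    using that by (intro compact_imp_bounded compact_continuous_image) auto
  define F where "F = (\<lambda>N u. (\<Sum>i<n+N. A i * v u ^ i) * (\<Sum>j<N. B j * inverse (v u) ^ j) * wt u)"
  define G where "G = (\<lambda>u. (\<Sum>i. A i * v u ^ i) * (\<Sum>j. B j * inverse (v u) ^ j) * wt u)"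
  have UF: "uniform_limit (sphere 0 1) F G sequentially"
    unfolding F_def G_def
    by (intro uniform_lim_mult UA' UB uniform_limit_const bd continuous_intros cA cB cwt)
  have int: "(F N has_contour_integral (2 * pi * \<i> / (1 - R * Q) * (\<Sum>j<N. A (n + j) * B j))) (circlepath 0 1)" for N
  proof -
    have "((\<lambda>u. \<Sum>j<N. \<Sum>i<n+N. (A i * B j) * (v u ^ i * inverse (v u) ^ j * wt u)) has_contour_integral
            (\<Sum>j<N. \<Sum>i<n+N. (A i * B j) * (if i = n + j then 2 * pi * \<i> / (1 - R * Q) else 0))) (circlepath 0 1)"
      unfolding wt_def v_def
      by (intro has_contour_integral_sum has_contour_integral_lmul moebius_circle_integral assms) auto
    moreover have "(\<Sum>j<N. \<Sum>i<n+N. (A i * B j) * (v u ^ i * inverse (v u) ^ j * wt u)) = F N u" for u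
      unfolding F_def by (subst sum.swap) (simp add: sum_product sum_distrib_left sum_distrib_right mult_ac)
    moreover have "(\<Sum>j<N. \<Sum>i<n+N. (A i * B j) * (if i = n + j then 2 * pi * \<i> / (1 - R * Q) else 0)) =
        2 * pi * \<i> / (1 - R * Q) * (\<Sum>j<N. A (n + j) * B j)"
      by (simp add: if_distrib sum_distrib_left sum_divide_distrib mult_ac cong: if_cong)
    ultimately show ?thesis by simp
  qed
  have "(\<lambda>N. contour_integral (circlepath 0 1) (F N)) \<longlonglongrightarrow> contour_integral (circlepath 0 1) G"
    by (rule contour_integral_uniform_limit_circlepath[OF _ UF])
       (auto simp: contour_integrable_on_def intro!: always_eventually exI int)
  hence "(\<lambda>N. 2 * pi * \<i> / (1 - R * Q) * (\<Sum>j<N. A (n + j) * B j)) \<longlonglongrightarrow> contour_integral (circlepath 0 1) G"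
    by (simp add: contour_integral_unique[OF int])
  from tendsto_mult_left[OF this, of "(1 - R * Q) / (2 * pi * \<i>)"]
  have "(\<lambda>N. \<Sum>j<N. A (n + j) * B j) \<longlonglongrightarrow> (1 - R * Q) / (2 * pi * \<i>) * contour_integral (circlepath 0 1) G"
    using RQ by simp
  thus ?thesis unfolding sums_def G_def wt_def .
qed

section \<open>Principal logarithms in the right half plane\<close>

lemma Ln_mult_right_half_plane:
  assumes "Re a > 0" "Re b > 0"
  shows "Ln (a * b) = Ln a + Ln b"
proof -
  have "a \<noteq> 0" "b \<noteq> 0" using assms by auto
  moreover from this have "\<bar>Im (Ln a)\<bar> < pi / 2" "\<bar>Im (Ln b)\<bar> < pi / 2"
    using assms Re_Ln_pos_lt[of a] Re_Ln_pos_lt[of b] by blast+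
  ultimately show ?thesis by (intro Ln_times_simple) auto
qed

lemma Ln_divide_right_half_plane:
  assumes "Re a > 0" "Re b > 0"
  shows "Ln (a / b) = Ln a - Ln b"
proof -
  have nz: "a \<noteq> 0" "b \<noteq> 0" using assms by auto
  have "b \<notin> \<real>\<^sub>\<le>\<^sub>0" using assms by (auto simp: complex_nonpos_Reals_iff)
  moreover have "Re (inverse b) > 0" using assms nz
    by (simp add: Re_divide inverse_eq_divide sum_power2_gt_zero_iff complex_eq_iff)
  ultimately show ?thesis
    using Ln_mult_right_half_plane[of a "inverse b"] assms nz by (simp add: divide_inverse Ln_inverse)
qed

lemma Re_one_minus_pos: "norm z < 1 \<Longrightarrow> Re (1 - z) > 0" for z :: complex
  using complex_Re_le_cmod[of z] by simp

section \<open>The regularized Gauss series inside the unit disc\<close>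

lemma rGamma_of_nat_Suc: "rGamma (of_nat (Suc n) + of_nat j :: complex) = 1 / fact (n + j)"
  using Gamma_fact[of "n + j", where 'a = complex] by (simp add: rGamma_inverse_Gamma add_ac divide_inverse)

text \<open>Ratio test with \<open>g k\<close> tending to \<open>z\<close>. Terms may vanish while
  \<open>C + k\<close> is a non-positive integer, so the recurrence of \<open>rGamma\<close> is
  divided by \<open>C + k\<close> only for \<open>k > norm C\<close>.\<close>

lemma summable_norm_hyp2F1_reg_series:
  fixes z :: complex
  assumes "norm z < 1"
  shows "summable (\<lambda>k. norm (pochhammer A k * pochhammer B k * rGamma (C + of_nat k) / fact k * z ^ k))"
proof (cases "z = 0")
  case True
  show ?thesis by (rule summable_finite[of "{0}"]) (auto simp: True power_0_left)
next
  case False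
  define f where "f = (\<lambda>k. pochhammer A k * pochhammer B k * rGamma (C + of_nat k) / fact k * z ^ k)"
  define g where "g = (\<lambda>k. (A + of_nat k) * (B + of_nat k) / ((C + of_nat k) * (1 + of_nat k)) * z)"
  obtain c where c: "norm z < c" "c < 1" using dense[OF assms] by blast
  have lim: "(\<lambda>k. norm (g k)) \<longlonglongrightarrow> norm z"
  proof -
    have tn: "(\<lambda>k. inverse (of_nat k) :: complex) \<longlonglongrightarrow> 0" by (rule lim_inverse_n)
    have "(\<lambda>k. (A * inverse (of_nat k) + 1) * (B * inverse (of_nat k) + 1) /
             ((C * inverse (of_nat k) + 1) * (inverse (of_nat k) + 1)) * z)
           \<longlonglongrightarrow> (A * 0 + 1) * (B * 0 + 1) / ((C * 0 + 1) * (0 + 1)) * z"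
      by (intro tendsto_intros tn) auto
    moreover have "eventually (\<lambda>k. (A * inverse (of_nat k) + 1) * (B * inverse (of_nat k) + 1) /
             ((C * inverse (of_nat k) + 1) * (inverse (of_nat k) + 1)) * z = g k) sequentially"
      using eventually_gt_at_top[of 0]
    proof eventually_elim
      case (elim k)
      hence k: "(of_nat k :: complex) \<noteq> 0" by simp
      have "X * inverse (of_nat k) + 1 = (X + of_nat k) / of_nat k" for X :: complex
        using k by (simp add: field_simps)
      moreover from this[of 1] have "inverse (of_nat k) + 1 = (1 + of_nat k) / (of_nat k :: complex)" by simp
      ultimately show ?case using k by (simp add: g_def)
    qed
    ultimately have "g \<longlonglongrightarrow> z" by (simp add: tendsto_cong)
    thus ?thesis by (rule tendsto_norm)
  qed
  have ev: "eventually (\<lambda>k. norm (g k) < c \<and> k > norm C) sequentially"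
    using order_tendstoD(2)[OF lim c(1)] eventually_gt_at_top[of "nat \<lceil>norm C\<rceil>"]
    by eventually_elim linarith
  then obtain N where N: "\<And>k. k \<ge> N \<Longrightarrow> norm (g k) < c \<and> k > norm C"
    by (auto simp: eventually_sequentially)
  have "summable (\<lambda>k. norm (f k))"
  proof (rule summable_ratio_test[OF c(2)])
    fix k assume k: "k \<ge> N"
    have nz: "C + of_nat k \<noteq> 0"
    proof
      assume "C + of_nat k = 0"
      hence "norm C = k" by (metis add_eq_0_iff norm_minus_cancel norm_of_nat)
      thus False using N[OF k] by simp
    qed
    have "rGamma (C + of_nat k) = (C + of_nat k) * rGamma (C + of_nat (Suc k))"
      using rGamma_plus1[of "C + of_nat k"] by (simp add: add_ac)
    hence "f (Suc k) = (A + of_nat k) * (B + of_nat k) / (1 + of_nat k) * z * (f k / (C + of_nat k))"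
      using nz by (simp add: f_def pochhammer_Suc mult_ac)
    hence "f (Suc k) = g k * f k" by (simp add: g_def mult_ac)
    thus "norm (norm (f (Suc k))) \<le> c * norm (norm (f k))"
      using N[OF k] by (auto simp: norm_mult intro!: mult_right_mono)
  qed
  thus ?thesis by (simp add: f_def)
qed

lemma hyp2F1_reg_series_sums:
  assumes "norm z < 1"
  shows "(\<lambda>k. pochhammer A k * pochhammer B k * rGamma (C + of_nat k) / fact k * z ^ k) sums
           hyp2F1_reg_series A B C z"
  unfolding hyp2F1_reg_series_def
  by (intro summable_sums summable_norm_cancel[OF summable_norm_hyp2F1_reg_series] assms)

text \<open>Shifted products of binomial coefficients are the terms of a Gauss series with lower
  parameter \<open>n + 1\<close>, because \<open>1 / fact (n + j)\<close> is the value of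
  \<open>rGamma\<close> at \<open>n + 1 + j\<close>.\<close>

lemma rising_coeff_hyp2F1_term:
  "rising_coeff a (n + j) * rising_coeff b j =
     pochhammer a n * (pochhammer (a + of_nat n) j * pochhammer b j *
       rGamma (of_nat (Suc n) + of_nat j) / fact j)"
  by (simp add: rising_coeff_def rGamma_of_nat_Suc pochhammer_product' del: of_nat_Suc)

text \<open>The constant is \<open>(9/8) / (7/8)\<close>. It keeps \<open>v\<close> so close to the
  unit circle that both binomial series in \<open>v\<close> and in \<open>1 / v\<close> still
  converge.\<close>

lemma moebius_circle_bounds:
  fixes Q R u :: complex
  assumes "norm Q \<le> 1/8" "norm R \<le> 1/8" "norm u = 1"
  shows "norm ((u - Q) / (1 - R * u)) \<le> 9/7" "norm (inverse ((u - Q) / (1 - R * u))) \<le> 9/7"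
proof -
  have "norm (R * u) \<le> 1/8" using assms by (simp add: norm_mult)
  hence "7/8 \<le> norm (1 - R * u)" "norm (1 - R * u) \<le> 9/8"
    using norm_triangle_ineq2[of 1 "R * u"] norm_triangle_ineq4[of 1 "R * u"] by simp_all
  moreover have "7/8 \<le> norm (u - Q)" "norm (u - Q) \<le> 9/8"
    using assms norm_triangle_ineq2[of u Q] norm_triangle_ineq4[of u Q] by simp_all
  ultimately have "norm (u - Q) / norm (1 - R * u) \<le> (9/8) / (7/8)" "norm (1 - R * u) / norm (u - Q) \<le> (9/8) / (7/8)"
    by (intro frac_le; linarith)+
  thus "norm ((u - Q) / (1 - R * u)) \<le> 9/7" "norm (inverse ((u - Q) / (1 - R * u))) \<le> 9/7"
    by (simp_all add: norm_divide)
qed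

lemma cancel_fractions:
  fixes X Y a b :: "'a :: field"
  assumes "X \<noteq> 0" "Y \<noteq> 0"
  shows "X * Y * (1 - a / Y * (b / X)) = X * Y - a * b"
  using assms by (simp add: field_simps)

lemma power_fraction_shift:
  fixes X Y :: "'a :: field"
  assumes "X \<noteq> 0" "Y \<noteq> 0"
  shows "X ^ n / X * inverse Y ^ Suc n = (X / Y) ^ Suc n / X\<^sup>2"
  using assms by (simp add: power_divide power_inverse power2_eq_square field_simps)

text \<open>The half-plane conditions make \<open>Ln\<close> additive on both sides of
  \<open>a * b = c * d * (1 - w)\<close>, so the factorization survives an arbitrary complex
  exponent on principal branches.\<close>

lemma moebius_linear_factor:
  fixes a b c d :: complex
  assumes "Re a > 0" "Re b > 0" "Re c > 0" "Re d > 0" "Re (c * d) > 0" "norm w < 1"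
    and "a * b = c * d * (1 - w)"
  shows "a powr e = b powr (- e) * c powr e * d powr e * (1 - w) powr e"
proof -
  have nz: "a \<noteq> 0" "b \<noteq> 0" "c \<noteq> 0" "d \<noteq> 0" using assms by auto
  have w: "Re (1 - w) > 0" by (rule Re_one_minus_pos) fact
  hence w0: "1 - w \<noteq> 0" by auto
  have "Ln a + Ln b = Ln (c * d * (1 - w))"
    using Ln_mult_right_half_plane[of a b] assms by simp
  also have "\<dots> = Ln c + Ln d + Ln (1 - w)"
    using assms w by (subst Ln_mult_right_half_plane) (auto simp: Ln_mult_right_half_plane)
  finally have "Ln a = Ln c + Ln d + Ln (1 - w) - Ln b" by (simp add: algebra_simps)
  thus ?thesis using nz w0
    by (simp only: powr_def if_False) (simp add: algebra_simps flip: exp_add)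
qed

text \<open>
  The same contour integral is evaluated twice, with \<open>u\<close> and with \<open>v = (u - Q) / (1 - R u)\<close> as the
  expansion variable; the conditions on the exponents make the factors \<open>1 - R u\<close> and \<open>1 - Q / u\<close> combine
  with the Jacobian, so that only two binomial series are left in the second evaluation.
\<close>

lemma binomial2_correlation_small:
  fixes P R P' Q a1 a2 b1 b2 :: complex and n :: nat
  assumes P: "norm P \<le> 1/8" and R: "norm R \<le> 1/8" and P': "norm P' \<le> 1/8" and Q: "norm Q \<le> 1/8"
    and a: "a1 + a2 = 1 - of_nat n" and b: "b1 + b2 = 1 + of_nat n"
  shows "(\<lambda>m. binomial2_coeff a1 a2 P R (n + m) * binomial2_coeff b1 b2 P' Q m) sums
     ((1 - P * Q) powr (- a1) * (1 - R * Q) powr (a1 + b1 - 1) * (1 - P' * R) powr (- b1) *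
      (pochhammer a1 n * ((P - R) / (1 - P * Q)) ^ n *
       hyp2F1_reg_series (a1 + of_nat n) b1 (of_nat (Suc n))
         ((P - R) * (P' - Q) / ((1 - P * Q) * (1 - P' * R)))))"
proof -
  have le64: "norm (x * y) \<le> 1/64" if "norm x \<le> 1/8" "norm y \<le> 1/8" for x y :: complex
    using mult_mono[OF that] by (simp add: norm_mult)
  have near: "63/64 \<le> norm (1 - x * y)" if "norm x \<le> 1/8" "norm y \<le> 1/8" for x y :: complex
    using norm_triangle_ineq2[of 1 "x * y"] le64[OF that] by simp
  have Re1: "Re (1 - x * y) > 0" if "norm x \<le> 1/8" "norm y \<le> 1/8" for x y :: complex
    by (rule Re_one_minus_pos) (use le64[OF that] in linarith)
  have nz1: "1 - x * y \<noteq> 0" if "norm x \<le> 1/8" "norm y \<le> 1/8" for x y :: complex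
    using Re1[OF that] by (metis less_irrefl zero_complex.simps(1))
  \<comment> \<open>The map \<open>v\<close> sends the singularity \<open>1 / P\<close> to
    \<open>1 / p\<close> and the singularity \<open>P'\<close> to \<open>q\<close>.\<close>
  define p where "p = (P - R) / (1 - P * Q)"
  define q where "q = (P' - Q) / (1 - P' * R)"
  define v where "v = (\<lambda>u. (u - Q) / (1 - R * u))"
  \<comment> \<open>Here \<open>16/63\<close> is \<open>(1/4) / (63/64)\<close>, and
    \<open>16/63 * 9/7 < 1\<close> is what the two expansions in \<open>v\<close> need.\<close>
  have frac: "norm ((x - y) / (1 - z * w)) \<le> 16/63" if "norm x \<le> 1/8" "norm y \<le> 1/8" "norm z \<le> 1/8" "norm w \<le> 1/8"
    for x y z w :: complex
  proof -
    have "norm (x - y) / norm (1 - z * w) \<le> (1/4) / (63/64)"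
      by (intro frac_le near that) (use norm_triangle_ineq4[of x y] that in simp_all)
    thus ?thesis by (simp add: norm_divide)
  qed
  have p: "norm p \<le> 16/63" and q: "norm q \<le> 16/63"
    unfolding p_def q_def by (intro frac P R P' Q)+
  have vb: "norm (v u) \<le> 9/7" "norm (inverse (v u)) \<le> 9/7" if "norm u = 1" for u
    unfolding v_def using moebius_circle_bounds[OF Q R that] by simp_all
  have pv: "norm (p * v u) < 1" and qv: "norm (q * inverse (v u)) < 1" if "norm u = 1" for u
    using mult_mono[OF p vb(1)[OF that]] mult_mono[OF q vb(2)[OF that]] by (simp_all add: norm_mult)
  have mult1: "norm (x * u) \<le> 1/8" "norm (x * inverse u) \<le> 1/8" if "norm x \<le> 1/8" "norm u = 1" for x u :: complex
    using that by (simp_all add: norm_mult norm_inverse)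
  define f where "f = (\<lambda>u. \<Sum>i. binomial2_coeff a1 a2 P R i * u ^ i)"
  define g where "g = (\<lambda>u. \<Sum>i. binomial2_coeff b1 b2 P' Q i * inverse u ^ i)"
  define F where "F = (\<lambda>u. \<Sum>i. (rising_coeff a1 i * p ^ i) * v u ^ i)"
  define G where "G = (\<lambda>u. \<Sum>i. (rising_coeff b1 i * q ^ i) * inverse (v u) ^ i)"
  define K where "K = (1 - P * Q) powr (- a1) * (1 - R * Q) powr (a1 + b1) * (1 - P' * R) powr (- b1)"
  have f: "f u = (1 - P * u) powr (- a1) * (1 - R * u) powr (- a2)"
   and g: "g u = (1 - P' * inverse u) powr (- b1) * (1 - Q * inverse u) powr (- b2)"
   and F: "F u = (1 - p * v u) powr (- a1)" and G: "G u = (1 - q * inverse (v u)) powr (- b1)"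
    if "norm u = 1" for u
  proof -
    have lt: "norm (x * u) < 1" "norm (x * inverse u) < 1" if "norm x \<le> 1/8" for x
      using mult1[OF that \<open>norm u = 1\<close>] by linarith+
    show "f u = (1 - P * u) powr (- a1) * (1 - R * u) powr (- a2)"
      unfolding f_def by (intro sums_unique[symmetric] binomial2_series_sums lt P R)
    show "g u = (1 - P' * inverse u) powr (- b1) * (1 - Q * inverse u) powr (- b2)"
      unfolding g_def by (intro sums_unique[symmetric] binomial2_series_sums lt P' Q)
    show "F u = (1 - p * v u) powr (- a1)"
      unfolding F_def using sums_unique[OF negative_binomial_series[OF pv[OF that], of a1]]
      by (simp add: power_mult_distrib mult_ac)
    show "G u = (1 - q * inverse (v u)) powr (- b1)"
      unfolding G_def using sums_unique[OF negative_binomial_series[OF qv[OF that], of b1]]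
      by (simp add: power_mult_distrib mult_ac)
  qed
  have s1: "(\<lambda>m. binomial2_coeff a1 a2 P R (n + m) * binomial2_coeff b1 b2 P' Q m) sums
      (1 / (2 * pi * \<i>) * contour_integral (circlepath 0 1) (\<lambda>u. f u * g u * inverse u ^ Suc n))"
    using moebius_circle_sums[of 0 0 1 "binomial2_coeff a1 a2 P R" "binomial2_coeff b1 b2 P' Q" n]
      summable_norm_binomial2[of P 1 R a1 a2] summable_norm_binomial2[of P' 1 Q b1 b2] P R P' Q
    by (simp add: f_def g_def norm_inverse)
  have geom: "summable (\<lambda>i. norm (rising_coeff a i * x ^ i) * (9/7) ^ i)" if "norm x \<le> 16/63" for a x
  proof -
    have "norm (x * (9/7)) < 1" using that by (simp add: norm_mult)
    from summable_norm_rising_coeff[OF this, of a]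
    show ?thesis by (simp only: norm_mult norm_power power_mult_distrib norm_divide norm_numeral mult.assoc)
  qed
  have s2: "(\<lambda>j. rising_coeff a1 (n + j) * p ^ (n + j) * (rising_coeff b1 j * q ^ j)) sums
      ((1 - R * Q) / (2 * pi * \<i>) * contour_integral (circlepath 0 1)
         (\<lambda>u. F u * G u * (inverse (v u) ^ Suc n / (1 - R * u)\<^sup>2)))"
    unfolding F_def G_def v_def
    by (rule moebius_circle_sums[where r = "9/7"])
       (use Q R vb geom[OF p] geom[OF q] in \<open>auto simp: v_def\<close>)
  have eq: "f u * g u * inverse u ^ Suc n = K * (F u * G u * (inverse (v u) ^ Suc n / (1 - R * u)\<^sup>2))"
    if u: "norm u = 1" for u
  proof -
    have u0: "u \<noteq> 0" using u by auto
    have Reu: "Re (1 - x * u) > 0" "Re (1 - x * inverse u) > 0" if "norm x \<le> 1/8" for x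
      by (rule Re_one_minus_pos, use mult1[OF that u] in linarith)+
    have Rem: "Re ((1 - x) * (1 - y)) > 0" if "norm x \<le> 1/8" "norm y \<le> 1/8" for x y :: complex
    proof -
      have "norm (x + y - x * y) \<le> norm x + norm y + norm (x * y)"
        by (meson add_mono norm_triangle_ineq norm_triangle_ineq4 order_trans order_refl)
      also have "\<dots> \<le> 1/8 + 1/8 + 1/64" using that le64[OF that] by (intro add_mono)
      finally have "Re (1 - (x + y - x * y)) > 0" by (intro Re_one_minus_pos) simp
      thus ?thesis by (simp add: algebra_simps)
    qed
    have le8: "norm (x * y) \<le> 1/8" if "norm x \<le> 1/8" "norm y \<le> 1/8" for x y :: complex
      using le64[OF that] by linarith
    have nzu: "1 - R * u \<noteq> 0" "1 - Q * inverse u \<noteq> 0" using Reu[OF R] Reu[OF Q] by (metis less_irrefl zero_complex.simps(1))+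
    have uQ: "u - Q \<noteq> 0" using nzu(2) u0 by (simp add: field_simps)
    have fac1: "(1 - P * u) * (1 - R * Q) = (1 - R * u) * (1 - P * Q) * (1 - p * v u)"
    proof -
      have "(1 - R * u) * (1 - P * Q) * (1 - p * v u) = (1 - R * u) * (1 - P * Q) - (P - R) * (u - Q)"
        unfolding p_def v_def by (rule cancel_fractions[OF nzu(1) nz1[OF P Q]])
      thus ?thesis by (simp add: algebra_simps)
    qed
    have e1: "(1 - P * u) powr (- a1) = (1 - R * Q) powr (- (- a1)) * (1 - R * u) powr (- a1) *
                 (1 - P * Q) powr (- a1) * (1 - p * v u) powr (- a1)"
      by (rule moebius_linear_factor[OF Reu(1)[OF P] Re1[OF R Q] Reu(1)[OF R] Re1[OF P Q] _ pv[OF u] fac1])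
         (intro Rem mult1 le8 P R Q u)
    have fac2: "(1 - P' * inverse u) * (1 - R * Q) = (1 - Q * inverse u) * (1 - P' * R) * (1 - q * inverse (v u))"
    proof -
      have "u * ((1 - Q * inverse u) * (1 - P' * R) * (1 - q * inverse (v u))) =
            (u - Q) * (1 - P' * R) * (1 - q * inverse (v u))" using u0 by (simp add: field_simps)
      also have "\<dots> = (u - Q) * (1 - P' * R) - (P' - Q) * (1 - R * u)"
        unfolding q_def v_def inverse_divide by (rule cancel_fractions[OF uQ nz1[OF P' R]])
      also have "\<dots> = u * ((1 - P' * inverse u) * (1 - R * Q))" using u0 by (simp add: field_simps)
      finally show ?thesis using u0 by simp
    qed
    have e2: "(1 - P' * inverse u) powr (- b1) = (1 - R * Q) powr (- (- b1)) * (1 - Q * inverse u) powr (- b1) *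
                 (1 - P' * R) powr (- b1) * (1 - q * inverse (v u)) powr (- b1)"
      by (rule moebius_linear_factor[OF Reu(2)[OF P'] Re1[OF R Q] Reu(2)[OF Q] Re1[OF P' R] _ qv[OF u] fac2])
         (intro Rem mult1 le8 P' R Q u)
    have i1: "(1 - R * u) powr (- a1) * (1 - R * u) powr (- a2) = (1 - R * u) ^ n / (1 - R * u)"
    proof -
      have "- a1 + - a2 = of_nat n - 1" using a by (simp add: algebra_simps)
      thus ?thesis using nzu by (simp flip: powr_add) (simp add: powr_diff powr_nat')
    qed
    have i2: "(1 - Q * inverse u) powr (- b1) * (1 - Q * inverse u) powr (- b2) = inverse (1 - Q * inverse u) ^ Suc n"
    proof -
      have "- b1 + - b2 = - of_nat (Suc n)" using b by (simp add: algebra_simps)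
      thus ?thesis using nzu by (simp flip: powr_add del: of_nat_Suc) (simp add: powr_minus powr_nat' power_inverse del: of_nat_Suc)
    qed
    have i3: "(1 - R * u) ^ n / (1 - R * u) * (inverse (1 - Q * inverse u) ^ Suc n * inverse u ^ Suc n) =
              inverse (v u) ^ Suc n / (1 - R * u)\<^sup>2"
    proof -
      have "inverse (1 - Q * inverse u) * inverse u = inverse (u - Q)"
        using u0 by (simp only: inverse_mult_distrib[symmetric]) (simp add: left_diff_distrib)
      thus ?thesis unfolding power_mult_distrib[symmetric] v_def inverse_divide
        using power_fraction_shift[OF nzu(1) uQ, of n] by simp
    qed
    have "f u * g u * inverse u ^ Suc n = K * (F u * G u * ((1 - R * u) powr (- a1) * (1 - R * u) powr (- a2) *
            (((1 - Q * inverse u) powr (- b1) * (1 - Q * inverse u) powr (- b2)) * inverse u ^ Suc n)))"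
      unfolding f[OF u] g[OF u] F[OF u] G[OF u] e1 e2 K_def minus_minus powr_add by (simp only: mult_ac)
    thus ?thesis unfolding i1 i2 i3 .
  qed
  define h where "h = (\<lambda>u. F u * G u * (inverse (v u) ^ Suc n / (1 - R * u)\<^sup>2))"
  define I where "I = contour_integral (circlepath 0 1) h"
  have "contour_integral (circlepath 0 1) (\<lambda>u. f u * g u * inverse u ^ Suc n) =
        contour_integral (circlepath 0 1) (\<lambda>u. K * h u)"
    unfolding h_def by (rule contour_integral_eq) (rule eq, simp)
  \<comment> \<open>A contour integral that does not exist has the value 0 by convention, so
    \<open>K\<close> can be pulled out without settling integrability.\<close>
  also have "\<dots> = K * I"
    by (cases "K = 0"; cases "h contour_integrable_on circlepath 0 1")
       (simp_all add: I_def contour_integral_lmul not_integrable_contour_integral contour_integrable_lmul_iff)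
  finally have ceq: "contour_integral (circlepath 0 1) (\<lambda>u. f u * g u * inverse u ^ Suc n) = K * I" .
  define Z where "Z = (P - R) * (P' - Q) / ((1 - P * Q) * (1 - P' * R))"
  have pq: "p * q = Z" by (simp add: p_def q_def Z_def)
  have "norm Z < 1" unfolding pq[symmetric] using mult_mono[OF p q] by (simp add: norm_mult)
  from sums_mult[OF hyp2F1_reg_series_sums[OF this, of "a1 + of_nat n" b1 "of_nat (Suc n)"], of "pochhammer a1 n * p ^ n"]
  have "(\<lambda>j. rising_coeff a1 (n + j) * p ^ (n + j) * (rising_coeff b1 j * q ^ j)) sums
      (pochhammer a1 n * p ^ n * hyp2F1_reg_series (a1 + of_nat n) b1 (of_nat (Suc n)) Z)"
  proof (rule sums_cong[THEN iffD1, rotated])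
    fix j
    have "rising_coeff a1 (n + j) * p ^ (n + j) * (rising_coeff b1 j * q ^ j) =
          (rising_coeff a1 (n + j) * rising_coeff b1 j) * (p ^ n * (p * q) ^ j)"
      by (simp add: power_add power_mult_distrib mult_ac)
    also have "\<dots> = pochhammer a1 n * p ^ n * (pochhammer (a1 + of_nat n) j * pochhammer b1 j * rGamma (of_nat (Suc n) + of_nat j) / fact j * Z ^ j)"
      unfolding rising_coeff_hyp2F1_term pq by (simp add: mult_ac)
    finally show "pochhammer a1 n * p ^ n * (pochhammer (a1 + of_nat n) j * pochhammer b1 j * rGamma (of_nat (Suc n) + of_nat j) / fact j * Z ^ j) =
       rising_coeff a1 (n + j) * p ^ (n + j) * (rising_coeff b1 j * q ^ j)" ..
  qed
  from sums_unique2[OF this s2]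
  have H: "pochhammer a1 n * p ^ n * hyp2F1_reg_series (a1 + of_nat n) b1 (of_nat (Suc n)) Z =
           (1 - R * Q) / (2 * pi * \<i>) * I" unfolding I_def h_def .
  \<comment> \<open>The factor \<open>1 - R * Q\<close> from the derivative of \<open>v\<close>
    lowers the exponent \<open>a1 + b1\<close> by one.\<close>
  have "(1 - R * Q) powr (a1 + b1) = (1 - R * Q) powr (a1 + b1 - 1) * (1 - R * Q)"
    using nz1[OF R Q] by (simp add: powr_diff)
  hence "1 / (2 * pi * \<i>) * (K * I) = (1 - P * Q) powr (- a1) * (1 - R * Q) powr (a1 + b1 - 1) * (1 - P' * R) powr (- b1) *
          ((1 - R * Q) / (2 * pi * \<i>) * I)" by (simp add: K_def)
  with s1 show ?thesis unfolding ceq Z_def[symmetric] p_def[symmetric] H by (simp only:)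
qed

section \<open>Analytic continuation of the hypergeometric function\<close>

text \<open>Such a \<open>u\<close> is the radius of a circle that encloses \<open>c\<close>,
  \<open>d\<close> and leaves \<open>1 / a\<close>, \<open>1 / b\<close> outside; it exists because
  \<open>max a b * max c d < 1\<close>. When \<open>a = b = 0\<close> there is no upper bound to
  respect.\<close>

lemma balancing_radius:
  fixes a b c d :: real
  assumes "0 \<le> a" "0 \<le> b" "0 \<le> c" "0 \<le> d" "a * c < 1" "a * d < 1" "b * c < 1" "b * d < 1"
  obtains u where "0 < u" "a * u < 1" "b * u < 1" "c < u" "d < u"
proof (cases "max a b = 0")
  case True
  hence "a = 0" "b = 0" using assms by auto
  thus ?thesis using that[of "max c d + 1"] assms by auto
next
  case False
  hence M: "max a b > 0" using assms by auto
  have "max c d * max a b < 1" using assms by (auto simp: max_def mult.commute)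
  hence "max c d < 1 / max a b" by (simp only: pos_less_divide_eq[OF M])
  then obtain u where u: "max c d < u" "u < 1 / max a b" using dense by blast
  hence "u > 0" using assms by auto
  moreover have "max a b * u < 1" using u(2) by (simp only: pos_less_divide_eq[OF M] mult.commute)
  moreover have "a * u \<le> max a b * u" "b * u \<le> max a b * u"
    using \<open>u > 0\<close> by (auto intro!: mult_right_mono)
  ultimately have "a * u < 1" "b * u < 1" by linarith+
  with u \<open>u > 0\<close> show ?thesis using that by simp
qed

text \<open>With a balancing radius \<open>u\<close>, the first coefficient is weighted by
  \<open>u ^ (n + m)\<close> and the second by \<open>(z / u) ^ m\<close>. Both weighted series
  converge absolutely; one is used for summability, the other only for boundedness.\<close>

lemma summable_binomial2_correlation:
  fixes P R P' Q z :: complex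
  assumes "norm (z * (P * P')) < 1" "norm (z * (P * Q)) < 1" "norm (z * (R * P')) < 1" "norm (z * (R * Q)) < 1"
  shows "summable (\<lambda>m. norm (binomial2_coeff a1 a2 P R (n + m) * binomial2_coeff b1 b2 P' Q m * z ^ m))"
proof -
  obtain u where u: "0 < u" "norm P * u < 1" "norm R * u < 1" "norm P' * norm z < u" "norm Q * norm z < u"
    by (rule balancing_radius[of "norm P" "norm R" "norm P' * norm z" "norm Q * norm z"])
       (use assms in \<open>simp_all add: norm_mult mult_ac\<close>)
  define e where "e = (\<lambda>k. binomial2_coeff a1 a2 P R k * of_real u ^ k)"
  define h where "h = (\<lambda>k. binomial2_coeff b1 b2 P' Q k * (z / of_real u) ^ k)"
  have e: "summable (\<lambda>k. norm (e k))"
    unfolding e_def using u by (intro summable_norm_binomial2) (simp_all add: norm_mult)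
  have eq: "binomial2_coeff a1 a2 P R (n + m) * binomial2_coeff b1 b2 P' Q m * z ^ m =
        inverse (of_real u ^ n) * (e (n + m) * h m)" for m
    using u by (simp add: e_def h_def power_add power_divide)
  have "summable (\<lambda>k. norm (h k))"
    unfolding h_def using u by (intro summable_norm_binomial2) (simp_all add: norm_mult norm_divide)
  hence "(\<lambda>k. norm (h k)) \<longlonglongrightarrow> 0" by (rule summable_LIMSEQ_zero)
  hence "eventually (\<lambda>k. norm (h k) < 1) sequentially" by (rule order_tendstoD) simp
  hence ev: "eventually (\<lambda>m. norm (norm (binomial2_coeff a1 a2 P R (n + m) * binomial2_coeff b1 b2 P' Q m * z ^ m))
          \<le> norm (inverse (of_real u ^ n) :: complex) * norm (e (n + m))) sequentially"
    by eventually_elim (simp add: eq norm_mult mult_left_le mult_left_mono)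
  have "summable (\<lambda>m. norm (e (n + m)))"
    using summable_ignore_initial_segment[OF e, of n] by (simp add: add.commute)
  hence "summable (\<lambda>m. norm (inverse (of_real u ^ n) :: complex) * norm (e (n + m)))"
    by (rule summable_mult)
  with ev show ?thesis by (rule summable_comparison_test_ev)
qed

text \<open>Small parameters are reached by writing \<open>z = w * l\<close> with a fixed small
  \<open>l\<close>: \<open>P\<close>, \<open>R\<close> are scaled by \<open>w\<close> and
  \<open>P'\<close>, \<open>Q\<close> by \<open>l\<close>, so every product across the pairs is
  scaled by \<open>z\<close>. Both sides gain a factor \<open>w ^ n\<close>, which is cancelled for
  \<open>z \<noteq> 0\<close>; hence the punctured neighbourhood.\<close>

lemma binomial2_correlation_near_0:
  fixes P R P' Q a1 a2 b1 b2 :: complex and n :: nat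
  assumes a: "a1 + a2 = 1 - of_nat n" and b: "b1 + b2 = 1 + of_nat n"
  shows "\<forall>\<^sub>F z in at 0. (\<lambda>m. binomial2_coeff a1 a2 P R (n + m) * binomial2_coeff b1 b2 P' Q m * z ^ m) sums
     ((1 - z * (P * Q)) powr (- a1) * (1 - z * (R * Q)) powr (a1 + b1 - 1) * (1 - z * (P' * R)) powr (- b1) *
      (pochhammer a1 n * ((P - R) / (1 - z * (P * Q))) ^ n *
       hyp2F1_reg_series (a1 + of_nat n) b1 (of_nat (Suc n))
         (z * ((P - R) * (P' - Q)) / ((1 - z * (P * Q)) * (1 - z * (P' * R))))))"
proof -
  define M where "M = norm P + norm R + norm P' + norm Q"
  \<comment> \<open>Chosen so that \<open>l * M \<le> 1/8\<close>; then
    \<open>norm z < l * l\<close> forces \<open>norm w \<le> l\<close>.\<close>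
  define l where "l = 1 / (8 * (1 + M))"
  have M: "norm P \<le> M" "norm R \<le> M" "norm P' \<le> M" "norm Q \<le> M" "M \<ge> 0" by (simp_all add: M_def)
  hence l: "l > 0" by (simp add: l_def)
  have small: "norm (w * x) \<le> 1/8" if "norm x \<le> M" "norm w \<le> l" for w x :: complex
  proof -
    have "norm (w * x) \<le> l * M" unfolding norm_mult using that l by (intro mult_mono) auto
    also have "\<dots> \<le> 1/8" using M by (simp add: l_def field_simps)
    finally show ?thesis .
  qed
  have "\<forall>\<^sub>F z in at (0::complex). norm z < l * l \<and> z \<noteq> 0"
  proof (rule eventually_conj)
    show "\<forall>\<^sub>F z in at (0::complex). norm z < l * l"
      unfolding eventually_at using l by (intro exI[of _ "l * l"]) auto
  qed (simp add: eventually_neq_at_within)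
  thus ?thesis
  proof eventually_elim
    case (elim z)
    define w where "w = z / of_real l"
    have wl: "w * of_real l = z" using l by (simp add: w_def)
    have w: "norm w \<le> l" "w \<noteq> 0" using elim l by (simp_all add: w_def norm_divide field_simps)
    have ll: "norm (of_real l :: complex) \<le> l" using l by simp
    have prods: "w * x * (of_real l * y) = z * (x * y)" "of_real l * x * (w * y) = z * (x * y)" for x y
      using wl by (simp_all add: mult_ac)
    have diffs: "w * P - w * R = w * (P - R)" "of_real l * P' - of_real l * Q = of_real l * (P' - Q)"
      by (simp_all add: algebra_simps)
    have frac: "(w * (P - R) / X) ^ n = w ^ n * ((P - R) / X) ^ n" for X
      by (simp add: power_mult_distrib power_divide)
    have terms: "w ^ (n + m) * X * (of_real l ^ m * Y) = w ^ n * (X * Y * z ^ m)" for X Y m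
      unfolding wl[symmetric] by (simp add: power_add power_mult_distrib mult_ac)
    have "(\<lambda>m. w ^ n * (binomial2_coeff a1 a2 P R (n + m) * binomial2_coeff b1 b2 P' Q m * z ^ m)) sums
       (w ^ n * ((1 - z * (P * Q)) powr (- a1) * (1 - z * (R * Q)) powr (a1 + b1 - 1) * (1 - z * (P' * R)) powr (- b1) *
      (pochhammer a1 n * ((P - R) / (1 - z * (P * Q))) ^ n *
       hyp2F1_reg_series (a1 + of_nat n) b1 (of_nat (Suc n))
         (z * ((P - R) * (P' - Q)) / ((1 - z * (P * Q)) * (1 - z * (P' * R)))))))"
      using binomial2_correlation_small[OF small[OF M(1) w(1)] small[OF M(2) w(1)]
          small[OF M(3) ll] small[OF M(4) ll] a b]
      unfolding binomial2_coeff_scale prods diffs frac terms by (simp only: mult_ac)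
    thus ?case using w by (subst (asm) sums_mult_iff) auto
  qed
qed

section \<open>The cut plane and uniqueness of continuation\<close>

lemma mem_cut_plane_iff: "z \<in> cut_plane \<longleftrightarrow> 1 - z \<notin> \<real>\<^sub>\<le>\<^sub>0"
proof -
  have "z \<in> complex_of_real ` {1..} \<longleftrightarrow> Im z = 0 \<and> Re z \<ge> 1"
    by (auto simp: complex_eq_iff image_iff intro: bexI[of _ "Re z"])
  thus ?thesis by (auto simp: cut_plane_def complex_nonpos_Reals_iff)
qed

lemma open_cut_plane: "open cut_plane"
proof -
  have "cut_plane = (\<lambda>z. 1 - z) -` (- \<real>\<^sub>\<le>\<^sub>0)" by (auto simp: mem_cut_plane_iff)
  moreover have "open \<dots>" by (intro open_vimage continuous_intros) (simp add: open_Compl)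
  ultimately show ?thesis by simp
qed

lemma unit_ball_subset_cut_plane: "ball 0 1 \<subseteq> cut_plane"
proof
  fix z :: complex assume "z \<in> ball 0 1"
  thus "z \<in> cut_plane" using Re_one_minus_pos[of z] by (auto simp: mem_cut_plane_iff complex_nonpos_Reals_iff)
qed

lemma zero_in_cut_plane: "0 \<in> cut_plane"
  using unit_ball_subset_cut_plane by auto

lemma connected_cut_plane: "connected cut_plane"
proof (rule starlike_imp_connected)
  have "closed_segment 0 z \<subseteq> cut_plane" if "z \<in> cut_plane" for z
  proof
    fix w assume "w \<in> closed_segment 0 z"
    then obtain u where u: "0 \<le> u" "u \<le> 1" "w = u *\<^sub>R z" by (auto simp: in_segment)
    show "w \<in> cut_plane"
    proof (rule ccontr)
      assume "w \<notin> cut_plane"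
      hence w: "Im w = 0" "Re w \<ge> 1" by (auto simp: mem_cut_plane_iff complex_nonpos_Reals_iff)
      with u have "u \<noteq> 0" by auto
      moreover from w u have "0 < u * Re z" by simp
      ultimately have "Im z = 0" "Re z > 0" using w u by (auto simp: zero_less_mult_iff)
      moreover from this have "Re w \<le> Re z" using u by (simp add: mult_left_le_one_le)
      ultimately show False using that w by (auto simp: mem_cut_plane_iff complex_nonpos_Reals_iff)
    qed
  qed
  thus "starlike cut_plane" unfolding starlike_def using zero_in_cut_plane by blast
qed

text \<open>Identity theorem in the form in which equalities arise here, namely on a punctured
  neighbourhood of one point.\<close>

lemma holomorphic_eq_from_germ:
  assumes "open S" "connected S" "f holomorphic_on S" "g holomorphic_on S" "a \<in> S"
    and "\<forall>\<^sub>F z in at a. f z = g z" "z \<in> S"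
  shows "f z = g z"
proof -
  obtain U where U: "open U" "a \<in> U" "\<And>z. z \<in> U \<Longrightarrow> z \<noteq> a \<Longrightarrow> f z = g z"
    using assms(6) unfolding eventually_at_topological by blast
  have ne: "U \<inter> S - {a} \<noteq> {}"
  proof
    assume "U \<inter> S - {a} = {}"
    hence "U \<inter> S = {a}" using U assms by auto
    thus False using open_Int[OF U(1) assms(1)] not_open_singleton[of a] by simp
  qed
  show ?thesis
    by (rule analytic_continuation_open[of "U \<inter> S - {a}" S f g])
       (use U ne assms in \<open>auto intro: open_Diff\<close>)
qed

lemma hyp2F1_reg_series_holomorphic: "hyp2F1_reg_series A B C holomorphic_on ball 0 1"
  by (rule power_series_holomorphic[where a = "\<lambda>k. pochhammer A k * pochhammer B k * rGamma (C + of_nat k) / fact k"])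
     (use hyp2F1_reg_series_sums[of _ A B C] in simp)

text \<open>The existence half of the definite description in \<open>hyp2F1_reg\<close>; uniqueness
  is automatic on a connected domain.\<close>

definition hyp2F1_continuable :: "complex \<Rightarrow> complex \<Rightarrow> complex \<Rightarrow> bool" where
  "hyp2F1_continuable A B C \<longleftrightarrow>
     (\<exists>F. F holomorphic_on cut_plane \<and> (\<forall>u\<in>ball 0 1. F u = hyp2F1_reg_series A B C u))"

lemma hyp2F1_continuableI:
  assumes "F holomorphic_on cut_plane" "\<forall>\<^sub>F z in at 0. F z = hyp2F1_reg_series A B C z"
  shows "hyp2F1_continuable A B C"
  unfolding hyp2F1_continuable_def
proof (intro exI conjI ballI)
  fix u :: complex assume u: "u \<in> ball 0 1"
  show "F u = hyp2F1_reg_series A B C u"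
    by (rule holomorphic_eq_from_germ[OF open_ball connected_ball
          holomorphic_on_subset[OF assms(1) unit_ball_subset_cut_plane]
          hyp2F1_reg_series_holomorphic _ assms(2) u]) simp
qed fact

lemma
  assumes "hyp2F1_continuable A B C"
  shows hyp2F1_reg_holomorphic: "hyp2F1_reg A B C holomorphic_on cut_plane"
    and hyp2F1_reg_eq_series: "z \<in> ball 0 1 \<Longrightarrow> hyp2F1_reg A B C z = hyp2F1_reg_series A B C z"
proof -
  obtain F where F: "F holomorphic_on cut_plane" "\<forall>u\<in>ball 0 1. F u = hyp2F1_reg_series A B C u"
    using assms by (auto simp: hyp2F1_continuable_def)
  have eq: "hyp2F1_reg A B C z = F z" if z: "z \<in> cut_plane" for z
    unfolding hyp2F1_reg_def
  proof (rule the_equality)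
    show "\<exists>G. G holomorphic_on cut_plane \<and> (\<forall>u\<in>ball 0 1. G u = hyp2F1_reg_series A B C u) \<and> G z = F z"
      using F by blast
  next
    fix w assume "\<exists>G. G holomorphic_on cut_plane \<and> (\<forall>u\<in>ball 0 1. G u = hyp2F1_reg_series A B C u) \<and> G z = w"
    then obtain G where G: "G holomorphic_on cut_plane" "\<forall>u\<in>ball 0 1. G u = hyp2F1_reg_series A B C u" "G z = w" by blast
    have "G z = F z"
      by (rule analytic_continuation_open[of "ball 0 1" cut_plane G F])
         (use F G z open_cut_plane connected_cut_plane unit_ball_subset_cut_plane in auto)
    with G show "w = F z" by simp
  qed
  show "hyp2F1_reg A B C holomorphic_on cut_plane"
    using F(1) eq by (simp cong: holomorphic_cong)
  show "hyp2F1_reg A B C z = hyp2F1_reg_series A B C z" if "z \<in> ball 0 1"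
    using that F eq unit_ball_subset_cut_plane by auto
qed

lemma hyp2F1_reg_eqI:
  assumes "hyp2F1_continuable A B C" "F holomorphic_on cut_plane"
    and "\<forall>\<^sub>F z in at 0. F z = hyp2F1_reg_series A B C z" "z \<in> cut_plane"
  shows "hyp2F1_reg A B C z = F z"
proof (rule holomorphic_eq_from_germ[OF open_cut_plane connected_cut_plane hyp2F1_reg_holomorphic[OF assms(1)] assms(2) zero_in_cut_plane _ assms(4)])
  have "\<forall>\<^sub>F z in at (0::complex). z \<in> ball 0 1"
    using eventually_at_in_open'[of "ball 0 1" "0 :: complex"] by simp
  with assms(3) show "\<forall>\<^sub>F z in at 0. hyp2F1_reg A B C z = F z"
  proof eventually_elim
    case (elim z)
    thus ?case using hyp2F1_reg_eq_series[OF assms(1) elim(2)] by simp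
  qed
qed

text \<open>
  \<open>4 w / (1 + w)\<^sup>2\<close> maps the unit disc conformally onto the cut plane, and for \<open>P = P' = 1\<close>,
  \<open>R = Q = - 1\<close> it is the hypergeometric argument in \<open>binomial2_correlation_near_0\<close>, whose left-hand side
  is a power series in \<open>w\<close> that converges in the whole disc.
\<close>

lemma hyp2F1_continuable_1: "hyp2F1_continuable a b 1"
proof -
  define c where "c = (\<lambda>m. binomial2_coeff a (1 - a) 1 (- 1) m * binomial2_coeff b (1 - b) 1 (- 1) m)"
  define T where "T = (\<lambda>w. \<Sum>m. c m * w ^ m)"
  \<comment> \<open>Solving \<open>4 w / (1 + w)\<^sup>2 = z\<close> for the root in the unit disc
    gives \<open>\<zeta>\<close>. It is a Cayley transform of \<open>s\<close>, so
    \<open>norm (\<zeta> z) < 1\<close> amounts to \<open>Re (s z) > 0\<close>.\<close>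
  define s where "s = (\<lambda>z. csqrt (1 - z))"
  define \<zeta> where "\<zeta> = (\<lambda>z. (1 - s z) / (1 + s z))"
  have "T holomorphic_on ball 0 1"
  proof (rule power_series_holomorphic[where a = c])
    fix w :: complex assume "w \<in> ball 0 1"
    hence "summable (\<lambda>m. norm (c m * w ^ m))"
      using summable_binomial2_correlation[of w 1 1 "- 1" "- 1" a "1 - a" 0 b "1 - b"] by (simp add: c_def)
    thus "(\<lambda>m. c m * (w - 0) ^ m) sums T w"
      unfolding T_def using summable_sums[OF summable_norm_cancel] by simp
  qed
  moreover have s: "Re (s z) > 0" if "z \<in> cut_plane" for z
  proof (rule ccontr)
    assume "\<not> Re (s z) > 0"
    hence re: "Re (s z) = 0" using Re_csqrt[of "1 - z"] by (simp add: s_def)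
    have "1 - z = s z ^ 2" by (simp add: s_def)
    also have "\<dots> \<in> \<real>\<^sub>\<le>\<^sub>0" using re by (simp add: complex_nonpos_Reals_iff power2_eq_square)
    finally show False using that by (simp add: mem_cut_plane_iff)
  qed
  have s1: "1 + s z \<noteq> 0" if "z \<in> cut_plane" for z
    using s[OF that] by (auto simp: complex_eq_iff)
  have hol_s: "s holomorphic_on cut_plane" unfolding s_def
    by (intro holomorphic_intros) (simp add: mem_cut_plane_iff)
  have hol\<zeta>: "\<zeta> holomorphic_on cut_plane" unfolding \<zeta>_def using s1 hol_s by (intro holomorphic_intros) auto
  have \<zeta>: "norm (\<zeta> z) < 1" if "z \<in> cut_plane" for z
  proof -
    have "(norm (1 - s z))\<^sup>2 < (norm (1 + s z))\<^sup>2"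
      unfolding cmod_power2 using s[OF that] by (simp add: power2_eq_square algebra_simps)
    hence "norm (1 - s z) < norm (1 + s z)" by (rule power_less_imp_less_base) simp
    thus ?thesis using s1[OF that] by (simp add: \<zeta>_def norm_divide)
  qed
  ultimately have "(T \<circ> \<zeta>) holomorphic_on cut_plane"
    by (intro holomorphic_on_compose_gen hol\<zeta>) auto
  hence holT: "(\<lambda>z. T (\<zeta> z)) holomorphic_on cut_plane" by (simp add: o_def)
  \<comment> \<open>The three powers are the inverses of the prefactors in the correlation identity,
    where \<open>1 - w P Q\<close> and \<open>1 - w P' R\<close> become \<open>1 + w\<close> and
    \<open>1 - w R Q\<close> becomes \<open>1 - w\<close>.\<close>
  define F where "F = (\<lambda>z. T (\<zeta> z) * ((1 + \<zeta> z) powr a * (1 - \<zeta> z) powr (1 - a - b) * (1 + \<zeta> z) powr b))"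
  have Re\<zeta>: "Re (1 - \<zeta> z) > 0" "Re (1 + \<zeta> z) > 0" if "z \<in> cut_plane" for z
    using Re_one_minus_pos[of "\<zeta> z"] Re_one_minus_pos[of "- \<zeta> z"] \<zeta>[OF that] by auto
  have "F holomorphic_on cut_plane" unfolding F_def
    by (intro holomorphic_intros holT hol\<zeta>) (use Re\<zeta> in \<open>force simp: complex_nonpos_Reals_iff\<close>)+
  moreover have "\<forall>\<^sub>F z in at 0. F z = hyp2F1_reg_series a b 1 z"
  proof -
    have "isCont \<zeta> 0"
      by (rule continuous_on_interior[OF holomorphic_on_imp_continuous_on[OF hol\<zeta>]])
         (simp add: interior_open open_cut_plane zero_in_cut_plane)
    moreover have "\<zeta> 0 = 0" by (simp add: \<zeta>_def s_def)
    ultimately have lim: "\<zeta> \<midarrow>0\<rightarrow> 0" by (simp add: isCont_def)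
    have arg: "\<zeta> z * 4 / ((1 + \<zeta> z) * (1 + \<zeta> z)) = z" if "z \<in> cut_plane" for z
    proof -
      have "1 + \<zeta> z = 2 / (1 + s z)" using s1[OF that] by (simp add: \<zeta>_def field_simps)
      hence "\<zeta> z * 4 / ((1 + \<zeta> z) * (1 + \<zeta> z)) = (1 - s z) * (1 + s z)"
        using s1[OF that] by (simp add: \<zeta>_def)
      also have "\<dots> = 1 - (s z)\<^sup>2" by (simp add: power2_eq_square algebra_simps)
      finally show ?thesis by (simp add: s_def)
    qed
    have cut: "\<forall>\<^sub>F z in at 0. z \<in> cut_plane \<and> z \<noteq> (0::complex)"
      using eventually_at_in_open[OF open_cut_plane zero_in_cut_plane] by simp
    \<comment> \<open>The identity is known only off the origin, so \<open>\<zeta>\<close> must not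
      hit 0 for \<open>z \<noteq> 0\<close>.\<close>
    hence "\<forall>\<^sub>F z in at 0. \<zeta> z \<noteq> 0"
      by eventually_elim (metis arg mult_zero_left div_0)
    hence "filterlim \<zeta> (at 0) (at 0)" using lim by (simp add: filterlim_at)
    from eventually_compose_filterlim[OF binomial2_correlation_near_0[of a "1 - a" 0 b "1 - b" 1 "- 1" 1 "- 1"] this]
    have "\<forall>\<^sub>F z in at 0. (\<lambda>m. c m * \<zeta> z ^ m) sums
       ((1 + \<zeta> z) powr (- a) * (1 - \<zeta> z) powr (a + b - 1) * (1 + \<zeta> z) powr (- b) *
          hyp2F1_reg_series a b 1 (\<zeta> z * 4 / ((1 + \<zeta> z) * (1 + \<zeta> z))))"
      by (simp add: c_def)
    with cut show ?thesis
    proof eventually_elim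
      case (elim z)
      have nz: "1 + \<zeta> z \<noteq> 0" "1 - \<zeta> z \<noteq> 0" using Re\<zeta>[of z] elim by (metis less_irrefl zero_complex.simps(1))+
      have "T (\<zeta> z) = (1 + \<zeta> z) powr (- a) * (1 - \<zeta> z) powr (a + b - 1) * (1 + \<zeta> z) powr (- b) *
          hyp2F1_reg_series a b 1 z"
        using sums_unique[OF elim(2)] arg[of z] elim(1) by (simp add: T_def)
      moreover have "x powr (- e) * x powr e = 1" if "x \<noteq> 0" for x e :: complex
        using that by (simp flip: powr_add)
      from this[OF nz(1), of a] this[OF nz(1), of b] this[OF nz(2), of "1 - a - b"]
      have "(1 + \<zeta> z) powr (- a) * (1 + \<zeta> z) powr a = 1" "(1 + \<zeta> z) powr (- b) * (1 + \<zeta> z) powr b = 1"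
           "(1 - \<zeta> z) powr (a + b - 1) * (1 - \<zeta> z) powr (1 - a - b) = 1" by (simp_all add: algebra_simps)
      ultimately show "F z = hyp2F1_reg_series a b 1 z"
        unfolding F_def by algebra
    qed
  qed
  ultimately show ?thesis by (rule hyp2F1_continuableI)
qed

text \<open>Regularization absorbs the usual factor \<open>1 / C\<close>, so differentiation raises
  the lower parameter for every \<open>C\<close>.\<close>

lemma hyp2F1_reg_series_has_field_derivative:
  assumes "norm z < 1"
  shows "(hyp2F1_reg_series A B C has_field_derivative
            A * B * hyp2F1_reg_series (A + 1) (B + 1) (C + 1) z) (at z)"
proof -
  define c where "c = (\<lambda>k. pochhammer A k * pochhammer B k * rGamma (C + of_nat k) / fact k)"
  obtain r where r: "norm z < r" "r < 1" using dense[OF assms] by blast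
  hence "r > 0" using norm_ge_zero[of z] by linarith
  hence "summable (\<lambda>k. c k * of_real r ^ k)"
    using summable_norm_cancel[OF summable_norm_hyp2F1_reg_series, of "of_real r" A B C] r
    by (simp add: c_def)
  from termdiffs_strong[OF this, of z]
  have "((\<lambda>x. \<Sum>k. c k * x ^ k) has_field_derivative (\<Sum>k. diffs c k * z ^ k)) (at z)"
    using r \<open>r > 0\<close> by simp
  moreover have "diffs c k * z ^ k = A * B * (pochhammer (A + 1) k * pochhammer (B + 1) k *
      rGamma (C + 1 + of_nat k) / fact k * z ^ k)" for k
    by (simp add: diffs_def c_def pochhammer_rec add_ac del: of_nat_Suc) (simp add: add_ac)
  hence "(\<Sum>k. diffs c k * z ^ k) = A * B * hyp2F1_reg_series (A + 1) (B + 1) (C + 1) z"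
    using sums_unique[OF sums_mult[OF hyp2F1_reg_series_sums[OF assms, of "A + 1" "B + 1" "C + 1"], of "A * B"]] by simp
  moreover have "(\<lambda>x. \<Sum>k. c k * x ^ k) = hyp2F1_reg_series A B C"
    by (simp add: c_def hyp2F1_reg_series_def fun_eq_iff)
  ultimately show ?thesis by simp
qed

lemma hyp2F1_continuable_deriv:
  assumes "hyp2F1_continuable A B C" "A \<noteq> 0" "B \<noteq> 0"
  shows "hyp2F1_continuable (A + 1) (B + 1) (C + 1)"
proof -
  obtain F where F: "F holomorphic_on cut_plane" "\<And>u. u \<in> ball 0 1 \<Longrightarrow> F u = hyp2F1_reg_series A B C u"
    using assms by (auto simp: hyp2F1_continuable_def)
  show ?thesis unfolding hyp2F1_continuable_def
  proof (intro exI conjI ballI)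
    show "(\<lambda>z. deriv F z / (A * B)) holomorphic_on cut_plane"
      using assms by (intro holomorphic_intros F open_cut_plane) auto
    fix u :: complex assume u: "u \<in> ball 0 1"
    have "(F has_field_derivative A * B * hyp2F1_reg_series (A + 1) (B + 1) (C + 1) u) (at u)"
      by (rule has_field_derivative_transform_within_open[OF hyp2F1_reg_series_has_field_derivative, of _ "ball 0 1"])
         (use u F in auto)
    from DERIV_imp_deriv[OF this]
    show "deriv F u / (A * B) = hyp2F1_reg_series (A + 1) (B + 1) (C + 1) u" using assms by simp
  qed
qed

text \<open>Starting from lower parameter 1, each differentiation raises all three parameters by
  one. Non-integral \<open>A\<close> and \<open>B\<close> guarantee that the lowered upper
  parameters never vanish and can be divided out.\<close>

lemma hyp2F1_continuable_pos_int:
  assumes "A \<notin> \<int>" "B \<notin> \<int>"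
  shows "hyp2F1_continuable A B (of_nat (Suc n))"
  using assms
proof (induction n arbitrary: A B)
  case 0
  show ?case using hyp2F1_continuable_1 by simp
next
  case (Suc n)
  have "A - 1 \<notin> \<int>" "B - 1 \<notin> \<int>" using Suc.prems by (metis Ints_1 Ints_add diff_add_cancel)+
  moreover from this have "A - 1 \<noteq> 0" "B - 1 \<noteq> 0" by (metis Ints_0)+
  ultimately show ?case using hyp2F1_continuable_deriv[OF Suc.IH[of "A - 1" "B - 1"]] by (simp add: add_ac)
qed

text \<open>The first \<open>m\<close> terms are killed by the zeros of \<open>rGamma\<close>; the
  rest is a Gauss series with lower parameter \<open>1 + m\<close>. This exhibits the zero of order
  at least \<open>m\<close> at the origin that later compensates a negative power.\<close>

lemma hyp2F1_reg_series_shift: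
  assumes "norm z < 1"
  shows "hyp2F1_reg_series a b (1 - of_nat m) z =
     pochhammer a m * pochhammer b m * z ^ m *
       hyp2F1_reg_series (a + of_nat m) (b + of_nat m) (1 + of_nat m) z"
proof -
  define f where "f = (\<lambda>k. pochhammer a k * pochhammer b k * rGamma (1 - of_nat m + of_nat k) / fact k * z ^ k)"
  have zero: "f k = 0" if "k < m" for k
  proof -
    have "1 - of_nat m + of_nat k = - (of_nat (m - Suc k) :: complex)" using that by (simp add: of_nat_diff)
    hence "rGamma (1 - of_nat m + of_nat k :: complex) = 0" by (simp add: rGamma_eq_zero_iff)
    thus ?thesis by (simp add: f_def)
  qed
  have "(\<lambda>j. pochhammer a m * pochhammer b m * z ^ m * (pochhammer (a + of_nat m) j * pochhammer (b + of_nat m) j *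
           rGamma (1 + of_nat m + of_nat j) / fact j * z ^ j)) sums
         (pochhammer a m * pochhammer b m * z ^ m *
           hyp2F1_reg_series (a + of_nat m) (b + of_nat m) (1 + of_nat m) z)"
    by (intro sums_mult hyp2F1_reg_series_sums assms)
  also have "(\<lambda>j. pochhammer a m * pochhammer b m * z ^ m * (pochhammer (a + of_nat m) j * pochhammer (b + of_nat m) j *
           rGamma (1 + of_nat m + of_nat j) / fact j * z ^ j)) = (\<lambda>j. f (j + m))"
  proof
    fix j
    have "rGamma (1 + of_nat m + of_nat j :: complex) = 1 / fact (m + j)"
      using rGamma_of_nat_Suc[of m j] by simp
    moreover have "rGamma (1 - of_nat m + of_nat (j + m) :: complex) = 1 / fact j"
      using rGamma_of_nat_Suc[of 0 j] by simp
    ultimately show "pochhammer a m * pochhammer b m * z ^ m * (pochhammer (a + of_nat m) j * pochhammer (b + of_nat m) j *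
           rGamma (1 + of_nat m + of_nat j) / fact j * z ^ j) = f (j + m)"
      unfolding f_def by (simp only: add.commute[of j m] pochhammer_product' power_add) (simp add: mult_ac)
  qed
  finally have "f sums (pochhammer a m * pochhammer b m * z ^ m *
           hyp2F1_reg_series (a + of_nat m) (b + of_nat m) (1 + of_nat m) z)"
    using sums_zero_iff_shift[of m f] zero by blast
  thus ?thesis unfolding f_def hyp2F1_reg_series_def[of a b] by (rule sums_unique[symmetric])
qed

lemma add_of_nat_notin_Ints: "(a :: complex) \<notin> \<int> \<Longrightarrow> a + of_nat m \<notin> \<int>"
  by (metis Ints_diff Ints_of_nat add_diff_cancel_right')

lemma eventually_at_0_unit_ball: "\<forall>\<^sub>F z in at (0::complex). norm z < 1"
  using eventually_at_in_open'[of "ball 0 1" "0 :: complex"] by simp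

text \<open>The right-hand side of the series identity already lives on the cut plane and so serves
  as the continuation of the left-hand side.\<close>

lemma hyp2F1_continuable_shift:
  assumes "a \<notin> \<int>" "b \<notin> \<int>"
  shows "hyp2F1_continuable a b (1 - of_nat m)"
    and "z \<in> cut_plane \<Longrightarrow> hyp2F1_reg a b (1 - of_nat m) z =
     pochhammer a m * pochhammer b m * z ^ m * hyp2F1_reg (a + of_nat m) (b + of_nat m) (1 + of_nat m) z"
proof -
  have c: "hyp2F1_continuable (a + of_nat m) (b + of_nat m) (1 + of_nat m)"
    using hyp2F1_continuable_pos_int[OF assms[THEN add_of_nat_notin_Ints[of _ m]], of m] by simp
  define F where "F = (\<lambda>z. pochhammer a m * pochhammer b m * z ^ m *
      hyp2F1_reg (a + of_nat m) (b + of_nat m) (1 + of_nat m) z)"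
  have F: "F holomorphic_on cut_plane" unfolding F_def
    by (intro holomorphic_intros hyp2F1_reg_holomorphic c)
  have ev: "\<forall>\<^sub>F z in at 0. F z = hyp2F1_reg_series a b (1 - of_nat m) z"
    using eventually_at_0_unit_ball
    by eventually_elim (simp add: F_def hyp2F1_reg_series_shift hyp2F1_reg_eq_series[OF c])
  show 1: "hyp2F1_continuable a b (1 - of_nat m)" by (rule hyp2F1_continuableI[OF F ev])
  show "hyp2F1_reg a b (1 - of_nat m) z =
     pochhammer a m * pochhammer b m * z ^ m * hyp2F1_reg (a + of_nat m) (b + of_nat m) (1 + of_nat m) z"
    if "z \<in> cut_plane" using hyp2F1_reg_eqI[OF 1 F ev that] by (simp add: F_def)
qed

lemmas hyp2F1_reg_shift = hyp2F1_continuable_shift(2)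

lemma hyp2F1_continuable_int:
  assumes "A \<notin> \<int>" "B \<notin> \<int>"
  shows "hyp2F1_continuable A B (of_int k)"
proof (cases "k > 0")
  case True
  hence "k = int (Suc (nat (k - 1)))" by simp
  thus ?thesis using hyp2F1_continuable_pos_int[OF assms] by (metis of_int_of_nat_eq)
next
  case False
  hence "of_int k = 1 - (of_nat (nat (1 - k)) :: complex)" by simp
  thus ?thesis using hyp2F1_continuable_shift(1)[OF assms] by metis
qed

lemma pochhammer_nonzero: "(a :: complex) \<notin> \<int> \<Longrightarrow> pochhammer a n \<noteq> 0"
  by (auto simp: pochhammer_eq_0_iff)

section \<open>Pfaff's transformation\<close>

lemma pochhammer_reflect:
  "pochhammer (1 - a - of_nat n) n = (- 1) ^ n * pochhammer (a :: complex) n"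
  using pochhammer_minus[of "a + of_nat n - 1" n] by (simp add: algebra_simps)

lemma cut_plane_pfaff: "z \<in> cut_plane \<Longrightarrow> z / (z - 1) \<in> cut_plane"
proof -
  assume z: "z \<in> cut_plane"
  hence "1 - z \<noteq> 0" by (auto simp: mem_cut_plane_iff)
  hence "1 - z / (z - 1) = inverse (1 - z)" by (simp add: field_simps)
  moreover have "inverse (1 - z) \<notin> \<real>\<^sub>\<le>\<^sub>0" using z
    by (metis mem_cut_plane_iff inverse_inverse_eq nonpos_Reals_inverse_iff)
  ultimately show ?thesis by (simp add: mem_cut_plane_iff)
qed

text \<open>The correlation identity with \<open>P = Q = 0\<close> and \<open>R = P' = 1\<close>:
  its left-hand side is itself a Gauss series in \<open>z\<close>, its right-hand side one in
  \<open>z / (z - 1)\<close>. The common Pochhammer factor is nonzero since \<open>a = A - n\<close>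
  is not an integer, and the identity theorem carries the result to the cut plane.\<close>

lemma hyp2F1_reg_pfaff_pos:
  assumes A: "A \<notin> \<int>" and B: "B \<notin> \<int>" and z: "z \<in> cut_plane"
  shows "hyp2F1_reg A B (of_nat (Suc n)) (z / (z - 1)) =
           (1 - z) powr B * hyp2F1_reg (of_nat (Suc n) - A) B (of_nat (Suc n)) z"
proof -
  have A': "of_nat (Suc n) - A \<notin> \<int>" using A by (metis Ints_diff Ints_of_nat diff_diff_eq2 add_diff_cancel_left')
  define a where "a = A - of_nat n"
  have a: "a \<notin> \<int>" using A unfolding a_def by (metis Ints_add Ints_of_nat diff_add_cancel)
  have A_eq: "A = a + of_nat n" by (simp add: a_def)
  have c1: "hyp2F1_continuable A B (of_nat (Suc n))" by (intro hyp2F1_continuable_pos_int A B)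
  have c2: "hyp2F1_continuable (of_nat (Suc n) - A) B (of_nat (Suc n))"
    by (intro hyp2F1_continuable_pos_int A' B)
  define f where "f = (\<lambda>z. hyp2F1_reg A B (of_nat (Suc n)) (z / (z - 1)))"
  define g where "g = (\<lambda>z. (1 - z) powr B * hyp2F1_reg (of_nat (Suc n) - A) B (of_nat (Suc n)) z)"
  have ne1: "z \<noteq> 1" if "z \<in> cut_plane" for z using that by (auto simp: mem_cut_plane_iff)
  have "(hyp2F1_reg A B (of_nat (Suc n)) \<circ> (\<lambda>z. z / (z - 1))) holomorphic_on cut_plane"
    by (rule holomorphic_on_compose_gen[OF _ hyp2F1_reg_holomorphic[OF c1]])
       (use ne1 cut_plane_pfaff in \<open>auto intro!: holomorphic_intros\<close>)
  hence f: "f holomorphic_on cut_plane" by (simp add: f_def o_def)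
  have g: "g holomorphic_on cut_plane" unfolding g_def
    by (intro holomorphic_intros hyp2F1_reg_holomorphic c2) (simp add: mem_cut_plane_iff)
  have coeff: "binomial2_coeff a1 a2 0 1 k = rising_coeff a2 k" for a1 a2 k
  proof -
    have "binomial2_coeff a1 a2 0 1 k = (\<Sum>i\<le>k. if i = 0 then rising_coeff a2 k else 0)"
      unfolding binomial2_coeff_def by (intro sum.cong) (auto simp: power_0_left rising_coeff_def)
    thus ?thesis by simp
  qed
  have coeff': "binomial2_coeff a1 a2 1 0 k = rising_coeff a1 k" for a1 a2 k
  proof -
    have "binomial2_coeff a1 a2 1 0 k = (\<Sum>i\<le>k. if i = k then rising_coeff a1 i else 0)"
      unfolding binomial2_coeff_def by (intro sum.cong) (auto simp: power_0_left rising_coeff_def)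
    thus ?thesis by simp
  qed
  have "\<forall>\<^sub>F z in at 0. f z = g z"
  proof -
    have near: "\<forall>\<^sub>F z in at 0. (\<lambda>m. rising_coeff (1 - of_nat n - a) (n + m) * rising_coeff B m * z ^ m) sums
        ((1 - z) powr (- B) * (pochhammer a n * (- 1) ^ n * hyp2F1_reg_series (a + of_nat n) B (of_nat (Suc n)) (- (z / (1 - z)))))"
      using binomial2_correlation_near_0[of a "1 - of_nat n - a" n B "1 + of_nat n - B" 0 1 1 0]
      unfolding coeff coeff' by (simp del: of_nat_Suc)
    have "((\<lambda>z. z / (z - 1)) \<longlongrightarrow> 0 / (0 - 1)) (at (0::complex))" by (intro tendsto_intros) simp_all
    hence "\<forall>\<^sub>F z in at (0::complex). norm (z / (z - 1)) < 1"
      by (intro order_tendstoD(2)[of _ 0]) (auto intro!: tendsto_norm_zero)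
    with eventually_at_0_unit_ball
         near
    show ?thesis
    proof eventually_elim
      case (elim z)
      have "1 - z \<noteq> 0" using elim(1) by auto
      hence pw: "(1 - z) powr (- B) * (1 - z) powr B = 1" by (simp flip: powr_add)
      have "(\<lambda>m. rising_coeff (1 - of_nat n - a) (n + m) * rising_coeff B m * z ^ m) sums
        ((1 - z) powr (- B) * (pochhammer a n * (- 1) ^ n * hyp2F1_reg_series (a + of_nat n) B (of_nat (Suc n)) (z / (z - 1))))"
        using elim(2) minus_divide_right[of z "1 - z"] unfolding minus_diff_eq by metis
      moreover have "(\<lambda>m. rising_coeff (1 - of_nat n - a) (n + m) * rising_coeff B m * z ^ m) sums
        (pochhammer (1 - of_nat n - a) n * hyp2F1_reg_series (1 - of_nat n - a + of_nat n) B (of_nat (Suc n)) z)"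
        unfolding rising_coeff_hyp2F1_term mult.assoc
        by (intro sums_mult) (use hyp2F1_reg_series_sums[OF elim(1), of "1 - of_nat n - a + of_nat n" B "of_nat (Suc n)"] in \<open>simp add: mult_ac\<close>)
      ultimately have "(1 - z) powr (- B) * (pochhammer a n * (- 1) ^ n * hyp2F1_reg_series (a + of_nat n) B (of_nat (Suc n)) (z / (z - 1))) =
         pochhammer (1 - of_nat n - a) n * hyp2F1_reg_series (1 - of_nat n - a + of_nat n) B (of_nat (Suc n)) z"
        by (rule sums_unique2)
      also have "pochhammer (1 - of_nat n - a) n = (- 1) ^ n * pochhammer a n"
        using pochhammer_reflect[of a n] by (simp add: algebra_simps)
      also have "1 - of_nat n - a + of_nat n = of_nat (Suc n) - A" by (simp add: A_eq)
      finally have h: "(1 - z) powr (- B) * hyp2F1_reg_series A B (of_nat (Suc n)) (z / (z - 1)) =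
         hyp2F1_reg_series (of_nat (Suc n) - A) B (of_nat (Suc n)) z"
        using pochhammer_nonzero[OF a, of n] by (simp add: A_eq)
      have "hyp2F1_reg_series A B (of_nat (Suc n)) (z / (z - 1)) =
          (1 - z) powr (- B) * (1 - z) powr B * hyp2F1_reg_series A B (of_nat (Suc n)) (z / (z - 1))"
        unfolding pw by simp
      also have "\<dots> = (1 - z) powr B * ((1 - z) powr (- B) * hyp2F1_reg_series A B (of_nat (Suc n)) (z / (z - 1)))"
        by (simp only: mult_ac)
      finally have "hyp2F1_reg_series A B (of_nat (Suc n)) (z / (z - 1)) =
         (1 - z) powr B * hyp2F1_reg_series (of_nat (Suc n) - A) B (of_nat (Suc n)) z"
        unfolding h .
      thus ?case using elim by (simp add: f_def g_def hyp2F1_reg_eq_series[OF c1] hyp2F1_reg_eq_series[OF c2] del: of_nat_Suc)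
    qed
  qed
  from holomorphic_eq_from_germ[OF open_cut_plane connected_cut_plane f g zero_in_cut_plane this z]
  show ?thesis by (simp add: f_def g_def)
qed

text \<open>For a non-positive lower parameter both sides are shifted to lower parameter
  \<open>1 + m\<close>. The sign from \<open>(z / (z - 1)) ^ m * (1 - z) ^ m\<close> matches the one
  from reflecting the Pochhammer symbol.\<close>

lemma hyp2F1_reg_pfaff:
  assumes A: "A \<notin> \<int>" and B: "B \<notin> \<int>" and z: "z \<in> cut_plane"
  shows "hyp2F1_reg A B (of_int k) (z / (z - 1)) =
           (1 - z) powr B * hyp2F1_reg (of_int k - A) B (of_int k) z"
proof (cases "k > 0")
  case True
  hence "k = int (Suc (nat (k - 1)))" by simp
  thus ?thesis using hyp2F1_reg_pfaff_pos[OF assms] by (metis of_int_of_nat_eq)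
next
  case False
  define m where "m = nat (1 - k)"
  have k: "of_int k = 1 - (of_nat m :: complex)" using False by (simp add: m_def)
  have nz: "1 - z \<noteq> 0" using z by (auto simp: mem_cut_plane_iff)
  have A': "1 - of_nat m - A \<notin> \<int>" using A by (metis Ints_1 Ints_diff Ints_of_nat diff_diff_eq2 add_diff_cancel_left' diff_add_eq_diff_diff_swap)
  define H where "H = hyp2F1_reg (1 - A) (B + of_nat m) (1 + of_nat m) z"
  have s1: "(1 - z) powr (B + of_nat m) = (1 - z) powr B * (1 - z) ^ m"
    using nz by (simp add: powr_add powr_nat')
  have "z / (z - 1) * (1 - z) = - 1 * z" using nz by (simp add: field_simps)
  hence s2: "(z / (z - 1)) ^ m * (1 - z) ^ m = (- 1) ^ m * z ^ m"
    unfolding power_mult_distrib[symmetric] by (simp only:)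
  have s3: "hyp2F1_reg (A + of_nat m) (B + of_nat m) (1 + of_nat m) (z / (z - 1)) =
      (1 - z) powr (B + of_nat m) * H" unfolding H_def
    using hyp2F1_reg_pfaff_pos[OF add_of_nat_notin_Ints[OF A, of m] add_of_nat_notin_Ints[OF B, of m] z, of m] by simp
  have s4: "hyp2F1_reg (1 - of_nat m - A) B (1 - of_nat m) z =
      pochhammer (1 - of_nat m - A) m * pochhammer B m * z ^ m * H"
    using hyp2F1_reg_shift[OF A' B z, of m] by (simp add: H_def)
  have s5: "pochhammer (1 - of_nat m - A) m = (- 1) ^ m * pochhammer A m"
    using pochhammer_reflect[of A m] by (simp add: algebra_simps)
  have "hyp2F1_reg A B (1 - of_nat m) (z / (z - 1)) =
      pochhammer A m * pochhammer B m * (z / (z - 1)) ^ m * ((1 - z) powr B * (1 - z) ^ m * H)"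
    unfolding hyp2F1_reg_shift[OF A B cut_plane_pfaff[OF z]] s3 s1 ..
  also have "\<dots> = pochhammer A m * pochhammer B m * ((z / (z - 1)) ^ m * (1 - z) ^ m) * (1 - z) powr B * H"
    by (simp only: mult_ac)
  also have "\<dots> = (1 - z) powr B * hyp2F1_reg (1 - of_nat m - A) B (1 - of_nat m) z"
    unfolding s2 s4 s5 by (simp only: mult_ac)
  finally show ?thesis unfolding k .
qed

section \<open>Correlations of binomial coefficients\<close>

text \<open>
  The quotient equals \<open>1 / (1 - a) + 1 / (1 - b) - 1\<close>.  Hence a cross ratio as in the next lemmas is a
  quotient of two points of the right half plane and never meets the branch cut.
\<close>

lemma Re_cross_quotient_pos:
  fixes a b :: complex
  assumes "norm a < 1" "norm b < 1"
  shows "Re ((1 - a * b) / ((1 - a) * (1 - b))) > 0"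
proof -
  have half: "Re (1 / (1 - z)) > 1/2" if "norm z < 1" for z :: complex
  proof -
    have "(norm z)\<^sup>2 < 1" using that by (simp add: abs_square_less_1)
    hence "(Re z)\<^sup>2 + (Im z)\<^sup>2 < 1" by (simp add: cmod_power2)
    moreover have "1 - Re z > 0" using Re_one_minus_pos[OF that] by simp
    hence "(1 - Re z)\<^sup>2 + (Im z)\<^sup>2 > 0" by (simp add: sum_power2_gt_zero_iff)
    ultimately show ?thesis by (simp add: Re_divide field_simps power2_eq_square)
  qed
  have nz: "1 - a \<noteq> 0" "1 - b \<noteq> 0" using assms by auto
  have "(1 - a * b) / ((1 - a) * (1 - b)) = 1 / (1 - a) + 1 / (1 - b) - 1"
    using nz by (simp add: divide_simps) (simp add: algebra_simps)
  thus ?thesis using half[OF assms(1)] half[OF assms(2)] by simp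
qed

text \<open>The two sides differ by \<open>2 \<pi> \<i> k\<close>. The left one has imaginary part
  below \<open>\<pi> / 2\<close> in modulus, the right one below \<open>3 \<pi> / 2\<close>, which
  forces \<open>k = 0\<close>.\<close>

lemma Ln_cross_quotient:
  fixes a b :: complex
  assumes "norm a < 1" "norm b < 1"
  shows "Ln ((1 - a * b) / ((1 - a) * (1 - b))) = Ln (1 - a * b) - Ln (1 - a) - Ln (1 - b)"
proof -
  define U where "U = (1 - a * b) / ((1 - a) * (1 - b))"
  define L where "L = Ln (1 - a * b) - Ln (1 - a) - Ln (1 - b)"
  have "norm a * norm b < 1 * 1" using assms by (intro mult_strict_mono') auto
  hence ab: "norm (a * b) < 1" by (simp add: norm_mult)
  have im: "\<bar>Im (Ln w)\<bar> < pi / 2" if "Re w > 0" for w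
    using that Re_Ln_pos_lt[of w] by (cases "w = 0") auto
  have nz: "1 - a \<noteq> 0" "1 - b \<noteq> 0" "1 - a * b \<noteq> 0" using assms ab by auto
  have "exp L = U" using nz by (simp add: L_def U_def exp_diff)
  moreover have "U \<noteq> 0" using nz by (simp add: U_def)
  ultimately have "exp (Ln U) = exp L" by simp
  then obtain k :: int where k: "Ln U = L + of_int (2 * k) * (of_real pi * \<i>)"
    by (subst (asm) exp_eq) (auto simp: mult_ac)
  hence "2 * of_int k * pi = Im (Ln U) - Im L" by simp
  moreover have "\<bar>Im (Ln U)\<bar> < pi / 2" unfolding U_def by (intro im Re_cross_quotient_pos assms)
  moreover have "\<bar>Im (Ln (1 - a * b))\<bar> < pi / 2" "\<bar>Im (Ln (1 - a))\<bar> < pi / 2" "\<bar>Im (Ln (1 - b))\<bar> < pi / 2"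
    by (intro im Re_one_minus_pos ab assms)+
  hence "\<bar>Im L\<bar> < 3 * (pi / 2)" unfolding L_def minus_complex.sel by linarith
  ultimately have "\<bar>of_int k * pi\<bar> < 1 * pi" by linarith
  hence "\<bar>of_int k :: real\<bar> < 1" by (simp add: abs_mult)
  hence "k = 0" by linarith
  with k show ?thesis by (simp add: U_def L_def)
qed

lemma
  fixes a b c d :: complex
  assumes ab: "norm a < 1" "norm b < 1" and cd: "norm c < 1" "norm d < 1" and eq: "a * b = c * d"
  shows cross_ratio_notin_nonpos_Reals: "(1 - a) * (1 - b) / ((1 - c) * (1 - d)) \<notin> \<real>\<^sub>\<le>\<^sub>0"
    and Ln_cross_ratio: "Ln ((1 - a) * (1 - b) / ((1 - c) * (1 - d))) =
           Ln (1 - a) + Ln (1 - b) - Ln (1 - c) - Ln (1 - d)"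
proof -
  define U where "U = (1 - a * b) / ((1 - a) * (1 - b))"
  define V where "V = (1 - c * d) / ((1 - c) * (1 - d))"
  define X where "X = (1 - a) * (1 - b) / ((1 - c) * (1 - d))"
  have "norm a * norm b < 1 * 1" using ab by (intro mult_strict_mono') auto
  hence "norm (a * b) < 1" by (simp add: norm_mult)
  hence nz: "1 - a \<noteq> 0" "1 - b \<noteq> 0" "1 - c \<noteq> 0" "1 - d \<noteq> 0" "1 - a * b \<noteq> 0" using assms by auto
  have UV: "Re U > 0" "Re V > 0" unfolding U_def V_def by (intro Re_cross_quotient_pos ab cd)+
  \<comment> \<open>By \<open>a * b = c * d\<close> the numerators of \<open>U\<close> and
    \<open>V\<close> agree and cancel.\<close>
  have X: "X = V / U" using nz by (simp add: U_def V_def X_def eq)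
  have L: "Ln X = Ln V - Ln U" unfolding X by (rule Ln_divide_right_half_plane[OF UV(2,1)])
  show "Ln ((1 - a) * (1 - b) / ((1 - c) * (1 - d))) = Ln (1 - a) + Ln (1 - b) - Ln (1 - c) - Ln (1 - d)"
    using L Ln_cross_quotient[OF ab] Ln_cross_quotient[OF cd] by (simp add: X_def U_def V_def eq)
  have im: "\<bar>Im (Ln w)\<bar> < pi / 2" if "Re w > 0" for w
    using that Re_Ln_pos_lt[of w] by (cases "w = 0") auto
  have "Im (Ln X) < pi" using im[OF UV(1)] im[OF UV(2)] unfolding L minus_complex.sel by linarith
  moreover have "X \<noteq> 0" using nz by (simp add: X_def)
  ultimately show "(1 - a) * (1 - b) / ((1 - c) * (1 - d)) \<notin> \<real>\<^sub>\<le>\<^sub>0"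
    using Im_Ln_eq_pi[of X] unfolding X_def[symmetric]
    by (auto simp: complex_nonpos_Reals_iff complex_eq_iff less_le)
qed

definition correlation_arg :: "complex \<Rightarrow> complex \<Rightarrow> complex \<Rightarrow> complex \<Rightarrow> complex" where
  "correlation_arg P R P' Q = (P - R) * (P' - Q) / ((1 - P * Q) * (1 - P' * R))"

lemma one_minus_correlation_arg:
  assumes "1 - P * Q \<noteq> 0" "1 - P' * R \<noteq> 0"
  shows "1 - correlation_arg P R P' Q = (1 - P * P') * (1 - R * Q) / ((1 - P * Q) * (1 - P' * R))"
  using assms by (simp add: correlation_arg_def divide_simps) (simp add: algebra_simps)

text \<open>The cross ratio has entries \<open>P * P'\<close>, \<open>R * Q\<close> over
  \<open>P * Q\<close>, \<open>P' * R\<close>; both pairs have the same product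
  \<open>P * R * P' * Q\<close>.\<close>

lemma
  assumes "norm (P * P') < 1" "norm (P * Q) < 1" "norm (R * P') < 1" "norm (R * Q) < 1"
  shows correlation_arg_in_cut_plane: "correlation_arg P R P' Q \<in> cut_plane"
    and Ln_one_minus_correlation_arg: "Ln (1 - correlation_arg P R P' Q) =
      Ln (1 - P * P') + Ln (1 - R * Q) - Ln (1 - P * Q) - Ln (1 - P' * R)"
proof -
  have "1 - P * Q \<noteq> 0" "1 - P' * R \<noteq> 0" using assms by (auto simp: mult.commute)
  note eq = one_minus_correlation_arg[OF this]
  have lt: "norm (P' * R) < 1" using assms by (simp add: mult.commute)
  show "correlation_arg P R P' Q \<in> cut_plane" unfolding mem_cut_plane_iff eq
    by (rule cross_ratio_notin_nonpos_Reals) (use assms lt in simp_all)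
  show "Ln (1 - correlation_arg P R P' Q) =
      Ln (1 - P * P') + Ln (1 - R * Q) - Ln (1 - P * Q) - Ln (1 - P' * R)" unfolding eq
    by (rule Ln_cross_ratio) (use assms lt in simp_all)
qed

lemma binomial2_correlation_sums:
  fixes P R P' Q a1 a2 b1 b2 :: complex and n :: nat
  assumes lt: "norm (P * P') < 1" "norm (P * Q) < 1" "norm (R * P') < 1" "norm (R * Q) < 1"
    and a: "a1 + a2 = 1 - of_nat n" and b: "b1 + b2 = 1 + of_nat n" and "a1 \<notin> \<int>" "b1 \<notin> \<int>"
  shows "(\<lambda>m. binomial2_coeff a1 a2 P R (n + m) * binomial2_coeff b1 b2 P' Q m) sums
     ((1 - P * Q) powr (- a1) * (1 - R * Q) powr (a1 + b1 - 1) * (1 - P' * R) powr (- b1) *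
      (pochhammer a1 n * ((P - R) / (1 - P * Q)) ^ n *
       hyp2F1_reg (a1 + of_nat n) b1 (of_nat (Suc n)) (correlation_arg P R P' Q)))"
proof -
  define K where "K = Max {norm (P * P'), norm (P * Q), norm (R * P'), norm (R * Q)}"
  have K: "norm (P * P') \<le> K" "norm (P * Q) \<le> K" "norm (R * P') \<le> K" "norm (R * Q) \<le> K" "K < 1"
    using lt by (auto simp: K_def)
  have K0: "0 \<le> K" using K(1) norm_ge_zero[of "P * P'"] by linarith
  \<comment> \<open>The reciprocal of the mean of 1 and \<open>K\<close>: a radius beyond 1 with
    \<open>r * K < 1\<close>, valid also for \<open>K = 0\<close>.\<close>
  define r where "r = 2 / (1 + K)"
  have r: "r > 1" "r * K < 1" using K0 K(5) by (simp_all add: r_def field_simps)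
  define c where "c = (\<lambda>m. binomial2_coeff a1 a2 P R (n + m) * binomial2_coeff b1 b2 P' Q m)"
  define T where "T = (\<lambda>z. \<Sum>m. c m * z ^ m)"
  have less: "norm (z * x) < 1" if "norm z < r" "norm x \<le> K" for z x :: complex
  proof -
    have "norm (z * x) \<le> r * K" unfolding norm_mult using that r K0 by (intro mult_mono) auto
    thus ?thesis using r by simp
  qed
  have sums: "(\<lambda>m. c m * z ^ m) sums T z" if "norm z < r" for z
    unfolding T_def c_def
    by (intro summable_sums summable_norm_cancel[OF summable_binomial2_correlation] less that K)
  have holT: "T holomorphic_on ball 0 r"
    by (rule power_series_holomorphic[where a = c]) (use sums in simp)
  define \<zeta> where "\<zeta> = (\<lambda>z. z * ((P - R) * (P' - Q)) / ((1 - z * (P * Q)) * (1 - z * (P' * R))))"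
  define G where "G = (\<lambda>z. (1 - z * (P * Q)) powr (- a1) * (1 - z * (R * Q)) powr (a1 + b1 - 1) * (1 - z * (P' * R)) powr (- b1) *
      (pochhammer a1 n * ((P - R) / (1 - z * (P * Q))) ^ n *
       hyp2F1_reg (a1 + of_nat n) b1 (of_nat (Suc n)) (\<zeta> z)))"
  have cont: "hyp2F1_continuable (a1 + of_nat n) b1 (of_nat (Suc n))"
    by (intro hyp2F1_continuable_pos_int add_of_nat_notin_Ints assms)
  have K': "norm (P' * R) \<le> K" using K by (simp add: mult.commute)
  have Re: "Re (1 - z * x) > 0" if "norm z < r" "norm x \<le> K" for z x :: complex
    by (rule Re_one_minus_pos[OF less[OF that]])
  have nz: "1 - z * x \<noteq> 0" if "norm z < r" "norm x \<le> K" for z x :: complex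
    using Re[OF that] by (metis less_irrefl zero_complex.simps(1))
  have np: "1 - z * x \<notin> \<real>\<^sub>\<le>\<^sub>0" if "norm z < r" "norm x \<le> K" for z x :: complex
    using Re[OF that] by (auto simp: complex_nonpos_Reals_iff)
  have \<zeta>: "\<zeta> z = correlation_arg (z * P) (z * R) P' Q" for z
    by (simp add: \<zeta>_def correlation_arg_def mult_ac right_diff_distrib)
  have \<zeta>cut: "\<zeta> z \<in> cut_plane" if "norm z < r" for z
    unfolding \<zeta> by (rule correlation_arg_in_cut_plane) (use less[OF that] K in \<open>simp_all add: mult.assoc\<close>)
  have hol\<zeta>: "\<zeta> holomorphic_on ball 0 r" unfolding \<zeta>_def
    by (intro holomorphic_intros) (use nz K K' in auto)
  have "(hyp2F1_reg (a1 + of_nat n) b1 (of_nat (Suc n)) \<circ> \<zeta>) holomorphic_on ball 0 r"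
    by (rule holomorphic_on_compose_gen[OF hol\<zeta> hyp2F1_reg_holomorphic[OF cont]]) (use \<zeta>cut in auto)
  hence holG: "G holomorphic_on ball 0 r" unfolding G_def o_def
    by (intro holomorphic_intros) (use np nz K K' in auto)
  have ev: "\<forall>\<^sub>F z in at 0. T z = G z"
  proof -
    have "isCont \<zeta> 0"
      by (rule continuous_on_interior[OF holomorphic_on_imp_continuous_on[OF hol\<zeta>]])
         (use r in \<open>simp add: interior_open\<close>)
    moreover have "\<zeta> 0 = 0" by (simp add: \<zeta>_def)
    ultimately have "\<zeta> \<midarrow>0\<rightarrow> 0" by (simp add: isCont_def)
    hence "\<forall>\<^sub>F z in at 0. norm (\<zeta> z) < 1"
      by (intro order_tendstoD(2)[of _ 0]) (auto intro!: tendsto_norm_zero)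
    with eventually_at_0_unit_ball binomial2_correlation_near_0[OF a b, of P R P' Q] show ?thesis
    proof eventually_elim
      case (elim z)
      have "hyp2F1_reg_series (a1 + of_nat n) b1 (of_nat (Suc n)) (\<zeta> z) =
            hyp2F1_reg (a1 + of_nat n) b1 (of_nat (Suc n)) (\<zeta> z)"
        by (rule hyp2F1_reg_eq_series[OF cont, symmetric]) (use elim in simp)
      hence "(\<lambda>m. c m * z ^ m) sums G z"
        using elim(2) unfolding c_def G_def \<zeta>_def by metis
      moreover have "norm z < r" using elim r by simp
      ultimately show ?case using sums_unique2[OF sums] by metis
    qed
  qed
  have "T 1 = G 1"
    by (rule holomorphic_eq_from_germ[OF open_ball connected_ball holT holG _ ev]) (use r in simp_all)
  moreover have "\<zeta> 1 = correlation_arg P R P' Q" unfolding \<zeta> by simp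
  ultimately show ?thesis using sums[of 1] r unfolding G_def c_def by simp
qed

lemma hyp2F1_reg_commute: "hyp2F1_reg A B C z = hyp2F1_reg B A C z"
proof -
  have "hyp2F1_reg_series A B C = hyp2F1_reg_series B A C"
    by (simp add: fun_eq_iff hyp2F1_reg_series_def mult.commute[of "pochhammer A _"])
  thus ?thesis by (simp add: hyp2F1_reg_def)
qed

text \<open>The image of \<open>correlation_arg\<close> under the map \<open>z / (z - 1)\<close> of Pfaff's transformation.\<close>

definition correlation_pfaff_arg :: "complex \<Rightarrow> complex \<Rightarrow> complex \<Rightarrow> complex \<Rightarrow> complex" where
  "correlation_pfaff_arg P R P' Q = - ((P - R) * (P' - Q) / ((1 - P * P') * (1 - R * Q)))"

text \<open>\<open>z / (z - 1)\<close> is an involution, so Pfaff's transformation taken at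
  \<open>W\<close> returns \<open>Z\<close>. Its factor \<open>(1 - W) powr B\<close> splits into
  four principal powers because the logarithm of \<open>1 - Z\<close> splits without a branch
  correction.\<close>

lemma
  assumes "norm (P * P') < 1" "norm (P * Q) < 1" "norm (R * P') < 1" "norm (R * Q) < 1"
  shows correlation_pfaff_arg_in_cut_plane: "correlation_pfaff_arg P R P' Q \<in> cut_plane"
    and hyp2F1_reg_correlation_arg: "A \<notin> \<int> \<Longrightarrow> B \<notin> \<int> \<Longrightarrow>
      hyp2F1_reg A B (of_nat (Suc n)) (correlation_arg P R P' Q) =
        (1 - P * P') powr (- B) * (1 - R * Q) powr (- B) * (1 - P * Q) powr B * (1 - P' * R) powr B *
        hyp2F1_reg (of_nat (Suc n) - A) B (of_nat (Suc n)) (correlation_pfaff_arg P R P' Q)"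
proof -
  define Z where "Z = correlation_arg P R P' Q"
  define W where "W = correlation_pfaff_arg P R P' Q"
  have nz: "1 - P * Q \<noteq> 0" "1 - P' * R \<noteq> 0" "1 - P * P' \<noteq> 0" "1 - R * Q \<noteq> 0"
    using assms by (auto simp: mult.commute)
  have Z: "Z \<in> cut_plane" unfolding Z_def by (rule correlation_arg_in_cut_plane[OF assms])
  have oneZ: "1 - Z = (1 - P * P') * (1 - R * Q) / ((1 - P * Q) * (1 - P' * R))"
    unfolding Z_def by (rule one_minus_correlation_arg[OF nz(1,2)])
  hence Z1: "1 - Z \<noteq> 0" using nz by simp
  have "W = - (Z / (1 - Z))" unfolding oneZ using nz by (simp add: W_def Z_def correlation_arg_def correlation_pfaff_arg_def)
  hence W: "W = Z / (Z - 1)" using minus_divide_right[of Z "1 - Z"] by simp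
  show Wc: "correlation_pfaff_arg P R P' Q \<in> cut_plane"
    using cut_plane_pfaff[OF Z] W by (simp add: W_def)
  have Z1': "Z - 1 \<noteq> 0" using Z1 by simp
  have W1: "1 - W = inverse (1 - Z)" unfolding W using Z1 Z1' by (simp add: field_simps)
  have WZ: "W / (W - 1) = Z"
  proof -
    have "W / (W - 1) = - (W / (1 - W))" using minus_divide_right[of W "1 - W"] by simp
    also have "\<dots> = - (W * (1 - Z))" unfolding W1 by (simp add: divide_inverse)
    also have "\<dots> = Z" unfolding W using Z1' by (simp add: field_simps)
    finally show ?thesis .
  qed
  have npZ: "1 - Z \<notin> \<real>\<^sub>\<le>\<^sub>0" using Z by (simp add: mem_cut_plane_iff)
  assume AB: "A \<notin> \<int>" "B \<notin> \<int>"
  have "Ln (1 - W) = - Ln (1 - Z)" unfolding W1 by (rule Ln_inverse[OF npZ])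
  also have "\<dots> = - (Ln (1 - P * P') + Ln (1 - R * Q) - Ln (1 - P * Q) - Ln (1 - P' * R))"
    unfolding Z_def by (simp add: Ln_one_minus_correlation_arg[OF assms])
  finally have L: "Ln (1 - W) = - (Ln (1 - P * P') + Ln (1 - R * Q) - Ln (1 - P * Q) - Ln (1 - P' * R))" .
  have "1 - W \<noteq> 0" unfolding W1 using Z1 by simp
  hence "(1 - W) powr B = (1 - P * P') powr (- B) * (1 - R * Q) powr (- B) * (1 - P * Q) powr B * (1 - P' * R) powr B"
    using nz by (simp only: powr_def if_False L flip: exp_add) (simp add: algebra_simps)
  moreover have "hyp2F1_reg A B (of_nat (Suc n)) Z = (1 - W) powr B * hyp2F1_reg (of_nat (Suc n) - A) B (of_nat (Suc n)) W"
    using hyp2F1_reg_pfaff_pos[OF AB Wc[folded W_def], of n] unfolding WZ .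
  ultimately show "hyp2F1_reg A B (of_nat (Suc n)) (correlation_arg P R P' Q) =
        (1 - P * P') powr (- B) * (1 - R * Q) powr (- B) * (1 - P * Q) powr B * (1 - P' * R) powr B *
        hyp2F1_reg (of_nat (Suc n) - A) B (of_nat (Suc n)) (correlation_pfaff_arg P R P' Q)"
    unfolding Z_def W_def by simp
qed

section \<open>Summation over the integers\<close>

lemma abs_summable_on_Times:
  fixes f :: "'a \<Rightarrow> complex" and g :: "'b \<Rightarrow> complex"
  assumes "(\<lambda>x. norm (f x)) summable_on A" "(\<lambda>y. norm (g y)) summable_on B"
  shows "(\<lambda>q. norm (case q of (x, y) \<Rightarrow> f x * g y)) summable_on A \<times> B"
  unfolding Infinite_Sum.abs_summable_on_Sigma_iff
  using assms by (auto simp: norm_mult abs_mult infsum_cmult_right'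
      intro!: summable_on_cmult_right summable_on_cmult_left)

lemma has_sum_Times:
  fixes f :: "'a \<Rightarrow> complex" and g :: "'b \<Rightarrow> complex"
  assumes "(\<lambda>(x, y). f x * g y) summable_on A \<times> B" "(f has_sum F) A" "(g has_sum G) B"
  shows "((\<lambda>(x, y). f x * g y) has_sum (F * G)) (A \<times> B)"
proof -
  obtain T where T: "((\<lambda>(x, y). f x * g y) has_sum T) (A \<times> B)"
    using assms(1) by (auto simp: summable_on_def)
  have "((\<lambda>x. f x * G) has_sum T) A"
    by (rule has_sum_SigmaD[OF T]) (simp add: has_sum_cmult_right assms(3))
  moreover have "((\<lambda>x. f x * G) has_sum (F * G)) A" by (rule has_sum_cmult_left[OF assms(2)])
  ultimately show ?thesis using T has_sum_unique by blast
qed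

text \<open>Regrouping along the values of \<open>\<phi>\<close>. It is applied to the same fourfold
  series with two different groupings, which is how the Meixner sum and the correlation are
  identified.\<close>

lemma has_sum_fibres:
  fixes f :: "'a \<Rightarrow> complex"
  assumes "(f has_sum S) X" "\<And>y. (f has_sum g y) {x\<in>X. \<phi> x = y}"
  shows "(g has_sum S) UNIV"
proof (rule has_sum_SigmaD)
  have "((\<lambda>(y, x). f x) has_sum S) (SIGMA y:UNIV. {x\<in>X. \<phi> x = y}) \<longleftrightarrow> (f has_sum S) X"
    by (rule has_sum_reindex_bij_witness[where i = "\<lambda>x. (\<phi> x, x)" and j = snd]) auto
  with assms(1) show "((\<lambda>(y, x). f x) has_sum S) (SIGMA y:UNIV. {x\<in>X. \<phi> x = y})" by simp
qed (use assms(2) in simp)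

text \<open>
  The terms of the fourfold expansion of
  \<open>(1 - P u) powr (- a1) * (1 - R u) powr (- a2) * (1 - P' / u) powr (- b1) * (1 - Q / u) powr (- b2)\<close>;
  those with index in \<open>quad_set n\<close> contribute to \<open>u powi n\<close>.
\<close>

definition quad_term ::
  "complex \<Rightarrow> complex \<Rightarrow> complex \<Rightarrow> complex \<Rightarrow> complex \<Rightarrow> complex \<Rightarrow> complex \<Rightarrow> complex \<Rightarrow>
   (nat \<times> nat) \<times> nat \<times> nat \<Rightarrow> complex" where
  "quad_term a1 a2 b1 b2 P R P' Q = (\<lambda>((i1, i2), (j1, j2)).
     (rising_coeff a1 i1 * P ^ i1 * (rising_coeff a2 i2 * R ^ i2)) *
     (rising_coeff b1 j1 * P' ^ j1 * (rising_coeff b2 j2 * Q ^ j2)))"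

definition quad_set :: "int \<Rightarrow> ((nat \<times> nat) \<times> nat \<times> nat) set" where
  "quad_set n = {((i1, i2), (j1, j2)). int (i1 + i2) = n + int (j1 + j2)}"

lemma rising_coeff_abs_summable:
  assumes "norm z < 1"
  shows "(\<lambda>k. norm (rising_coeff a k * z ^ k)) summable_on UNIV"
  using summable_norm_rising_coeff[OF assms, of a]
  by (intro norm_summable_imp_summable_on) simp

text \<open>Moving to a circle of balancing radius \<open>u\<close> puts all four arguments into the
  unit disc, where the series is a product of absolutely convergent ones. On
  \<open>quad_set n\<close> this rescaling costs only the constant factor
  \<open>u powi n\<close>.\<close>

lemma quad_term_abs_summable:
  fixes P R P' Q :: complex
  assumes lt: "norm (P * P') < 1" "norm (P * Q) < 1" "norm (R * P') < 1" "norm (R * Q) < 1"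
  shows "(\<lambda>q. norm (quad_term a1 a2 b1 b2 P R P' Q q)) summable_on quad_set n"
proof -
  obtain u where u: "0 < u" "norm P * u < 1" "norm R * u < 1" "norm P' < u" "norm Q < u"
    by (rule balancing_radius[of "norm P" "norm R" "norm P'" "norm Q"])
       (use assms in \<open>simp_all add: norm_mult\<close>)
  define U where "U = complex_of_real u"
  have U: "U \<noteq> 0" "norm (P * U) < 1" "norm (R * U) < 1" "norm (P' / U) < 1" "norm (Q / U) < 1"
    using u by (simp_all add: U_def norm_mult norm_divide)
  define G where "G = quad_term a1 a2 b1 b2 (P * U) (R * U) (P' / U) (Q / U)"
  have "(\<lambda>q. norm (G q)) summable_on (UNIV \<times> UNIV) \<times> (UNIV \<times> UNIV)"
  proof -
    have eq: "G = (\<lambda>(x, y). (\<lambda>(i1, i2). rising_coeff a1 i1 * (P * U) ^ i1 * (rising_coeff a2 i2 * (R * U) ^ i2)) x *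
                 (\<lambda>(j1, j2). rising_coeff b1 j1 * (P' / U) ^ j1 * (rising_coeff b2 j2 * (Q / U) ^ j2)) y)"
      by (auto simp: G_def quad_term_def fun_eq_iff)
    show ?thesis unfolding eq
      by (intro abs_summable_on_Times rising_coeff_abs_summable U)
  qed
  hence "(\<lambda>q. norm (G q)) summable_on quad_set n" by (rule summable_on_subset_banach) auto
  hence "(\<lambda>q. norm (U powi (- n)) * norm (G q)) summable_on quad_set n"
    by (rule summable_on_cmult_right)
  moreover have "norm (quad_term a1 a2 b1 b2 P R P' Q q) = norm (U powi (- n)) * norm (G q)" if "q \<in> quad_set n" for q
  proof -
    obtain i1 i2 j1 j2 where q: "q = ((i1, i2), (j1, j2))" by (metis surj_pair)
    hence "int (i1 + i2) = n + int (j1 + j2)" using that by (simp add: quad_set_def)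
    hence "U powi int (i1 + i2) = U powi n * U powi int (j1 + j2)" by (simp only: power_int_add[OF disjI1[OF U(1)]])
    hence pw: "U ^ i1 * U ^ i2 = U powi n * (U ^ j1 * U ^ j2)" by (simp only: power_int_of_nat power_add)
    have "G q = quad_term a1 a2 b1 b2 P R P' Q q * ((U ^ i1 * U ^ i2) / (U ^ j1 * U ^ j2))"
      using U by (simp add: G_def quad_term_def q power_mult_distrib power_divide)
    also have "\<dots> = quad_term a1 a2 b1 b2 P R P' Q q * U powi n" unfolding pw using U by simp
    finally show ?thesis using U by (simp add: norm_mult power_int_minus flip: norm_inverse) (simp add: norm_inverse)
  qed
  ultimately show ?thesis by (simp cong: summable_on_cong)
qed

lemma binomial2_coeff_sum_antidiagonal:
  "(\<Sum>(i, l)\<in>{(i, l). i + l = m}. rising_coeff a i * P ^ i * (rising_coeff b l * R ^ l)) = binomial2_coeff a b P R m"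
  unfolding binomial2_coeff_def
  by (rule sum.reindex_bij_witness[where i = "\<lambda>i. (i, m - i)" and j = fst]) auto

lemma finite_antidiagonal: "finite {(i, l). i + l = (m :: nat)}"
  by (rule finite_subset[of _ "{..m} \<times> {..m}"]) auto

text \<open>Grouping by the power of \<open>1 / u\<close>: each fibre is a product of two finite
  antidiagonals.\<close>

lemma quad_term_sums:
  assumes "(quad_term a1 a2 b1 b2 P R P' Q has_sum S) (quad_set (int n))"
  shows "(\<lambda>m. binomial2_coeff a1 a2 P R (n + m) * binomial2_coeff b1 b2 P' Q m) sums S"
proof (rule has_sum_imp_sums, rule has_sum_fibres[OF assms, where \<phi> = "\<lambda>(_, j1, j2). j1 + j2"])
  fix m
  have set: "{q \<in> quad_set (int n). (case q of (_, j1, j2) \<Rightarrow> j1 + j2) = m} =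
        {(i, l). i + l = n + m} \<times> {(i, l). i + l = m}"
    by (auto simp: quad_set_def)
  have "sum (quad_term a1 a2 b1 b2 P R P' Q) ({(i, l). i + l = n + m} \<times> {(i, l). i + l = m}) =
         binomial2_coeff a1 a2 P R (n + m) * binomial2_coeff b1 b2 P' Q m"
    unfolding binomial2_coeff_sum_antidiagonal[symmetric] sum_product sum.cartesian_product
    by (rule sum.cong) (auto simp: quad_term_def)
  thus "(quad_term a1 a2 b1 b2 P R P' Q has_sum
          (binomial2_coeff a1 a2 P R (n + m) * binomial2_coeff b1 b2 P' Q m))
        {q \<in> quad_set (int n). (case q of (_, j1, j2) \<Rightarrow> j1 + j2) = m}"
    unfolding set by (intro has_sum_finiteI finite_cartesian_product finite_antidiagonal) simp
qed

text \<open>The substitution of \<open>1 / u\<close> for \<open>u\<close>, which reduces negative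
  indices to non-negative ones.\<close>

lemma quad_term_has_sum_swap:
  "(quad_term a1 a2 b1 b2 P R P' Q has_sum S) (quad_set n) \<longleftrightarrow>
   (quad_term b1 b2 a1 a2 P' Q P R has_sum S) (quad_set (- n))"
  by (rule has_sum_reindex_bij_witness[where i = prod.swap and j = prod.swap])
     (auto simp: quad_set_def quad_term_def)

text \<open>The coefficient of \<open>u powi N\<close> in \<open>(1 - P u) powr (- A) * (1 - P / u) powr (- B)\<close>.\<close>

definition laurent_coeff :: "complex \<Rightarrow> complex \<Rightarrow> complex \<Rightarrow> int \<Rightarrow> complex" where
  "laurent_coeff A B P N = P powi N * (Gamma (A + of_int N) / Gamma A) *
     hyp2F1_reg_series (A + of_int N) B (of_int (N + 1)) (P\<^sup>2)"

text \<open>The Gamma quotient in \<open>laurent_coeff\<close> extends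
  \<open>pochhammer A (N + j) / pochhammer (A + N) j\<close> to negative \<open>N\<close>. The
  series runs over all \<open>j\<close>, the fibre only over \<open>N + j \<ge> 0\<close>; the
  surplus terms vanish because \<open>rGamma\<close> is zero at
  \<open>N + 1 + j \<le> 0\<close>.\<close>

lemma laurent_coeff_has_sum:
  assumes A: "A \<notin> \<int>" and P: "P \<noteq> 0" "norm P < 1"
  shows "((\<lambda>(i, j). rising_coeff A i * P ^ i * (rising_coeff B j * P ^ j)) has_sum laurent_coeff A B P N)
           {(i, j). int i - int j = N}"
proof -
  define c where "c = P powi N * (Gamma (A + of_int N) / Gamma A)"
  define f where "f = (\<lambda>j. pochhammer (A + of_int N) j * pochhammer B j * rGamma (of_int (N + 1) + of_nat j) / fact j * (P\<^sup>2) ^ j)"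
  have P2: "norm (P\<^sup>2) < 1" using P by (simp add: norm_power abs_square_less_1)
  have "summable (\<lambda>j. norm (f j))" unfolding f_def by (rule summable_norm_hyp2F1_reg_series[OF P2])
  moreover have "f sums hyp2F1_reg_series (A + of_int N) B (of_int (N + 1)) (P\<^sup>2)"
    unfolding f_def by (rule hyp2F1_reg_series_sums[OF P2])
  ultimately have "(f has_sum hyp2F1_reg_series (A + of_int N) B (of_int (N + 1)) (P\<^sup>2)) UNIV"
    by (rule norm_summable_imp_has_sum)
  hence "((\<lambda>j. c * f j) has_sum laurent_coeff A B P N) UNIV"
    unfolding laurent_coeff_def c_def by (rule has_sum_cmult_right)
  also have "((\<lambda>j. c * f j) has_sum laurent_coeff A B P N) UNIV \<longleftrightarrow>
             ((\<lambda>j. c * f j) has_sum laurent_coeff A B P N) {j. N + int j \<ge> 0}"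
  proof (rule has_sum_cong_neutral)
    fix j assume "j \<in> UNIV - {j. N + int j \<ge> 0}"
    hence "of_int (N + 1) + of_nat j = (- of_nat (nat (- (N + 1 + int j))) :: complex)" by simp
    hence "rGamma (of_int (N + 1) + of_nat j :: complex) = 0" by (simp only: rGamma_eq_zero_iff) simp
    thus "c * f j = 0" by (simp add: f_def)
  qed auto
  also have "\<dots> \<longleftrightarrow> ((\<lambda>(i, j). rising_coeff A i * P ^ i * (rising_coeff B j * P ^ j)) has_sum laurent_coeff A B P N)
           {(i, j). int i - int j = N}"
  proof (rule has_sum_reindex_bij_witness[where j = "\<lambda>j. (nat (N + int j), j)" and i = snd])
    fix j assume "j \<in> {j. N + int j \<ge> 0}"
    then obtain i where i: "N + int j = int i" using nonneg_int_cases by auto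
    have N: "of_int N = of_nat i - (of_nat j :: complex)" using arg_cong[OF i, of "of_int :: int \<Rightarrow> complex"] by (simp add: eq_diff_eq)
    have notin: "A + of_int k \<notin> \<int>\<^sub>\<le>\<^sub>0" for k
      using A by (metis Ints_diff Ints_of_int add_diff_cancel_right' nonpos_Ints_Int)
    have A0: "A \<notin> \<int>\<^sub>\<le>\<^sub>0" using notin[of 0] by simp
    have "pochhammer A i = Gamma (A + of_nat i) / Gamma A" by (rule pochhammer_Gamma[OF A0])
    moreover have "pochhammer (A + of_int N) j = Gamma (A + of_int N + of_nat j) / Gamma (A + of_int N)"
      by (rule pochhammer_Gamma[OF notin])
    moreover have "A + of_int N + of_nat j = A + of_nat i" by (simp add: N)
    moreover have "Gamma (A + of_int N) \<noteq> 0" using notin by (simp add: Gamma_eq_zero_iff)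
    ultimately have poch: "Gamma (A + of_int N) / Gamma A * pochhammer (A + of_int N) j = pochhammer A i" by simp
    have "of_int (N + 1) + of_nat j = of_nat (Suc 0) + (of_nat i :: complex)" by (simp add: N)
    hence rg: "rGamma (of_int (N + 1) + of_nat j :: complex) = 1 / fact i" using rGamma_of_nat_Suc[of 0 i] by (simp only: add_0)
    have "N = int i + (- int j)" using i by simp
    hence "P powi N = P ^ i * inverse (P ^ j)"
      by (simp only: power_int_add[OF disjI1[OF P(1)]] power_int_minus power_int_of_nat)
    hence pw: "P powi N * (P\<^sup>2) ^ j = P ^ i * P ^ j"
      using P by (simp add: power2_eq_square power_mult_distrib)
    have "c * f j = (Gamma (A + of_int N) / Gamma A * pochhammer (A + of_int N) j) * (1 / fact i) *
         (pochhammer B j / fact j) * (P powi N * (P\<^sup>2) ^ j)"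
      unfolding c_def f_def rg by (simp add: mult_ac)
    also have "\<dots> = rising_coeff A i * P ^ i * (rising_coeff B j * P ^ j)"
      unfolding poch pw by (simp add: rising_coeff_def)
    finally show "(case (nat (N + int j), j) of (i, j) \<Rightarrow> rising_coeff A i * P ^ i * (rising_coeff B j * P ^ j)) = c * f j"
      by (simp add: i)
  qed auto
  finally show ?thesis .
qed

text \<open>The other grouping pairs the two factors with \<open>P\<close> and the two with
  \<open>\<sigma>\<close>. On a fibre \<open>i1 - j1 = N - x\<close> and
  \<open>j2 - i2 = N - y\<close>, so the powers of \<open>t\<close> combine to
  \<open>t powi (N - y)\<close> and the sum factors into two Laurent coefficients.\<close>

lemma quad_term_has_sum_laurent:
  fixes P \<sigma> t :: complex and x y :: int
  assumes "a1 \<notin> \<int>" "b2 \<notin> \<int>" "P \<noteq> 0" "norm P < 1" "\<sigma> \<noteq> 0" "norm \<sigma> < 1" "t \<noteq> 0"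
    and abs: "(\<lambda>q. norm (quad_term a1 a2 b1 b2 P (\<sigma> / t) P (\<sigma> * t) q)) summable_on quad_set (y - x)"
    and S: "(quad_term a1 a2 b1 b2 P (\<sigma> / t) P (\<sigma> * t) has_sum S) (quad_set (y - x))"
  shows "((\<lambda>N. t powi (N - y) * (laurent_coeff a1 b1 P (N - x) * laurent_coeff b2 a2 \<sigma> (N - y))) has_sum S) UNIV"
proof (rule has_sum_fibres[OF S, where \<phi> = "\<lambda>((i1, _), (j1, _)). x + int i1 - int j1"])
  fix N :: int
  define X where "X = {q \<in> quad_set (y - x). (\<lambda>((i1, _), (j1, _)). x + int i1 - int j1) q = N}"
  define U where "U = {(i, j). int i - int j = N - x}"
  define V where "V = {(i, j). int i - int j = N - y}"
  define f where "f = (\<lambda>(i, j). rising_coeff a1 i * P ^ i * (rising_coeff b1 j * P ^ j))"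
  define g where "g = (\<lambda>(i, j). rising_coeff b2 i * \<sigma> ^ i * (rising_coeff a2 j * \<sigma> ^ j))"
  have reindex: "(quad_term a1 a2 b1 b2 P (\<sigma> / t) P (\<sigma> * t) has_sum s) X \<longleftrightarrow>
                 ((\<lambda>q. t powi (N - y) * (case q of (p, r) \<Rightarrow> f p * g r)) has_sum s) (U \<times> V)" for s
  proof (rule has_sum_reindex_bij_witness[where i = "\<lambda>((i1, j1), (j2, i2)). ((i1, i2), (j1, j2))"
        and j = "\<lambda>((i1, i2), (j1, j2)). ((i1, j1), (j2, i2))"])
    fix q assume "q \<in> X"
    then obtain i1 i2 j1 j2 where q: "q = ((i1, i2), (j1, j2))" "int (i1 + i2) = y - x + int (j1 + j2)" "x + int i1 - int j1 = N"
      unfolding X_def quad_set_def by auto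
    have "N - y = int j2 + (- int i2)" using q by simp
    hence "t powi (N - y) = t ^ j2 * inverse (t ^ i2)"
      by (simp only: power_int_add[OF disjI1[OF assms(7)]] power_int_minus power_int_of_nat)
    thus "t powi (N - y) * (case (\<lambda>((i1, i2), (j1, j2)). ((i1, j1), (j2, i2))) q of (p, r) \<Rightarrow> f p * g r) =
          quad_term a1 a2 b1 b2 P (\<sigma> / t) P (\<sigma> * t) q"
      by (simp add: q(1) f_def g_def quad_term_def power_divide power_mult_distrib field_simps)
  qed (auto simp: X_def U_def V_def quad_set_def)
  have "X \<subseteq> quad_set (y - x)" by (auto simp: X_def)
  hence "quad_term a1 a2 b1 b2 P (\<sigma> / t) P (\<sigma> * t) summable_on X"
    using abs summable_on_subset_banach abs_summable_summable by blast
  then obtain s where "((\<lambda>q. t powi (N - y) * (case q of (p, r) \<Rightarrow> f p * g r)) has_sum s) (U \<times> V)"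
    unfolding summable_on_def reindex by blast
  hence "((\<lambda>q. t powi (y - N) * (t powi (N - y) * (case q of (p, r) \<Rightarrow> f p * g r))) has_sum (t powi (y - N) * s)) (U \<times> V)"
    by (rule has_sum_cmult_right)
  moreover have "t powi (y - N) * t powi (N - y) = 1"
    using assms(7) by (simp flip: power_int_add)
  hence "t powi (y - N) * (t powi (N - y) * w) = w" for w by (simp flip: mult.assoc)
  ultimately have "(\<lambda>(p, r). f p * g r) summable_on U \<times> V"
    by (auto simp: summable_on_def case_prod_unfold)
  moreover have "(f has_sum laurent_coeff a1 b1 P (N - x)) U"
    unfolding f_def U_def by (intro laurent_coeff_has_sum assms)
  moreover have "(g has_sum laurent_coeff b2 a2 \<sigma> (N - y)) V"
    unfolding g_def V_def by (intro laurent_coeff_has_sum assms)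
  ultimately have "((\<lambda>(p, r). f p * g r) has_sum (laurent_coeff a1 b1 P (N - x) * laurent_coeff b2 a2 \<sigma> (N - y))) (U \<times> V)"
    by (rule has_sum_Times)
  from has_sum_cmult_right[OF this, of "t powi (N - y)"]
  show "(quad_term a1 a2 b1 b2 P (\<sigma> / t) P (\<sigma> * t) has_sum
          (t powi (N - y) * (laurent_coeff a1 b1 P (N - x) * laurent_coeff b2 a2 \<sigma> (N - y))))
        {q \<in> quad_set (y - x). (\<lambda>((i1, _), (j1, _)). x + int i1 - int j1) q = N}"
    unfolding X_def[symmetric] reindex .
qed

section \<open>Meixner functions\<close>

text \<open>Pfaff's transformation brings the correlation to the argument of the stated formula; in
  the process the powers of \<open>1 - P * R\<close> cancel.\<close>

lemma quad_term_total:
  fixes P Q R a1 a2 b1 b2 :: complex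
  assumes lt: "norm (P * P) < 1" "norm (P * Q) < 1" "norm (R * P) < 1" "norm (R * Q) < 1"
    and a: "a1 + a2 = 1 - of_nat n" and b: "b1 + b2 = 1 + of_nat n" and ni: "a1 \<notin> \<int>" "b1 \<notin> \<int>"
    and S: "(quad_term a1 a2 b1 b2 P R P Q has_sum S) (quad_set (int n))"
  shows "S = (1 - P * Q) powr (b1 - a1) * (1 - R * Q) powr (a1 - 1) * (1 - P * P) powr (- b1) *
       (pochhammer a1 n * ((P - R) / (1 - P * Q)) ^ n *
        hyp2F1_reg (1 - a1) b1 (of_nat (Suc n)) (correlation_pfaff_arg P R P Q))"
proof -
  have nz: "1 - P * Q \<noteq> 0" "1 - P * R \<noteq> 0" "1 - R * Q \<noteq> 0" using lt by (auto simp: mult.commute)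
  define H where "H = hyp2F1_reg (1 - a1) b1 (of_nat (Suc n)) (correlation_pfaff_arg P R P Q)"
  define p where "p = (P - R) / (1 - P * Q)"
  have "S = (1 - P * Q) powr (- a1) * (1 - R * Q) powr (a1 + b1 - 1) * (1 - P * R) powr (- b1) *
      (pochhammer a1 n * p ^ n * hyp2F1_reg (a1 + of_nat n) b1 (of_nat (Suc n)) (correlation_arg P R P Q))"
    unfolding p_def
    by (rule sums_unique2[OF quad_term_sums[OF S] binomial2_correlation_sums[OF lt a b ni]])
  also have "hyp2F1_reg (a1 + of_nat n) b1 (of_nat (Suc n)) (correlation_arg P R P Q) =
     (1 - P * P) powr (- b1) * (1 - R * Q) powr (- b1) * (1 - P * Q) powr b1 * (1 - P * R) powr b1 * H"
    using hyp2F1_reg_correlation_arg[OF lt add_of_nat_notin_Ints[OF ni(1)] ni(2), of n n] by (simp add: H_def)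
  finally have S: "S = ((1 - P * Q) powr (- a1) * (1 - P * Q) powr b1) *
      ((1 - R * Q) powr (a1 + b1 - 1) * (1 - R * Q) powr (- b1)) *
      ((1 - P * R) powr (- b1) * (1 - P * R) powr b1) * (1 - P * P) powr (- b1) * (pochhammer a1 n * p ^ n * H)"
    by (simp only: mult_ac)
  have e1: "(1 - P * Q) powr (- a1) * (1 - P * Q) powr b1 = (1 - P * Q) powr (b1 - a1)"
    by (simp flip: powr_add)
  have e2: "(1 - R * Q) powr (a1 + b1 - 1) * (1 - R * Q) powr (- b1) = (1 - R * Q) powr (a1 - 1)"
    by (simp flip: powr_add)
  have e3: "(1 - P * R) powr (- b1) * (1 - P * R) powr b1 = 1"
    using nz by (simp flip: powr_add)
  show ?thesis using S unfolding e1 e2 e3 H_def p_def by (simp only: mult_1_right)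
qed

text \<open>After the inversion of \<open>u\<close> the same computation applies with
  \<open>Q\<close> and \<open>R\<close> exchanged. Here the powers of \<open>1 - P * R\<close> leave
  \<open>(1 - P * R) ^ m\<close>, which clears the denominator of
  \<open>((P - Q) / (1 - P * R)) ^ m\<close>.\<close>

lemma quad_term_total_swapped:
  fixes P Q R a1 a2 b1 b2 :: complex
  assumes lt: "norm (P * P) < 1" "norm (P * Q) < 1" "norm (R * P) < 1" "norm (R * Q) < 1"
    and a: "a1 + a2 = 1 + of_nat m" and b: "b1 + b2 = 1 - of_nat m" and ni: "a1 \<notin> \<int>" "b1 \<notin> \<int>"
    and S: "(quad_term a1 a2 b1 b2 P R P Q has_sum S) (quad_set (- int m))"
  shows "S = (1 - P * Q) powr (b1 + of_nat m - a1) * (1 - R * Q) powr (a1 - 1 - of_nat m) * (1 - P * P) powr (- b1 - of_nat m) *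
       (pochhammer b1 m * (P - Q) ^ m *
        hyp2F1_reg (b1 + of_nat m) (1 + of_nat m - a1) (of_nat (Suc m)) (correlation_pfaff_arg P R P Q))"
proof -
  have lt': "norm (P * P) < 1" "norm (P * R) < 1" "norm (Q * P) < 1" "norm (Q * R) < 1"
    using lt by (simp_all add: mult.commute)
  have nz: "1 - P * Q \<noteq> 0" "1 - P * R \<noteq> 0" "1 - Q * R \<noteq> 0" using lt' by (auto simp: mult.commute)
  have S': "(quad_term b1 b2 a1 a2 P Q P R has_sum S) (quad_set (int m))"
    using S by (subst (asm) quad_term_has_sum_swap) simp
  define B where "B = b1 + of_nat m"
  have "S = (1 - P * R) powr (- b1) * (1 - Q * R) powr (b1 + a1 - 1) * (1 - P * Q) powr (- a1) *
      (pochhammer b1 m * ((P - Q) / (1 - P * R)) ^ m *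
       hyp2F1_reg B a1 (of_nat (Suc m)) (correlation_arg P Q P R))"
    unfolding B_def
    by (rule sums_unique2[OF quad_term_sums[OF S'] binomial2_correlation_sums[OF lt' b a ni(2,1)]])
  also have "hyp2F1_reg B a1 (of_nat (Suc m)) (correlation_arg P Q P R) =
     (1 - P * P) powr (- B) * (1 - Q * R) powr (- B) * (1 - P * R) powr B * (1 - P * Q) powr B *
        hyp2F1_reg (1 + of_nat m - a1) B (of_nat (Suc m)) (correlation_pfaff_arg P Q P R)"
    using hyp2F1_reg_correlation_arg[OF lt' ni(1) add_of_nat_notin_Ints[OF ni(2)], of m m]
    by (simp add: hyp2F1_reg_commute[of a1] B_def)
  also have "correlation_pfaff_arg P Q P R = correlation_pfaff_arg P R P Q"
    by (simp add: correlation_pfaff_arg_def mult.commute)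
  finally have S: "S = (1 - P * R) powr (- b1) * (1 - Q * R) powr (b1 + a1 - 1) * (1 - P * Q) powr (- a1) *
      (pochhammer b1 m * ((P - Q) / (1 - P * R)) ^ m *
       ((1 - P * P) powr (- B) * (1 - Q * R) powr (- B) * (1 - P * R) powr B * (1 - P * Q) powr B *
        hyp2F1_reg (1 + of_nat m - a1) B (of_nat (Suc m)) (correlation_pfaff_arg P R P Q)))" .
  have e1: "(1 - P * Q) powr (B - a1) = (1 - P * Q) powr (- a1) * (1 - P * Q) powr B"
    by (simp flip: powr_add)
  have e2: "(1 - Q * R) powr (a1 - 1 - of_nat m) = (1 - Q * R) powr (b1 + a1 - 1) * (1 - Q * R) powr (- B)"
    by (simp add: B_def algebra_simps flip: powr_add)
  have f1: "(1 - P * R) powr B = (1 - P * R) powr b1 * (1 - P * R) ^ m"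
    using nz by (simp add: B_def powr_add powr_nat')
  have f2: "(1 - P * R) powr (- b1) * (1 - P * R) powr b1 = 1"
    using nz by (simp flip: powr_add)
  have f3: "((P - Q) / (1 - P * R)) ^ m * (1 - P * R) ^ m = (P - Q) ^ m"
    using nz by (simp flip: power_mult_distrib)
  have "(1 - P * R) powr (- b1) * ((P - Q) / (1 - P * R)) ^ m * (1 - P * R) powr B =
        ((1 - P * R) powr (- b1) * (1 - P * R) powr b1) * (((P - Q) / (1 - P * R)) ^ m * (1 - P * R) ^ m)"
    unfolding f1 by (simp only: mult_ac)
  hence e3: "(1 - P * R) powr (- b1) * ((P - Q) / (1 - P * R)) ^ m * (1 - P * R) powr B = (P - Q) ^ m"
    unfolding f2 f3 by simp
  have "S = ((1 - P * R) powr (- b1) * ((P - Q) / (1 - P * R)) ^ m * (1 - P * R) powr B) *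
      ((1 - Q * R) powr (b1 + a1 - 1) * (1 - Q * R) powr (- B)) * ((1 - P * Q) powr (- a1) * (1 - P * Q) powr B) *
      (1 - P * P) powr (- B) * pochhammer b1 m *
        hyp2F1_reg (1 + of_nat m - a1) B (of_nat (Suc m)) (correlation_pfaff_arg P R P Q)"
    unfolding S by (simp only: mult_ac)
  also have "\<dots> = (P - Q) ^ m * (1 - Q * R) powr (a1 - 1 - of_nat m) * (1 - P * Q) powr (B - a1) *
      (1 - P * P) powr (- B) * pochhammer b1 m *
        hyp2F1_reg B (1 + of_nat m - a1) (of_nat (Suc m)) (correlation_pfaff_arg P R P Q)"
    unfolding e3 e1 e2 hyp2F1_reg_commute[of B] ..
  also have "- B = - b1 - of_nat m" by (simp add: B_def)
  finally show ?thesis unfolding B_def by (simp only: mult_ac)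
qed

lemma of_int_add_notin_Ints: "(a :: complex) \<notin> \<int> \<Longrightarrow> of_int k + a \<notin> \<int>"
  by (metis Ints_diff Ints_of_int add_diff_cancel_left')

lemma of_int_diff_notin_Ints: "(a :: complex) \<notin> \<int> \<Longrightarrow> of_int k - a \<notin> \<int>"
  by (metis Ints_diff Ints_of_int diff_diff_eq2 add_diff_cancel_left')

text \<open>Pfaff's transformation replaces \<open>c / (c - 1)\<close> by \<open>c\<close>, which
  lies in the disc of the series, and one upper parameter by \<open>1 - x - \<beta>\<close>, free of
  \<open>N\<close>. The resulting power of \<open>1 - c\<close> cancels against the normalization up
  to \<open>(1 - c) powr \<alpha>\<close>.\<close>

lemma meixner_factor:
  fixes \<alpha> \<beta> c :: complex and x N :: int
  assumes "\<alpha> \<notin> \<int>" "\<beta> \<notin> \<int>" "c \<noteq> 0" "norm c < 1"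
  shows "((1 - c) / csqrt c) powi (- N) * (Gamma (of_int N + \<alpha>) *
           hyp2F1_reg (of_int N + \<alpha>) (of_int N + \<beta>) (of_int (N + 1 - x)) (c / (c - 1))) =
         (1 - c) powr \<alpha> * Gamma (of_int x + \<alpha>) * csqrt c powi x *
           laurent_coeff (\<alpha> + of_int x) (1 - of_int x - \<beta>) (csqrt c) (N - x)"
proof -
  note ni = of_int_add_notin_Ints
  have ni': "1 - of_int x - \<beta> \<notin> \<int>" using of_int_diff_notin_Ints[OF assms(2), of "1 - x"] by simp
  have nz: "1 - c \<noteq> 0" "csqrt c \<noteq> 0" using assms by auto
  have cut: "c \<in> cut_plane" using unit_ball_subset_cut_plane assms by auto
  have cont: "hyp2F1_continuable (of_int N + \<alpha>) (1 - of_int x - \<beta>) (of_int (N + 1 - x))"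
    by (intro hyp2F1_continuable_int ni ni' assms)
  have "hyp2F1_reg (of_int N + \<alpha>) (of_int N + \<beta>) (of_int (N + 1 - x)) (c / (c - 1)) =
        (1 - c) powr (of_int N + \<alpha>) * hyp2F1_reg (of_int (N + 1 - x) - (of_int N + \<beta>)) (of_int N + \<alpha>) (of_int (N + 1 - x)) c"
    unfolding hyp2F1_reg_commute[of "of_int N + \<alpha>" "of_int N + \<beta>"]
    by (rule hyp2F1_reg_pfaff[OF ni[OF assms(2)] ni[OF assms(1)] cut])
  also have "of_int (N + 1 - x) - (of_int N + \<beta>) = 1 - of_int x - \<beta>" by simp
  also have "hyp2F1_reg (1 - of_int x - \<beta>) (of_int N + \<alpha>) (of_int (N + 1 - x)) c =
      hyp2F1_reg_series (of_int N + \<alpha>) (1 - of_int x - \<beta>) (of_int (N + 1 - x)) c"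
    unfolding hyp2F1_reg_commute[of "1 - of_int x - \<beta>"]
    by (rule hyp2F1_reg_eq_series[OF cont]) (use assms in simp)
  finally have H: "hyp2F1_reg (of_int N + \<alpha>) (of_int N + \<beta>) (of_int (N + 1 - x)) (c / (c - 1)) =
     (1 - c) powr (of_int N + \<alpha>) * hyp2F1_reg_series (of_int N + \<alpha>) (1 - of_int x - \<beta>) (of_int (N + 1 - x)) c" .
  have pw: "(1 - c) powr (of_int N + \<alpha>) = (1 - c) powi N * (1 - c) powr \<alpha>"
    using nz by (simp add: powr_add complex_powr_of_int)
  have q: "((1 - c) / csqrt c) powi (- N) * (1 - c) powi N = csqrt c powi N"
    using nz by (simp add: power_int_minus power_int_divide_distrib)
  have r: "csqrt c powi N = csqrt c powi x * csqrt c powi (N - x)"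
    using nz by (simp flip: power_int_add)
  have "Gamma (\<alpha> + of_int x) \<noteq> 0"
    using ni[OF assms(1), of x] by (auto simp: Gamma_eq_zero_iff add.commute dest: nonpos_Ints_Int)
  moreover have "\<alpha> + of_int x + of_int (N - x) = of_int N + \<alpha>" "N - x + 1 = N + 1 - x" "of_int x + \<alpha> = \<alpha> + of_int x"
    by simp_all
  ultimately have L: "Gamma (of_int x + \<alpha>) * laurent_coeff (\<alpha> + of_int x) (1 - of_int x - \<beta>) (csqrt c) (N - x) =
      csqrt c powi (N - x) * (Gamma (of_int N + \<alpha>) * hyp2F1_reg_series (of_int N + \<alpha>) (1 - of_int x - \<beta>) (of_int (N + 1 - x)) c)"
    unfolding laurent_coeff_def by (simp only: power2_csqrt) (simp add: mult_ac)
  have "((1 - c) / csqrt c) powi (- N) * (Gamma (of_int N + \<alpha>) *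
           hyp2F1_reg (of_int N + \<alpha>) (of_int N + \<beta>) (of_int (N + 1 - x)) (c / (c - 1))) =
        (((1 - c) / csqrt c) powi (- N) * (1 - c) powi N) * (1 - c) powr \<alpha> *
        (Gamma (of_int N + \<alpha>) * hyp2F1_reg_series (of_int N + \<alpha>) (1 - of_int x - \<beta>) (of_int (N + 1 - x)) c)"
    unfolding H pw by (simp only: mult_ac)
  also have "\<dots> = (1 - c) powr \<alpha> * csqrt c powi x * (csqrt c powi (N - x) *
        (Gamma (of_int N + \<alpha>) * hyp2F1_reg_series (of_int N + \<alpha>) (1 - of_int x - \<beta>) (of_int (N + 1 - x)) c))"
    unfolding q r by (simp only: mult_ac)
  finally show ?thesis unfolding L[symmetric] by (simp only: mult_ac)
qed

definition bilinear_prefactor ::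
  "complex \<Rightarrow> complex \<Rightarrow> int \<Rightarrow> int \<Rightarrow> complex \<Rightarrow> complex \<Rightarrow> complex \<Rightarrow> complex" where
  "bilinear_prefactor \<alpha> \<beta> x y c s t =
     t powi y * Gamma (of_int x + \<alpha>) * Gamma (of_int y + \<beta>) * (1 - c) powr \<alpha> * (1 - s) powr \<beta> *
     csqrt c powi x * csqrt s powi y"

text \<open>Both functions carry the same root \<open>q\<close>, and \<open>q * q\<close> is a
  product of two Gamma values. The one with \<alpha> goes to the function of \<open>x\<close>, the
  one with \<beta> to the function of \<open>y\<close>.\<close>

lemma meixner_product:
  fixes \<epsilon> \<rho> :: real and x y N :: int and c s t :: complex
  defines "\<alpha> \<equiv> of_real \<epsilon> + 1/2 + \<i> * of_real \<rho>" and "\<beta> \<equiv> of_real \<epsilon> + 1/2 - \<i> * of_real \<rho>"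
  assumes "\<alpha> \<notin> \<int>" "\<beta> \<notin> \<int>" "c \<noteq> 0" "norm c < 1" "s \<noteq> 0" "norm s < 1" "t \<noteq> 0"
  shows "meixner N x (- 1/2 + \<i> * of_real \<rho>) \<epsilon> c * meixner N y (- 1/2 + \<i> * of_real \<rho>) \<epsilon> s * t powi N =
    bilinear_prefactor \<alpha> \<beta> x y c s t *
      (t powi (N - y) * (laurent_coeff (\<alpha> + of_int x) (1 - of_int x - \<beta>) (csqrt c) (N - x) *
                         laurent_coeff (\<beta> + of_int y) (1 - of_int y - \<alpha>) (csqrt s) (N - y)))"
proof -
  define h where "h = (\<lambda>x c. hyp2F1_reg (of_int N + \<alpha>) (of_int N + \<beta>) (of_int (N + 1 - x)) (c / (c - 1)))"
  define w where "w = (\<lambda>c. ((1 - c) / csqrt c) powi (- N))"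
  define q where "q = csqrt (Gamma (of_int N + \<alpha>) * Gamma (of_int N + \<beta>))"
  have m: "meixner N z (- 1/2 + \<i> * of_real \<rho>) \<epsilon> d = w d * q * h z d" for z d
  proof -
    have "of_int N + (- 1/2 + \<i> * of_real \<rho>) + of_real \<epsilon> + 1 = of_int N + \<alpha>"
         "of_int N + of_real \<epsilon> + (- 1/2 + \<i> * of_real \<rho>) + 1 = of_int N + \<alpha>"
         "of_int N + of_real \<epsilon> - (- 1/2 + \<i> * of_real \<rho>) = of_int N + \<beta>"
      by (simp_all add: \<alpha>_def \<beta>_def)
    thus ?thesis by (simp only: meixner_def w_def q_def h_def)
  qed
  have q: "q * q = Gamma (of_int N + \<alpha>) * Gamma (of_int N + \<beta>)"
    using power2_csqrt by (simp add: q_def flip: power2_eq_square)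
  have t: "t powi N = t powi y * t powi (N - y)" using assms(9) by (simp flip: power_int_add)
  have "meixner N x (- 1/2 + \<i> * of_real \<rho>) \<epsilon> c * meixner N y (- 1/2 + \<i> * of_real \<rho>) \<epsilon> s * t powi N =
      (q * q) * (w c * h x c) * (w s * h y s) * t powi N" unfolding m by (simp only: mult_ac)
  also have "\<dots> = (w c * (Gamma (of_int N + \<alpha>) * h x c)) * (w s * (Gamma (of_int N + \<beta>) * h y s)) * t powi N"
    unfolding q by (simp only: mult_ac)
  also have "w c * (Gamma (of_int N + \<alpha>) * h x c) =
      (1 - c) powr \<alpha> * Gamma (of_int x + \<alpha>) * csqrt c powi x * laurent_coeff (\<alpha> + of_int x) (1 - of_int x - \<beta>) (csqrt c) (N - x)"
    unfolding w_def h_def by (rule meixner_factor) fact+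
  also have "w s * (Gamma (of_int N + \<beta>) * h y s) =
      (1 - s) powr \<beta> * Gamma (of_int y + \<beta>) * csqrt s powi y * laurent_coeff (\<beta> + of_int y) (1 - of_int y - \<alpha>) (csqrt s) (N - y)"
    unfolding w_def h_def hyp2F1_reg_commute[of "of_int N + \<alpha>"] by (rule meixner_factor) fact+
  finally show ?thesis unfolding t bilinear_prefactor_def by (simp only: mult_ac)
qed

text \<open>The real part \<open>\<epsilon> + 1/2\<close> lies in \<open>[1/2, 3/2)\<close>, whose
  only integer is 1; the excluded pair is the case \<open>\<alpha> = \<beta> = 1\<close>.\<close>

lemma meixner_parameter_notin_Ints:
  fixes \<epsilon> \<rho> :: real
  assumes "0 \<le> \<epsilon>" "\<epsilon> < 1" "(\<rho>, \<epsilon>) \<noteq> (0, 1/2)"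
  shows "of_real \<epsilon> + 1/2 + \<i> * of_real \<rho> \<notin> \<int>" "of_real \<epsilon> + 1/2 - \<i> * of_real \<rho> \<notin> \<int>"
proof -
  have "\<rho> = 0 \<and> \<epsilon> = 1/2" if "z \<in> \<int>" "Re z = \<epsilon> + 1/2" "\<bar>Im z\<bar> = \<bar>\<rho>\<bar>" for z :: complex
  proof -
    from that(1) obtain k where k: "z = of_int k" by (rule Ints_cases)
    hence "\<epsilon> + 1/2 = of_int k" "\<rho> = 0" using that by auto
    moreover from this have "0 < real_of_int k" "real_of_int k < 2" using assms by linarith+
    hence "k = 1" by linarith
    ultimately show ?thesis by simp
  qed
  from this[of "of_real \<epsilon> + 1/2 + \<i> * of_real \<rho>"] this[of "of_real \<epsilon> + 1/2 - \<i> * of_real \<rho>"]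
  show "of_real \<epsilon> + 1/2 + \<i> * of_real \<rho> \<notin> \<int>" "of_real \<epsilon> + 1/2 - \<i> * of_real \<rho> \<notin> \<int>"
    using assms by auto
qed

lemma Gamma_mult_pochhammer:
  fixes z :: complex
  assumes "z \<notin> \<int>"
  shows "Gamma z * pochhammer z n = Gamma (z + of_nat n)"
proof -
  have "z \<notin> \<int>\<^sub>\<le>\<^sub>0" using assms by (auto dest: nonpos_Ints_Int)
  thus ?thesis by (simp add: pochhammer_Gamma Gamma_eq_zero_iff)
qed

lemma powr_of_int_factor:
  fixes z :: complex
  assumes "z \<noteq> 0" "a = b + of_int k"
  shows "z powr a = z powr b * z powi k"
  using assms by (simp add: powr_add complex_powr_of_int)

text \<open>
  The sum of the series for \<open>x < y\<close>.  It agrees with the stated formula where the latter is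
  defined, but has no singularity at \<open>csqrt s * t = csqrt c\<close>.
\<close>

definition bilinear_regular ::
  "complex \<Rightarrow> complex \<Rightarrow> int \<Rightarrow> int \<Rightarrow> complex \<Rightarrow> complex \<Rightarrow> complex \<Rightarrow> complex" where
  "bilinear_regular \<alpha> \<beta> x y c s t =
     bilinear_prefactor \<alpha> \<beta> x y c s t *
     ((1 - csqrt c * (csqrt s * t)) powr (1 - of_int x - \<beta> - (\<alpha> + of_int x)) *
      (1 - s) powr (\<alpha> + of_int x - 1) * (1 - c) powr (- (1 - of_int x - \<beta>)) *
      (pochhammer (\<alpha> + of_int x) (nat (y - x)) *
         ((csqrt c - csqrt s / t) / (1 - csqrt c * (csqrt s * t))) ^ nat (y - x) *
       hyp2F1_reg (1 - (\<alpha> + of_int x)) (1 - of_int x - \<beta>) (of_nat (Suc (nat (y - x))))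
         ((csqrt c - csqrt s * t) * (csqrt c - csqrt s / t) / ((1 - c) * (s - 1)))))"

lemma csqrt_square: "csqrt z * csqrt z = z"
  using power2_csqrt[of z] by (simp add: power2_eq_square)

section \<open>The bilinear sum for either sign of \<open>y - x\<close>\<close>

context
  fixes \<epsilon> \<rho> :: real and x y :: int and c s :: complex and \<alpha> \<beta> :: complex
  assumes \<epsilon>: "0 \<le> \<epsilon>" "\<epsilon> < 1" and \<rho>: "(\<rho>, \<epsilon>) \<noteq> (0, 1/2)"
    and c: "0 < cmod c" "cmod c < 1" and s: "0 < cmod s" "cmod s < 1"
    and \<alpha>: "\<alpha> = of_real \<epsilon> + 1/2 + \<i> * of_real \<rho>" and \<beta>: "\<beta> = of_real \<epsilon> + 1/2 - \<i> * of_real \<rho>"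
begin

lemma \<alpha>_notin: "\<alpha> \<notin> \<int>" and \<beta>_notin: "\<beta> \<notin> \<int>"
  unfolding \<alpha> \<beta> by (rule meixner_parameter_notin_Ints[OF \<epsilon> \<rho>])+

lemma params_notin: "\<alpha> + of_int x \<notin> \<int>" "1 - of_int x - \<beta> \<notin> \<int>" "\<beta> + of_int y \<notin> \<int>"
  using of_int_add_notin_Ints[OF \<alpha>_notin, of x] of_int_add_notin_Ints[OF \<beta>_notin, of y]
    of_int_diff_notin_Ints[OF \<beta>_notin, of "1 - x"] by (simp_all add: add.commute)

definition annulus :: "complex set" where
  "annulus = {t. sqrt (cmod (c * s)) < cmod t \<and> cmod t < 1 / sqrt (cmod (c * s))}"

lemma open_annulus: "open annulus"
  unfolding annulus_def by (intro open_Collect_conj open_Collect_less continuous_intros)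

lemma params_nonzero: "c \<noteq> 0" "s \<noteq> 0" "1 - c \<noteq> 0" "1 - s \<noteq> 0" "csqrt c \<noteq> 0" "csqrt s \<noteq> 0"
  using c s by auto

lemma annulus_nonzero: "t \<in> annulus \<Longrightarrow> t \<noteq> 0"
  by (auto simp: annulus_def norm_mult mult_less_0_iff)

text \<open>The products are \<open>c\<close> and \<open>s\<close> and two mixed ones of norm
  \<open>r * norm t\<close> and \<open>r / norm t\<close> with
  \<open>r = sqrt (cmod (c * s))\<close>; the bounds on \<open>t\<close> say precisely that the
  mixed ones are below 1.\<close>

lemma annulus_less:
  assumes "t \<in> annulus"
  shows "norm (csqrt c * csqrt c) < 1" "norm (csqrt c * (csqrt s * t)) < 1"
    "norm (csqrt s / t * csqrt c) < 1" "norm (csqrt s / t * (csqrt s * t)) < 1"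
proof -
  have t0: "t \<noteq> 0" by (rule annulus_nonzero[OF assms])
  define r where "r = sqrt (cmod (c * s))"
  have r: "r > 0" "r = norm (csqrt c) * norm (csqrt s)" using c s
    by (simp_all add: r_def norm_mult real_sqrt_mult)
  have t: "r < norm t" "norm t < 1 / r" using assms by (simp_all add: annulus_def r_def)
  show "norm (csqrt c * csqrt c) < 1" unfolding csqrt_square by (rule c)
  have "csqrt s / t * (csqrt s * t) = s" using t0 csqrt_square[of s] by (simp add: field_simps)
  thus "norm (csqrt s / t * (csqrt s * t)) < 1" using s by simp
  have "norm (csqrt c * (csqrt s * t)) = r * norm t" by (simp add: norm_mult r)
  also have "\<dots> < 1" using t r(1) by (simp add: field_simps)
  finally show "norm (csqrt c * (csqrt s * t)) < 1" .
  have "norm (csqrt s / t * csqrt c) = r / norm t" by (simp add: norm_mult norm_divide r)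
  also have "\<dots> < 1" using t t0 by simp
  finally show "norm (csqrt s / t * csqrt c) < 1" .
qed

lemma annulus_argument:
  assumes "t \<in> annulus"
  shows "correlation_pfaff_arg (csqrt c) (csqrt s / t) (csqrt c) (csqrt s * t) =
     (csqrt c - csqrt s * t) * (csqrt c - csqrt s / t) / ((1 - c) * (s - 1))" (is "?L = ?R")
    and "(csqrt c - csqrt s * t) * (csqrt c - csqrt s / t) / ((1 - c) * (s - 1)) \<in> cut_plane"
proof -
  have RQ: "csqrt s / t * (csqrt s * t) = s"
    using annulus_nonzero[OF assms] csqrt_square[of s] by (simp add: field_simps)
  have "?R = - ((csqrt c - csqrt s * t) * (csqrt c - csqrt s / t) / ((1 - c) * (1 - s)))"
    unfolding minus_divide_right minus_mult_right minus_diff_eq ..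
  thus eq: "?L = ?R" unfolding correlation_pfaff_arg_def RQ csqrt_square by (simp only: mult_ac)
  show "?R \<in> cut_plane" unfolding eq[symmetric]
    by (rule correlation_pfaff_arg_in_cut_plane[OF annulus_less[OF assms]])
qed

text \<open>A common witness \<open>S\<close> links the two groupings: the first fact is what the
  correlation identity evaluates, the second is the Meixner series.\<close>

lemma bilinear_has_sum:
  assumes t: "t \<in> annulus"
  obtains S where
    "(quad_term (\<alpha> + of_int x) (1 - of_int y - \<alpha>) (1 - of_int x - \<beta>) (\<beta> + of_int y)
        (csqrt c) (csqrt s / t) (csqrt c) (csqrt s * t) has_sum S) (quad_set (y - x))"
    "((\<lambda>n. meixner n x (- 1/2 + \<i> * of_real \<rho>) \<epsilon> c *
           meixner n y (- 1/2 + \<i> * of_real \<rho>) \<epsilon> s * t powi n)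
        has_sum (bilinear_prefactor \<alpha> \<beta> x y c s t * S)) UNIV"
proof -
  have abs: "(\<lambda>q. norm (quad_term (\<alpha> + of_int x) (1 - of_int y - \<alpha>) (1 - of_int x - \<beta>) (\<beta> + of_int y)
        (csqrt c) (csqrt s / t) (csqrt c) (csqrt s * t) q)) summable_on (quad_set (y - x))"
    by (rule quad_term_abs_summable[OF annulus_less[OF t]])
  then obtain S where S: "(quad_term (\<alpha> + of_int x) (1 - of_int y - \<alpha>) (1 - of_int x - \<beta>) (\<beta> + of_int y)
        (csqrt c) (csqrt s / t) (csqrt c) (csqrt s * t) has_sum S) (quad_set (y - x))"
    using abs_summable_summable by (auto simp: summable_on_def)
  have "((\<lambda>N. t powi (N - y) * (laurent_coeff (\<alpha> + of_int x) (1 - of_int x - \<beta>) (csqrt c) (N - x) *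
          laurent_coeff (\<beta> + of_int y) (1 - of_int y - \<alpha>) (csqrt s) (N - y))) has_sum S) UNIV"
    by (rule quad_term_has_sum_laurent[OF _ _ _ _ _ _ _ abs S])
       (use params_notin params_nonzero annulus_nonzero[OF t] c s in simp_all)
  from has_sum_cmult_right[OF this, of "bilinear_prefactor \<alpha> \<beta> x y c s t"]
  have "((\<lambda>n. meixner n x (- 1/2 + \<i> * of_real \<rho>) \<epsilon> c *
           meixner n y (- 1/2 + \<i> * of_real \<rho>) \<epsilon> s * t powi n)
        has_sum (bilinear_prefactor \<alpha> \<beta> x y c s t * S)) UNIV"
    using meixner_product[of \<epsilon> \<rho> c s t _ x y, folded \<alpha> \<beta>] \<alpha>_notin \<beta>_notin params_nonzero c s annulus_nonzero[OF t]
    by simp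
  with S show ?thesis by (rule that)
qed

lemma Gamma_norm_square:
  "of_real ((cmod (Gamma (of_int x + of_real \<epsilon> + 1/2 + \<i> * of_real \<rho>)))\<^sup>2) =
     Gamma (of_int x + \<alpha>) * Gamma (of_int x + \<beta>)"
proof -
  have "of_int x + of_real \<epsilon> + 1/2 + \<i> * of_real \<rho> = of_int x + \<alpha>" "cnj (of_int x + \<alpha>) = of_int x + \<beta>"
    by (simp_all add: \<alpha> \<beta>)
  thus ?thesis by (simp only: complex_norm_square cnj_Gamma)
qed

lemma meixner_bilinear_formula_eq:
  "meixner_bilinear_formula \<rho> \<epsilon> x y c s t =
     t powi y * (1 - s) powr (\<alpha> + \<beta> - 1 + of_int y) * (1 - c) powr (\<alpha> + \<beta> - 1 + of_int y) *
     (1 - csqrt c * (csqrt s * t)) powr (1 - \<alpha> - \<beta> - of_int x - of_int y) *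
     (csqrt s * t - csqrt c) powi (x - y) * csqrt c powi x * csqrt s powi y *
     (Gamma (of_int x + \<alpha>) * Gamma (of_int x + \<beta>)) *
     hyp2F1_reg (1 - of_int y - \<beta>) (1 - of_int y - \<alpha>) (of_int (1 + x - y))
       ((csqrt c - csqrt s * t) * (csqrt c - csqrt s / t) / ((1 - c) * (s - 1)))"
proof -
  have "of_real (2 * \<epsilon> + of_int y) = \<alpha> + \<beta> - 1 + of_int y"
       "of_real (- 2 * \<epsilon> - of_int x - of_int y) = 1 - \<alpha> - \<beta> - of_int x - of_int y"
       "- of_int y - of_real \<epsilon> + 1/2 + \<i> * of_real \<rho> = 1 - of_int y - \<beta>"
       "- of_int y - of_real \<epsilon> + 1/2 - \<i> * of_real \<rho> = 1 - of_int y - \<alpha>"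
    by (simp_all add: \<alpha> \<beta>)
  thus ?thesis unfolding meixner_bilinear_formula_def Gamma_norm_square by (simp only: mult.assoc)
qed

text \<open>The sign from reflecting the Pochhammer symbol turns
  \<open>(csqrt c - csqrt s * t) ^ m\<close> into the power of the statement, and the remaining
  symbol raises \<open>Gamma (y + \<beta>)\<close> to \<open>Gamma (x + \<beta>)\<close>.\<close>

lemma bilinear_formula_ge:
  assumes "y \<le> x" and t: "t \<in> annulus"
    and S: "(quad_term (\<alpha> + of_int x) (1 - of_int y - \<alpha>) (1 - of_int x - \<beta>) (\<beta> + of_int y)
        (csqrt c) (csqrt s / t) (csqrt c) (csqrt s * t) has_sum S) (quad_set (y - x))"
  shows "bilinear_prefactor \<alpha> \<beta> x y c s t * S = meixner_bilinear_formula \<rho> \<epsilon> x y c s t"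
proof -
  define m where "m = nat (x - y)"
  have m: "x = y + int m" using assms by (simp add: m_def)
  have RQ: "csqrt s / t * (csqrt s * t) = s"
    using annulus_nonzero[OF t] csqrt_square[of s] by (simp add: field_simps)
  define H where "H = hyp2F1_reg (1 - of_int y - \<beta>) (1 - of_int y - \<alpha>) (of_int (1 + x - y))
       ((csqrt c - csqrt s * t) * (csqrt c - csqrt s / t) / ((1 - c) * (s - 1)))"
  have "S = (1 - csqrt c * (csqrt s * t)) powr (1 - of_int x - \<beta> + of_nat m - (\<alpha> + of_int x)) *
       (1 - csqrt s / t * (csqrt s * t)) powr (\<alpha> + of_int x - 1 - of_nat m) *
       (1 - csqrt c * csqrt c) powr (- (1 - of_int x - \<beta>) - of_nat m) *
       (pochhammer (1 - of_int x - \<beta>) m * (csqrt c - csqrt s * t) ^ m *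
        hyp2F1_reg (1 - of_int x - \<beta> + of_nat m) (1 + of_nat m - (\<alpha> + of_int x)) (of_nat (Suc m))
         (correlation_pfaff_arg (csqrt c) (csqrt s / t) (csqrt c) (csqrt s * t)))"
    by (rule quad_term_total_swapped[OF annulus_less[OF t]])
       (use S params_notin in \<open>simp_all add: m\<close>)
  also have "1 - of_int x - \<beta> + of_nat m - (\<alpha> + of_int x) = 1 - \<alpha> - \<beta> - of_int x - of_int y" by (simp add: m)
  also have "\<alpha> + of_int x - 1 - of_nat m = \<alpha> - 1 + of_int y" by (simp add: m)
  also have "- (1 - of_int x - \<beta>) - of_nat m = \<beta> - 1 + of_int y" by (simp add: m)
  also have "1 - of_int x - \<beta> + of_nat m = 1 - of_int y - \<beta>" by (simp add: m)
  also have "1 + of_nat m - (\<alpha> + of_int x) = 1 - of_int y - \<alpha>" by (simp add: m)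
  also have "(of_nat (Suc m) :: complex) = of_int (1 + x - y)" by (simp add: m)
  finally have S_eq: "S = (1 - csqrt c * (csqrt s * t)) powr (1 - \<alpha> - \<beta> - of_int x - of_int y) *
       (1 - s) powr (\<alpha> - 1 + of_int y) * (1 - c) powr (\<beta> - 1 + of_int y) *
       (pochhammer (1 - of_int x - \<beta>) m * (csqrt c - csqrt s * t) ^ m * H)"
    unfolding RQ csqrt_square annulus_argument(1)[OF t] H_def .
  have "pochhammer (1 - of_int x - \<beta>) m = (- 1) ^ m * pochhammer (of_int y + \<beta>) m"
    using pochhammer_reflect[of "of_int y + \<beta>" m] by (simp add: m algebra_simps)
  moreover have "(- 1) ^ m * (csqrt c - csqrt s * t) ^ m = (csqrt s * t - csqrt c) ^ m"
    by (simp flip: power_mult_distrib)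
  ultimately have p: "pochhammer (1 - of_int x - \<beta>) m * (csqrt c - csqrt s * t) ^ m =
      pochhammer (of_int y + \<beta>) m * (csqrt s * t - csqrt c) ^ m" by (simp add: mult_ac)
  have G: "Gamma (of_int y + \<beta>) * pochhammer (of_int y + \<beta>) m = Gamma (of_int x + \<beta>)"
    using Gamma_mult_pochhammer[OF of_int_add_notin_Ints[OF \<beta>_notin]] by (simp add: m add_ac)
  have e1: "(1 - s) powr \<beta> * (1 - s) powr (\<alpha> - 1 + of_int y) = (1 - s) powr (\<alpha> + \<beta> - 1 + of_int y)"
    by (simp add: algebra_simps flip: powr_add)
  have e2: "(1 - c) powr \<alpha> * (1 - c) powr (\<beta> - 1 + of_int y) = (1 - c) powr (\<alpha> + \<beta> - 1 + of_int y)"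
    by (simp add: algebra_simps flip: powr_add)
  have pw: "(csqrt s * t - csqrt c) powi (x - y) = (csqrt s * t - csqrt c) ^ m" by (simp add: m)
  have "bilinear_prefactor \<alpha> \<beta> x y c s t * S =
      t powi y * ((1 - s) powr \<beta> * (1 - s) powr (\<alpha> - 1 + of_int y)) * ((1 - c) powr \<alpha> * (1 - c) powr (\<beta> - 1 + of_int y)) *
      (1 - csqrt c * (csqrt s * t)) powr (1 - \<alpha> - \<beta> - of_int x - of_int y) *
      (csqrt s * t - csqrt c) powi (x - y) * csqrt c powi x * csqrt s powi y *
      (Gamma (of_int x + \<alpha>) * (Gamma (of_int y + \<beta>) * pochhammer (of_int y + \<beta>) m)) * H"
    unfolding S_eq bilinear_prefactor_def p pw by (simp only: mult_ac)
  thus ?thesis unfolding meixner_bilinear_formula_eq e1 e2 G H_def .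
qed

lemma bilinear_regular_eq_sum:
  assumes "x < y" and t: "t \<in> annulus"
    and S: "(quad_term (\<alpha> + of_int x) (1 - of_int y - \<alpha>) (1 - of_int x - \<beta>) (\<beta> + of_int y)
        (csqrt c) (csqrt s / t) (csqrt c) (csqrt s * t) has_sum S) (quad_set (y - x))"
  shows "bilinear_prefactor \<alpha> \<beta> x y c s t * S = bilinear_regular \<alpha> \<beta> x y c s t"
proof -
  define n where "n = nat (y - x)"
  have n: "y = x + int n" using assms by (simp add: n_def)
  have RQ: "csqrt s / t * (csqrt s * t) = s"
    using annulus_nonzero[OF t] csqrt_square[of s] by (simp add: field_simps)
  have "S = (1 - csqrt c * (csqrt s * t)) powr (1 - of_int x - \<beta> - (\<alpha> + of_int x)) *
       (1 - csqrt s / t * (csqrt s * t)) powr (\<alpha> + of_int x - 1) *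
       (1 - csqrt c * csqrt c) powr (- (1 - of_int x - \<beta>)) *
       (pochhammer (\<alpha> + of_int x) n * ((csqrt c - csqrt s / t) / (1 - csqrt c * (csqrt s * t))) ^ n *
        hyp2F1_reg (1 - (\<alpha> + of_int x)) (1 - of_int x - \<beta>) (of_nat (Suc n))
         (correlation_pfaff_arg (csqrt c) (csqrt s / t) (csqrt c) (csqrt s * t)))"
    by (rule quad_term_total[OF annulus_less[OF t]])
       (use S params_notin in \<open>simp_all add: n\<close>)
  thus ?thesis
    unfolding bilinear_regular_def RQ csqrt_square annulus_argument(1)[OF t] n_def by (simp only:)
qed

text \<open>The lower parameter is \<open>1 - n\<close>, and shifting it to \<open>1 + n\<close>
  produces \<open>W ^ n\<close>. Its factor \<open>(csqrt s * t - csqrt c) ^ n\<close> cancels the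
  negative power, while its denominators account for the exponents of \<open>1 - c\<close> and
  \<open>1 - s\<close> differing by \<open>n\<close>. The two reflection signs cancel each
  other.\<close>

lemma bilinear_regular_eq_formula:
  assumes "x < y" and t: "t \<in> annulus" and ne: "csqrt s * t \<noteq> csqrt c"
  shows "bilinear_regular \<alpha> \<beta> x y c s t = meixner_bilinear_formula \<rho> \<epsilon> x y c s t"
proof -
  define n where "n = nat (y - x)"
  have n: "y = x + int n" using assms by (simp add: n_def)
  define W where "W = (csqrt c - csqrt s * t) * (csqrt c - csqrt s / t) / ((1 - c) * (s - 1))"
  define V where "V = 1 - csqrt c * (csqrt s * t)"
  define H where "H = hyp2F1_reg (1 - of_int x - \<beta>) (1 - of_int x - \<alpha>) (1 + of_nat n) W"
  have V: "V \<noteq> 0" using annulus_less(2)[OF t] by (auto simp: V_def)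
  have "hyp2F1_reg (1 - of_int y - \<beta>) (1 - of_int y - \<alpha>) (1 - of_nat n) W =
      pochhammer (1 - of_int y - \<beta>) n * pochhammer (1 - of_int y - \<alpha>) n * W ^ n *
      hyp2F1_reg (1 - of_int y - \<beta> + of_nat n) (1 - of_int y - \<alpha> + of_nat n) (1 + of_nat n) W"
    using of_int_diff_notin_Ints[OF \<beta>_notin, of "1 - y"] of_int_diff_notin_Ints[OF \<alpha>_notin, of "1 - y"]
    by (intro hyp2F1_reg_shift annulus_argument(2)[OF t, folded W_def]) simp_all
  also have "1 - of_int y - \<beta> + of_nat n = 1 - of_int x - \<beta>" by (simp add: n)
  also have "1 - of_int y - \<alpha> + of_nat n = 1 - of_int x - \<alpha>" by (simp add: n)
  also have "pochhammer (1 - of_int y - \<beta>) n = (- 1) ^ n * pochhammer (of_int x + \<beta>) n"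
    using pochhammer_reflect[of "of_int x + \<beta>" n] by (simp add: n algebra_simps)
  also have "pochhammer (1 - of_int y - \<alpha>) n = (- 1) ^ n * pochhammer (of_int x + \<alpha>) n"
    using pochhammer_reflect[of "of_int x + \<alpha>" n] by (simp add: n algebra_simps)
  also have "(- 1) ^ n * pochhammer (of_int x + \<beta>) n * ((- 1) ^ n * pochhammer (of_int x + \<alpha>) n) =
      pochhammer (of_int x + \<alpha>) n * pochhammer (of_int x + \<beta>) n"
    by (simp add: mult_ac flip: power_add power_mult_distrib)
  finally have hyp: "hyp2F1_reg (1 - of_int y - \<beta>) (1 - of_int y - \<alpha>) (of_int (1 + x - y)) W =
      pochhammer (of_int x + \<alpha>) n * pochhammer (of_int x + \<beta>) n * W ^ n * H"
    by (simp add: n H_def)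
  have G\<beta>: "Gamma (of_int y + \<beta>) = Gamma (of_int x + \<beta>) * pochhammer (of_int x + \<beta>) n"
    using Gamma_mult_pochhammer[OF of_int_add_notin_Ints[OF \<beta>_notin], of x n] by (simp add: n add_ac)
  have QP: "csqrt s * t - csqrt c \<noteq> 0" using ne by simp
  have "W = (csqrt s * t - csqrt c) * (csqrt c - csqrt s / t) / ((1 - c) * (1 - s))"
    unfolding W_def using params_nonzero by (simp add: divide_simps) (simp add: algebra_simps)
  hence Wn: "W ^ n = (csqrt s * t - csqrt c) ^ n * (csqrt c - csqrt s / t) ^ n / ((1 - c) ^ n * (1 - s) ^ n)"
    by (simp add: power_divide power_mult_distrib)
  have pw: "(csqrt s * t - csqrt c) powi (x - y) = inverse ((csqrt s * t - csqrt c) ^ n)"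
    by (simp add: n power_int_minus)
  have W': "(csqrt s * t - csqrt c) powi (x - y) * W ^ n * ((1 - c) ^ n * (1 - s) ^ n) = (csqrt c - csqrt s / t) ^ n"
    unfolding pw Wn using QP params_nonzero by simp
  have e1: "(1 - s) powr (\<alpha> + \<beta> - 1 + of_int y) = (1 - s) powr \<beta> * (1 - s) powr (\<alpha> + of_int x - 1) * (1 - s) ^ n"
    using params_nonzero(4) powr_of_int_factor[of "1 - s" "\<alpha> + \<beta> - 1 + of_int y" "\<beta> + (\<alpha> + of_int x - 1)" "int n"]
    by (simp add: n powr_add)
  have e2: "(1 - c) powr (\<alpha> + \<beta> - 1 + of_int y) = (1 - c) powr \<alpha> * (1 - c) powr (- (1 - of_int x - \<beta>)) * (1 - c) ^ n"
    using params_nonzero(3) powr_of_int_factor[of "1 - c" "\<alpha> + \<beta> - 1 + of_int y" "\<alpha> + (- (1 - of_int x - \<beta>))" "int n"]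
    by (simp add: n powr_add)
  have "V powr (1 - of_int x - \<beta> - (\<alpha> + of_int x)) = V powr (1 - \<alpha> - \<beta> - of_int x - of_int y) * V ^ n"
    using powr_of_int_factor[OF V, of "1 - of_int x - \<beta> - (\<alpha> + of_int x)" "1 - \<alpha> - \<beta> - of_int x - of_int y" "int n"]
    by (simp add: n)
  hence e3: "V powr (1 - of_int x - \<beta> - (\<alpha> + of_int x)) * ((csqrt c - csqrt s / t) / V) ^ n =
      V powr (1 - \<alpha> - \<beta> - of_int x - of_int y) * (csqrt c - csqrt s / t) ^ n"
    using V by (simp add: power_divide)
  have "bilinear_regular \<alpha> \<beta> x y c s t =
      t powi y * Gamma (of_int x + \<alpha>) * Gamma (of_int y + \<beta>) * csqrt c powi x * csqrt s powi y *
      ((1 - s) powr \<beta> * (1 - s) powr (\<alpha> + of_int x - 1)) * ((1 - c) powr \<alpha> * (1 - c) powr (- (1 - of_int x - \<beta>))) *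
      (V powr (1 - of_int x - \<beta> - (\<alpha> + of_int x)) * ((csqrt c - csqrt s / t) / V) ^ n) * pochhammer (of_int x + \<alpha>) n * H"
  proof -
    have H': "hyp2F1_reg (1 - (\<alpha> + of_int x)) (1 - of_int x - \<beta>) (of_nat (Suc n)) W = H"
      unfolding H_def by (subst hyp2F1_reg_commute) (simp add: algebra_simps)
    show ?thesis
      unfolding bilinear_regular_def bilinear_prefactor_def n_def[symmetric] V_def[symmetric] W_def[symmetric] H'
      by (simp only: mult_ac add.commute[of \<alpha> "of_int x"])
  qed
  also have "\<dots> = t powi y * ((1 - s) powr \<beta> * (1 - s) powr (\<alpha> + of_int x - 1) * (1 - s) ^ n) *
      ((1 - c) powr \<alpha> * (1 - c) powr (- (1 - of_int x - \<beta>)) * (1 - c) ^ n) *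
      V powr (1 - \<alpha> - \<beta> - of_int x - of_int y) * (csqrt s * t - csqrt c) powi (x - y) * csqrt c powi x * csqrt s powi y *
      (Gamma (of_int x + \<alpha>) * Gamma (of_int x + \<beta>)) *
      (pochhammer (of_int x + \<alpha>) n * pochhammer (of_int x + \<beta>) n * W ^ n * H)"
    unfolding e3 G\<beta> W'[symmetric] by (simp only: mult_ac)
  also have "\<dots> = meixner_bilinear_formula \<rho> \<epsilon> x y c s t"
    unfolding meixner_bilinear_formula_eq V_def[symmetric] W_def[symmetric] e1 e2 hyp ..
  finally show ?thesis .
qed

lemma isCont_bilinear_regular:
  assumes t: "t \<in> annulus"
  shows "isCont (bilinear_regular \<alpha> \<beta> x y c s) t"
proof -
  define H where "H = hyp2F1_reg (1 - (\<alpha> + of_int x)) (1 - of_int x - \<beta>) (of_nat (Suc (nat (y - x))))"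
  define W where "W = (\<lambda>t. (csqrt c - csqrt s * t) * (csqrt c - csqrt s / t) / ((1 - c) * (s - 1)))"
  have t0: "t \<noteq> 0" by (rule annulus_nonzero[OF t])
  have "1 - (\<alpha> + of_int x) \<notin> \<int>" using of_int_diff_notin_Ints[OF params_notin(1), of 1] by simp
  hence "H holomorphic_on cut_plane" unfolding H_def
    by (intro hyp2F1_reg_holomorphic hyp2F1_continuable_pos_int params_notin)
  hence "isCont H (W t)" unfolding W_def
    by (rule continuous_on_interior[OF holomorphic_on_imp_continuous_on])
       (simp only: interior_open[OF open_cut_plane] annulus_argument(2)[OF t])
  moreover have "isCont W t" unfolding W_def by (intro continuous_intros) (use t0 params_nonzero in auto)
  ultimately have H: "isCont (\<lambda>t. H (W t)) t" by (rule isCont_o2[rotated])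
  have "Re (1 - csqrt c * (csqrt s * t)) > 0" by (rule Re_one_minus_pos[OF annulus_less(2)[OF t]])
  hence V: "1 - csqrt c * (csqrt s * t) \<notin> \<real>\<^sub>\<le>\<^sub>0" by (auto simp: complex_nonpos_Reals_iff)
  hence V0: "1 - csqrt c * (csqrt s * t) \<noteq> 0" by auto
  have "isCont (\<lambda>t. t powi y) t" by (intro continuous_intros) (rule t0)
  moreover have "isCont (\<lambda>t. (1 - csqrt c * (csqrt s * t)) powr (1 - of_int x - \<beta> - (\<alpha> + of_int x))) t"
    by (intro isCont_powr_complex V) (intro continuous_intros)+
  moreover have "isCont (\<lambda>t. ((csqrt c - csqrt s / t) / (1 - csqrt c * (csqrt s * t))) ^ nat (y - x)) t"
    by (intro continuous_intros t0 V0)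
  moreover note H[unfolded H_def W_def]
  ultimately show ?thesis
    unfolding bilinear_regular_def[abs_def] bilinear_prefactor_def
    by (intro isCont_mult continuous_const)
qed

text \<open>As \<open>csqrt s \<noteq> 0\<close>, the equation \<open>csqrt s * u = csqrt c\<close>
  has a single solution; around it the formula agrees with the regular expression, whose continuity
  gives the limit.\<close>

lemma bilinear_rhs_eq_regular:
  assumes "x < y" "t \<in> annulus"
  shows "meixner_bilinear_rhs \<rho> \<epsilon> x y c s t = bilinear_regular \<alpha> \<beta> x y c s t"
proof (cases "csqrt s * t = csqrt c")
  case True
  have "\<forall>\<^sub>F u in at t. u \<in> annulus \<and> u \<noteq> t"
    using eventually_at_in_open[OF open_annulus assms(2)] by simp
  hence "\<forall>\<^sub>F u in at t. bilinear_regular \<alpha> \<beta> x y c s u = meixner_bilinear_formula \<rho> \<epsilon> x y c s u"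
  proof eventually_elim
    case (elim u)
    hence "csqrt s * u \<noteq> csqrt c" using True params_nonzero by (metis mult_left_cancel)
    thus ?case using elim assms by (intro bilinear_regular_eq_formula) auto
  qed
  moreover have "bilinear_regular \<alpha> \<beta> x y c s \<midarrow>t\<rightarrow> bilinear_regular \<alpha> \<beta> x y c s t"
    using isCont_bilinear_regular[OF assms(2)] by (simp add: isCont_def)
  ultimately have "meixner_bilinear_formula \<rho> \<epsilon> x y c s \<midarrow>t\<rightarrow> bilinear_regular \<alpha> \<beta> x y c s t"
    by (rule Lim_transform_eventually[rotated])
  hence "Lim (at t) (meixner_bilinear_formula \<rho> \<epsilon> x y c s) = bilinear_regular \<alpha> \<beta> x y c s t"
    by (intro tendsto_Lim) auto
  thus ?thesis using True assms by (simp add: meixner_bilinear_rhs_def)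
next
  case False
  thus ?thesis using assms bilinear_regular_eq_formula by (simp add: meixner_bilinear_rhs_def)
qed

lemma meixner_bilinear_has_sum:
  assumes t: "t \<in> annulus"
  shows "((\<lambda>n. meixner n x (- 1/2 + \<i> * of_real \<rho>) \<epsilon> c *
           meixner n y (- 1/2 + \<i> * of_real \<rho>) \<epsilon> s * t powi n)
        has_sum meixner_bilinear_rhs \<rho> \<epsilon> x y c s t) UNIV"
proof (rule bilinear_has_sum[OF t])
  fix S
  assume S: "(quad_term (\<alpha> + of_int x) (1 - of_int y - \<alpha>) (1 - of_int x - \<beta>) (\<beta> + of_int y)
        (csqrt c) (csqrt s / t) (csqrt c) (csqrt s * t) has_sum S) (quad_set (y - x))"
    and sum: "((\<lambda>n. meixner n x (- 1/2 + \<i> * of_real \<rho>) \<epsilon> c *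
           meixner n y (- 1/2 + \<i> * of_real \<rho>) \<epsilon> s * t powi n)
        has_sum (bilinear_prefactor \<alpha> \<beta> x y c s t * S)) UNIV"
  have "bilinear_prefactor \<alpha> \<beta> x y c s t * S = meixner_bilinear_rhs \<rho> \<epsilon> x y c s t"
  proof (cases "x < y")
    case True
    thus ?thesis using bilinear_regular_eq_sum[OF True t S] bilinear_rhs_eq_regular[OF True t] by simp
  next
    case False
    thus ?thesis using bilinear_formula_ge[OF _ t S] by (simp add: meixner_bilinear_rhs_def)
  qed
  with sum show ?thesis by simp
qed

end

theorem theorem4p3:
  fixes \<epsilon> \<rho> :: real and x y :: int and c s t :: complex
  assumes "0 \<le> \<epsilon>" and "\<epsilon> < 1" and "0 \<le> \<rho>" and "(\<rho>, \<epsilon>) \<noteq> (0, 1/2)"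
    and "0 < cmod c" and "cmod c < 1" and "0 < cmod s" and "cmod s < 1"
    and "sqrt (cmod (c * s)) < cmod t" and "cmod t < 1 / sqrt (cmod (c * s))"
  shows "((\<lambda>n::int. meixner n x (- 1/2 + \<i> * of_real \<rho>) \<epsilon> c *
                    meixner n y (- 1/2 + \<i> * of_real \<rho>) \<epsilon> s * t powi n)
          has_sum meixner_bilinear_rhs \<rho> \<epsilon> x y c s t) UNIV"
  using assms
  by (intro meixner_bilinear_has_sum[OF _ _ _ _ _ _ _ refl refl]) (simp_all add: annulus_def)

end
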